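(* Let $T$, $\Gamma$, $V$, $W$, $J$, $R$, $\mathcal{V}$, $A_0$, $A_1$, $V_0$ and the approximations $\tilde A_0,\tilde A_1$ with $\|A_j-\tilde A_j\|\le\epsilon$ ($j=0,1$) be as in the context. Let $M=\sup_{z\in\mathrm{int}(\Gamma)}\|R(z)\|$ and let $\tilde F(z)=\tilde{\mathcal{U}}^*\tilde A_1\tilde V_0-z\,\tilde{\mathcal{U}}^*\tilde A_0\tilde V_0$, where $\tilde A_0=\tilde{\mathcal{U}}\tilde\Sigma_0\tilde V_0^*$ is the singular value decomposition of $\tilde A_0$. For $\delta>0$ put $$\gamma_\pm=\delta\pm\Bigl(2\|A_0^\dagger\|\,\|A_1\|+1+\sup_{z\in\mathrm{int}(\Gamma)}|z|\Bigr)\epsilon,$$ $$\delta_-=\frac{\gamma_-}{\|VW^*\|\,\|VW^*\mathcal{V}\|+M\gamma_-},\qquad \delta_+=\frac{\gamma_+}{\sigma_m(VW^* )\,\sigma_m(VW^*\mathcal{V})-M\gamma_+}.$$ Then, provided that $\gamma_->0$ and that $\gamma_+$ is sufficiently small (smaller than a positive constant depending only on $T$, $\Gamma$, $\mathcal{V}$), $$\Lambda_{\delta_-}(T)\cap\mathrm{int}(\Gamma)\subset\Lambda_\delta(\tilde F)\cap\mathrm{int}(\Gamma)\subset\Lambda_{\delta_+}(T)\cap\mathrm{int}(\Gamma).$$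
   Context: Nonlinear eigenproblem: $\Omega\subset\mathbb{C}$ is a non-empty domain, $\mathcal{H}$ a Hilbert space, and for each $z\in\Omega$, $T(z)$ is a closed linear operator in $\mathcal{H}$ with densely defined domain $\mathcal{D}(T)$ independent of $z$, such that $z\mapsto T(z)u$ is holomorphic on $\Omega$ for each $u\in\mathcal{D}(T)$, and $T(z)$ is Fredholm for all $z\in\Omega$. $\Lambda(T)$ is the set of $z\in\Omega$ for which $T(z)$ is not invertible (no bounded everywhere defined inverse), and $\rho(T)=\Omega\setminus\Lambda(T)$. Contour: $\Gamma\subset\Omega$ is a closed rectifiable Jordan curve that does not intersect $\Lambda(T)$ and bounds a simply connected region $\mathrm{int}(\Gamma)\subset\Omega$ containing eigenvalues $\lambda_1,\dots,\lambda_m$ of $T$ (counted with algebraic multiplicity; these are all the points of $\Lambda(T)$ in $\mathrm{int}(\Gamma)$). Keldysh's expansion (known theorem, used to define $V,W,J,R$): on a neighbourhood of the closure of $\mathrm{int}(\Gamma)$, for $z\in\rho(T)$, $$T(z)^{-1}=V(zI-J)^{-1}W^*+R(z),$$ where $V,W$ are quasimatrices with $m$ columns in $\mathcal{H}$ (i.e. linear maps $\mathbb{C}^m\to\mathcal{H}$) consisting of suitably normalized generalized right and left eigenvectors of $T$, $J\in\mathbb{C}^{m\times m}$ is block diagonal with the Jordan blocks of the eigenvalues inside $\Gamma$, and $R$ is holomorphic with values in the bounded operators on $\mathcal{H}$. Test functions: $\mathcal{V}$ is a fixed realization of a random quasimatrix with $m+p$ columns in $\mathcal{H}$ (a linear map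 $\mathbb{C}^{m+p}\to\mathcal{H}$), where $p\ge 0$ is an oversampling integer. When $\mathcal{H}=L^2(\mathcal{X})$, $\mathcal{X}\subseteq\mathbb{R}^d$, the columns are drawn independently from the mean-zero Gaussian process with covariance kernel $K_{\mathrm{SE}}(x,y)=\frac{1}{\mu\sqrt{2\pi}}\exp(-(x-y)^2/(2\mu^2))$, $\mu>0$; the process is analogous for other Hilbert spaces. Exact contour integrals: $$A_0=\frac{1}{2\pi i}\int_\Gamma T(z)^{-1}\mathcal{V}\,dz=VW^*\mathcal{V},\qquad A_1=\frac{1}{2\pi i}\int_\Gamma zT(z)^{-1}\mathcal{V}\,dz=VJW^*\mathcal{V}.$$ $A_0=\mathcal{U}\Sigma_0V_0^*$ is the economized singular value decomposition, where $\mathcal{U}$ is a quasimatrix with $m$ orthonormal columns in $\mathcal{H}$, $\Sigma_0\in\mathbb{C}^{m\times m}$ is diagonal, and $V_0\in\mathbb{C}^{(m+p)\times m}$ has orthonormal columns. It is assumed that $VW^*\mathcal{V}V_0$ has rank $m$. Computed quantities: $\tilde A_0,\tilde A_1$ are quasimatrices with $m+p$ columns in $\mathcal{H}$, obtained by approximating the integrals by a quadrature rule $\tilde A_0\approx\frac{1}{2\pi i}\sum_{k=1}^{\ell} w_kT(z_k)^{-1}\mathcal{V}$, $\tilde A_1\approx\frac{1}{2\pi i}\sum_{k=1}^{\ell} w_kz_kT(z_k)^{-1}\mathcal{V}$ followed by an $m$-truncated singular value decomposition. It is assumed that $\|A_j-\tilde A_j\|\le\epsilon$ for $j=0,1$,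 where $\epsilon>0$, and that $A_0,A_1,\tilde A_0,\tilde A_1$ all have rank $m$. In $\tilde A_0=\tilde{\mathcal{U}}\tilde\Sigma_0\tilde V_0^*$ (economized SVD), $\tilde{\mathcal{U}}$ has $m$ orthonormal columns in $\mathcal{H}$ and $\tilde V_0\in\mathbb{C}^{(m+p)\times m}$ has orthonormal columns; thus $\tilde F(z)\in\mathbb{C}^{m\times m}$. Notation: norms are operator norms; $\sigma_m(\cdot)$ is the $m$-th largest singular value; $A_0^\dagger$ is the Moore–Penrose pseudoinverse. $\Lambda_\eta(T)=\bigcup_E\Lambda(T+E)$, the union over all holomorphic $E:\Omega\to\mathcal{B}(\mathcal{H})$ with $\sup_{z\in\Omega}\|E(z)\|<\eta$. $\Lambda_\delta(\tilde F)=\{z:\sigma_{\mathrm{inf}}(\tilde F(z))<\delta\}$, with $\sigma_{\mathrm{inf}}(\tilde F(z))=\min\{\|\tilde F(z)x\|:x\in\mathbb{C}^m,\|x\|=1\}$. *)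

theory Defs
  imports "HOL-Complex_Analysis.Complex_Analysis" "HOL-Library.Multiset"
begin

section \<open>Complex Hilbert spaces\<close>

text \<open>The inner product is conjugate linear in its first argument.\<close>

class complex_hilbert = banach +
  fixes scaleC :: "complex \<Rightarrow> 'a \<Rightarrow> 'a"  (infixr "*\<^sub>C" 75)
    and cinner :: "'a \<Rightarrow> 'a \<Rightarrow> complex"
  assumes scaleC_add_right: "a *\<^sub>C (x + y) = a *\<^sub>C x + a *\<^sub>C y"
    and scaleC_add_left: "(a + b) *\<^sub>C x = a *\<^sub>C x + b *\<^sub>C x"
    and scaleC_scaleC: "a *\<^sub>C (b *\<^sub>C x) = (a * b) *\<^sub>C x"
    and scaleR_scaleC: "r *\<^sub>R x = complex_of_real r *\<^sub>C x"
    and cinner_commute: "cinner x y = cnj (cinner y x)"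
    and cinner_add_right: "cinner x (y + z) = cinner x y + cinner x z"
    and cinner_scaleC_right: "cinner x (a *\<^sub>C y) = a * cinner x y"
    and cinner_self: "cinner x x = complex_of_real ((norm x)\<^sup>2)"

instantiation complex :: complex_hilbert
begin

definition scaleC_complex :: "complex \<Rightarrow> complex \<Rightarrow> complex" where
  "scaleC_complex a x = a * x"

definition cinner_complex :: "complex \<Rightarrow> complex \<Rightarrow> complex" where
  "cinner_complex x y = cnj x * y"

instance
proof
  fix x :: complex
  show "cinner x x = complex_of_real ((norm x)\<^sup>2)"
    unfolding cinner_complex_def
    by (metis complex_norm_square mult.commute of_real_power)
qed (auto simp: scaleC_complex_def cinner_complex_def algebra_simps scaleR_conv_of_real)

end

text \<open>In particular \<open>complex ^ 'n\<close> carries the standard inner product and the Euclidean norm.\<close>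

instantiation vec :: (complex_hilbert, finite) complex_hilbert
begin

definition scaleC_vec :: "complex \<Rightarrow> 'a ^ 'b \<Rightarrow> 'a ^ 'b" where
  "scaleC_vec a x = (\<chi> i. a *\<^sub>C (x $ i))"

definition cinner_vec :: "'a ^ 'b \<Rightarrow> 'a ^ 'b \<Rightarrow> complex" where
  "cinner_vec x y = (\<Sum>i\<in>UNIV. cinner (x $ i) (y $ i))"

instance
proof
  fix x y z :: "'a ^ 'b" and a b :: complex and r :: real
  show "a *\<^sub>C (x + y) = a *\<^sub>C x + a *\<^sub>C y"
    by (simp add: scaleC_vec_def vec_eq_iff scaleC_add_right)
  show "(a + b) *\<^sub>C x = a *\<^sub>C x + b *\<^sub>C x"
    by (simp add: scaleC_vec_def vec_eq_iff scaleC_add_left)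
  show "a *\<^sub>C (b *\<^sub>C x) = (a * b) *\<^sub>C x"
    by (simp add: scaleC_vec_def vec_eq_iff scaleC_scaleC)
  show "r *\<^sub>R x = complex_of_real r *\<^sub>C x"
    by (simp add: scaleC_vec_def vec_eq_iff scaleR_scaleC)
  show "cinner x y = cnj (cinner y x)"
    unfolding cinner_vec_def by (subst cinner_commute) simp
  show "cinner x (y + z) = cinner x y + cinner x z"
    by (simp add: cinner_vec_def cinner_add_right sum.distrib)
  show "cinner x (a *\<^sub>C y) = a * cinner x y"
    by (simp add: cinner_vec_def scaleC_vec_def cinner_scaleC_right sum_distrib_left)
  show "cinner x x = complex_of_real ((norm x)\<^sup>2)"
    by (simp add: cinner_vec_def norm_vec_def L2_set_def cinner_self sum_nonneg)
qed

end

global_interpretation cvs: vector_space "scaleC :: complex \<Rightarrow> 'a \<Rightarrow> 'a::complex_hilbert"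
  by standard (auto simp: scaleC_add_right scaleC_add_left scaleC_scaleC,
    metis of_real_1 scaleR_one scaleR_scaleC)

definition clinear :: "('a::complex_hilbert \<Rightarrow> 'b::complex_hilbert) \<Rightarrow> bool" where
  "clinear A \<longleftrightarrow> Vector_Spaces.linear (*\<^sub>C) (*\<^sub>C) A"

definition bounded_clinear :: "('a::complex_hilbert \<Rightarrow> 'b::complex_hilbert) \<Rightarrow> bool" where
  "bounded_clinear A \<longleftrightarrow> clinear A \<and> bounded_linear A"

definition cadjoint :: "('a::complex_hilbert \<Rightarrow> 'b::complex_hilbert) \<Rightarrow> 'b \<Rightarrow> 'a" where
  "cadjoint A = (THE B. \<forall>x y. cinner (A x) y = cinner x (B y))"

text \<open>The value is the junk value 0 for operators of infinite rank.\<close>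

definition crank :: "('a::complex_hilbert \<Rightarrow> 'b::complex_hilbert) \<Rightarrow> nat" where
  "crank A = cvs.dim (range A)"

definition pseudoinverse :: "('a::complex_hilbert \<Rightarrow> 'b::complex_hilbert) \<Rightarrow> 'b \<Rightarrow> 'a" where
  "pseudoinverse A = (THE B. bounded_clinear B
     \<and> A \<circ> B \<circ> A = A \<and> B \<circ> A \<circ> B = B
     \<and> (\<forall>x y. cinner (A (B x)) y = cinner x (A (B y)))
     \<and> (\<forall>x y. cinner (B (A x)) y = cinner x (B (A y))))"


section \<open>Singular values\<close>

text \<open>A singular value decomposition with \<open>k\<close> terms of a finite rank operator; some of the
  \<open>s i\<close> may vanish.\<close>

definition finite_svd ::
  "nat \<Rightarrow> ('a::complex_hilbert \<Rightarrow> 'b::complex_hilbert) \<Rightarrow> (nat \<Rightarrow> 'b) \<Rightarrow> (nat \<Rightarrow> real) \<Rightarrow> (nat \<Rightarrow> 'a) \<Rightarrow> bool"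
where
  "finite_svd k A u s v \<longleftrightarrow>
     (\<forall>i<k. \<forall>j<k. cinner (u i) (u j) = (if i = j then 1 else 0)) \<and>
     (\<forall>i<k. \<forall>j<k. cinner (v i) (v j) = (if i = j then 1 else 0)) \<and>
     (\<forall>i<k. 0 \<le> s i) \<and> (\<forall>i<k. \<forall>j<k. i \<le> j \<longrightarrow> s j \<le> s i) \<and>
     (\<forall>x. A x = (\<Sum>i<k. (complex_of_real (s i) * cinner (v i) x) *\<^sub>C u i))"

text \<open>The \<open>j\<close>-th largest singular value (\<open>j = 1, 2, \<dots>\<close>) of a finite rank operator.\<close>

definition singular_value :: "nat \<Rightarrow> ('a::complex_hilbert \<Rightarrow> 'b::complex_hilbert) \<Rightarrow> real" where
  "singular_value j A =
     (THE t. \<exists>k u s v. finite_svd k A u s v \<and> t = (if j \<le> k then s (j - 1) else 0))"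

definition sigma_inf :: "('a::complex_hilbert \<Rightarrow> 'b::complex_hilbert) \<Rightarrow> real" where
  "sigma_inf A = Inf {norm (A x) | x. norm x = 1}"

definition orthonormal_columns :: "(complex ^ 'm \<Rightarrow> 'h::complex_hilbert) \<Rightarrow> bool" where
  "orthonormal_columns U \<longleftrightarrow>
     clinear U \<and> (\<forall>i j. cinner (U (axis i 1)) (U (axis j 1)) = (if i = j then 1 else 0))"

definition economized_svd ::
  "(complex ^ 'n \<Rightarrow> 'h::complex_hilbert) \<Rightarrow> (complex ^ 'm \<Rightarrow> 'h) \<Rightarrow> complex ^ 'm ^ 'm
    \<Rightarrow> complex ^ 'm ^ 'n \<Rightarrow> bool"
where
  "economized_svd A U S V \<longleftrightarrow>
     orthonormal_columns U \<and> orthonormal_columns ((*v) V) \<and>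
     (\<forall>i j. i \<noteq> j \<longrightarrow> S $ i $ j = 0) \<and> (\<forall>i. S $ i $ i \<in> \<real> \<and> 0 \<le> Re (S $ i $ i)) \<and>
     (\<forall>x. A x = U (S *v cadjoint ((*v) V) x))"


section \<open>Holomorphic functions with values in a Hilbert space or in the bounded operators\<close>

definition vec_holomorphic_on :: "(complex \<Rightarrow> 'h::complex_hilbert) \<Rightarrow> complex set \<Rightarrow> bool" where
  "vec_holomorphic_on f S \<longleftrightarrow>
     (\<forall>z\<in>S. \<exists>f'. (f has_derivative (\<lambda>h. h *\<^sub>C f')) (at z within S))"

definition cderiv :: "(complex \<Rightarrow> 'h::complex_hilbert) \<Rightarrow> complex \<Rightarrow> 'h" where
  "cderiv f z = (THE f'. (f has_derivative (\<lambda>h. h *\<^sub>C f')) (at z))"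

text \<open>Complex differentiability with respect to the operator norm.\<close>

definition op_holomorphic_on :: "(complex \<Rightarrow> 'h \<Rightarrow> 'h::complex_hilbert) \<Rightarrow> complex set \<Rightarrow> bool" where
  "op_holomorphic_on A S \<longleftrightarrow>
     (\<forall>z\<in>S. bounded_clinear (A z)) \<and>
     (\<forall>z\<in>S. \<exists>A'. bounded_clinear A' \<and>
        ((\<lambda>w. onorm (\<lambda>u. (1 / (w - z)) *\<^sub>C (A w u - A z u) - A' u)) \<longlongrightarrow> 0) (at z within S))"


section \<open>Nonlinear eigenproblems\<close>

text \<open>An operator with domain \<open>D\<close> is a total function whose values outside \<open>D\<close> are ignored.\<close>

definition fredholm_on :: "'h set \<Rightarrow> ('h \<Rightarrow> 'h::complex_hilbert) \<Rightarrow> bool" where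
  "fredholm_on D A \<longleftrightarrow>
     (\<exists>B. finite B \<and> {u\<in>D. A u = 0} \<subseteq> cvs.span B) \<and>
     closed (A ` D) \<and> (\<exists>B. finite B \<and> cvs.span (A ` D \<union> B) = UNIV)"

definition closed_operator_on :: "'h set \<Rightarrow> ('h \<Rightarrow> 'h::complex_hilbert) \<Rightarrow> bool" where
  "closed_operator_on D A \<longleftrightarrow>
     (\<forall>u\<in>D. \<forall>v\<in>D. A (u + v) = A u + A v) \<and> (\<forall>a. \<forall>u\<in>D. A (a *\<^sub>C u) = a *\<^sub>C A u) \<and>
     closed ((\<lambda>u. (u, A u)) ` D)"

definition invertible_on :: "'h set \<Rightarrow> ('h \<Rightarrow> 'h::complex_hilbert) \<Rightarrow> bool" where
  "invertible_on D A \<longleftrightarrow> bij_betw A D UNIV \<and> bounded_clinear (inv_into D A)"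

definition nonlinear_eigenproblem ::
  "complex set \<Rightarrow> 'h set \<Rightarrow> (complex \<Rightarrow> 'h \<Rightarrow> 'h::complex_hilbert) \<Rightarrow> bool"
where
  "nonlinear_eigenproblem \<Omega> D T \<longleftrightarrow>
     open \<Omega> \<and> connected \<Omega> \<and> \<Omega> \<noteq> {} \<and>
     cvs.subspace D \<and> closure D = UNIV \<and>
     (\<forall>z\<in>\<Omega>. closed_operator_on D (T z) \<and> fredholm_on D (T z)) \<and>
     (\<forall>u\<in>D. vec_holomorphic_on (\<lambda>z. T z u) \<Omega>)"

definition nl_spectrum ::
  "complex set \<Rightarrow> 'h set \<Rightarrow> (complex \<Rightarrow> 'h \<Rightarrow> 'h::complex_hilbert) \<Rightarrow> complex set"
where
  "nl_spectrum \<Omega> D T = {z\<in>\<Omega>. \<not> invertible_on D (T z)}"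

definition pseudospectrum ::
  "real \<Rightarrow> complex set \<Rightarrow> 'h set \<Rightarrow> (complex \<Rightarrow> 'h \<Rightarrow> 'h::complex_hilbert) \<Rightarrow> complex set"
where
  "pseudospectrum \<eta> \<Omega> D T =
     \<Union> {nl_spectrum \<Omega> D (\<lambda>z u. T z u + E z u) | E.
        op_holomorphic_on E \<Omega> \<and> bdd_above ((\<lambda>z. onorm (E z)) ` \<Omega>) \<and>
        (SUP z\<in>\<Omega>. onorm (E z)) < \<eta>}"

definition matrix_pseudospectrum ::
  "real \<Rightarrow> (complex \<Rightarrow> complex ^ 'm \<Rightarrow> complex ^ 'm) \<Rightarrow> complex set"
where
  "matrix_pseudospectrum \<delta> F = {z. sigma_inf (F z) < \<delta>}"


section \<open>Rectifiable contours and contour integrals\<close>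

definition rectifiable_path :: "(real \<Rightarrow> complex) \<Rightarrow> bool" where
  "rectifiable_path g \<longleftrightarrow> path g \<and>
     (\<exists>B. \<forall>d. d division_of {0..1} \<longrightarrow> (\<Sum>k\<in>d. norm (g (Sup k) - g (Inf k))) \<le> B)"

text \<open>The Riemann-Stieltjes integral along a path. The library's contour integral requires a
  piecewise continuously differentiable path and a complex-valued integrand.\<close>

definition has_path_integral ::
  "(complex \<Rightarrow> 'h::complex_hilbert) \<Rightarrow> 'h \<Rightarrow> (real \<Rightarrow> complex) \<Rightarrow> bool"
where
  "has_path_integral f I g \<longleftrightarrow>
     (\<forall>e>0. \<exists>d>0. \<forall>p. p tagged_division_of {0..1} \<and> (\<forall>(t, k)\<in>p. Sup k - Inf k < d) \<longrightarrow>
        norm ((\<Sum>(t, k)\<in>p. (g (Sup k) - g (Inf k)) *\<^sub>C f (g t)) - I) < e)"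

definition path_integral ::
  "(real \<Rightarrow> complex) \<Rightarrow> (complex \<Rightarrow> 'h::complex_hilbert) \<Rightarrow> 'h"
where
  "path_integral g f = (THE I. has_path_integral f I g)"

text \<open>The curve is positively oriented. The interior of a Jordan curve is simply connected.\<close>

definition admissible_contour ::
  "complex set \<Rightarrow> 'h set \<Rightarrow> (complex \<Rightarrow> 'h \<Rightarrow> 'h::complex_hilbert) \<Rightarrow> (real \<Rightarrow> complex) \<Rightarrow> bool"
where
  "admissible_contour \<Omega> D T g \<longleftrightarrow>
     rectifiable_path g \<and> simple_path g \<and> pathfinish g = pathstart g \<and>
     (\<forall>z\<in>inside (path_image g). winding_number g z = 1) \<and>
     path_image g \<subseteq> \<Omega> \<and> inside (path_image g) \<subseteq> \<Omega> \<and>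
     path_image g \<inter> nl_spectrum \<Omega> D T = {}"

definition contour_moment ::
  "nat \<Rightarrow> 'h set \<Rightarrow> (complex \<Rightarrow> 'h \<Rightarrow> 'h::complex_hilbert) \<Rightarrow> (real \<Rightarrow> complex)
    \<Rightarrow> (complex ^ 'n \<Rightarrow> 'h) \<Rightarrow> complex ^ 'n \<Rightarrow> 'h"
where
  "contour_moment j D T g X x =
     (1 / (2 * complex_of_real pi * \<i>)) *\<^sub>C path_integral g (\<lambda>z. z ^ j *\<^sub>C inv_into D (T z) (X x))"


section \<open>Keldysh's expansion\<close>

definition jordan_chain ::
  "'h set \<Rightarrow> (complex \<Rightarrow> 'h \<Rightarrow> 'h::complex_hilbert) \<Rightarrow> complex \<Rightarrow> 'h list \<Rightarrow> bool"
where
  "jordan_chain D T \<mu> c \<longleftrightarrow> c \<noteq> [] \<and> set c \<subseteq> D \<and> hd c \<noteq> 0 \<and>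
     (\<forall>i<length c. (\<Sum>j\<le>i. (1 / fact j) *\<^sub>C (cderiv ^^ j) (\<lambda>z. T z (c ! (i - j))) \<mu>) = 0)"

text \<open>A chain of generalized left eigenvectors, i.e. a Jordan chain of the adjoint family,
  written in weak form because the adjoints may be unbounded with varying domains.\<close>

definition left_jordan_chain ::
  "'h set \<Rightarrow> (complex \<Rightarrow> 'h \<Rightarrow> 'h::complex_hilbert) \<Rightarrow> complex \<Rightarrow> 'h list \<Rightarrow> bool"
where
  "left_jordan_chain D T \<mu> c \<longleftrightarrow> c \<noteq> [] \<and> hd c \<noteq> 0 \<and>
     (\<forall>i<length c. \<forall>u\<in>D.
        (\<Sum>j\<le>i. (1 / fact j) * cinner (c ! (i - j)) ((cderiv ^^ j) (\<lambda>z. T z u) \<mu>)) = 0)"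

text \<open>A canonical system of Jordan chains at \<open>\<mu>\<close>; the sum of the lengths of its chains is the
  algebraic multiplicity of \<open>\<mu>\<close>.\<close>

definition canonical_system ::
  "'h set \<Rightarrow> (complex \<Rightarrow> 'h \<Rightarrow> 'h::complex_hilbert) \<Rightarrow> complex \<Rightarrow> 'h list list \<Rightarrow> bool"
where
  "canonical_system D T \<mu> cs \<longleftrightarrow>
     (\<forall>c\<in>set cs. jordan_chain D T \<mu> c) \<and>
     distinct (map hd cs) \<and> \<not> cvs.dependent (hd ` set cs) \<and>
     cvs.span (hd ` set cs) = {u\<in>D. T \<mu> u = 0} \<and>
     (\<forall>l<length cs. \<forall>c. jordan_chain D T \<mu> c \<and> hd c \<notin> cvs.span (hd ` set (take l cs))
        \<longrightarrow> length c \<le> length (cs ! l))"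

text \<open>\<open>J\<close> is block diagonal with Jordan blocks. A block \<open>(is, \<mu>)\<close> lists its row and column indices
  in order; the index type itself carries no order.\<close>

definition jordan_form :: "complex ^ 'm ^ 'm \<Rightarrow> ('m list \<times> complex) list \<Rightarrow> bool" where
  "jordan_form J bs \<longleftrightarrow>
     distinct (concat (map fst bs)) \<and> set (concat (map fst bs)) = UNIV \<and>
     (\<forall>b\<in>set bs. fst b \<noteq> []) \<and>
     (\<forall>k<length bs. \<forall>l<length bs. \<forall>a<length (fst (bs ! k)). \<forall>b<length (fst (bs ! l)).
        J $ (fst (bs ! k) ! a) $ (fst (bs ! l) ! b) =
          (if k = l \<and> a = b then snd (bs ! k) else if k = l \<and> b = Suc a then 1 else 0))"

text \<open>The normalization of the eigenvectors is the one that makes the expansion hold. With ones on the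
  superdiagonal of \<open>J\<close>, the left eigenvector of a block is the last of its columns of \<open>W\<close>.\<close>

definition keldysh_expansion ::
  "complex set \<Rightarrow> 'h set \<Rightarrow> (complex \<Rightarrow> 'h \<Rightarrow> 'h::complex_hilbert) \<Rightarrow> (real \<Rightarrow> complex)
    \<Rightarrow> (complex ^ 'm \<Rightarrow> 'h) \<Rightarrow> (complex ^ 'm \<Rightarrow> 'h) \<Rightarrow> complex ^ 'm ^ 'm
    \<Rightarrow> (complex \<Rightarrow> 'h \<Rightarrow> 'h) \<Rightarrow> bool"
where
  "keldysh_expansion \<Omega> D T g V W J R \<longleftrightarrow>
     clinear V \<and> clinear W \<and>
     (\<exists>bs. jordan_form J bs \<and>
        snd ` set bs = nl_spectrum \<Omega> D T \<inter> inside (path_image g) \<and>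
        (\<forall>\<mu>\<in>snd ` set bs. \<exists>cs. canonical_system D T \<mu> cs \<and>
           mset cs = mset (map (\<lambda>b. map (\<lambda>i. V (axis i 1)) (fst b)) (filter (\<lambda>b. snd b = \<mu>) bs))) \<and>
        (\<forall>b\<in>set bs. left_jordan_chain D T (snd b) (rev (map (\<lambda>i. W (axis i 1)) (fst b))))) \<and>
     (\<exists>N. open N \<and> closure (inside (path_image g)) \<subseteq> N \<and> N \<subseteq> \<Omega> \<and>
        op_holomorphic_on R N \<and>
        (\<forall>z\<in>N - nl_spectrum \<Omega> D T. \<forall>f.
           inv_into D (T z) f = V (matrix_inv (mat z - J) *v cadjoint W f) + R z f))"

definition projected_pencil ::
  "(complex ^ 'm \<Rightarrow> 'h::complex_hilbert) \<Rightarrow> complex ^ 'm ^ 'n \<Rightarrow> (complex ^ 'n \<Rightarrow> 'h) \<Rightarrow> (complex ^ 'n \<Rightarrow> 'h)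
    \<Rightarrow> complex \<Rightarrow> complex ^ 'm \<Rightarrow> complex ^ 'm"
where
  "projected_pencil U V A0 A1 z x = cadjoint U (A1 (V *v x)) - z *\<^sub>C cadjoint U (A0 (V *v x))"

end

theory Submission
  imports Defs
begin

text \<open>
  Write \<open>B = A1 - z A0\<close>. By the residue theorem Keldysh's expansion gives \<open>A0 = V W\<^sup>* X\<close> and
  \<open>A1 = V J W\<^sup>* X\<close> (lemma \<open>keldysh_contour_moments\<close>), so \<open>B = V (J - z) W\<^sup>* X\<close>, and the rank conditions make \<open>V\<close>
  injective and \<open>W\<^sup>* X\<close> surjective. The projected pencil is within \<open>(1 + \<bar>z\<bar>) \<epsilon>\<close> of the compression
  \<open>U'\<^sup>* B V'\<close> of \<open>B\<close> to the computed singular subspaces. Everything rests on comparing this \<open>m\<close> by \<open>m\<close>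
  matrix with the part \<open>V (z - J)\<^sup>-\<^sup>1 W\<^sup>*\<close> of the inverse of \<open>T z\<close>; the other part is bounded by \<open>M\<close>.
  Moreover \<open>z\<close> lies in the \<open>\<theta>\<close>-pseudospectrum of \<open>T\<close> if and only if it lies in the spectrum or the
  inverse of \<open>T z\<close> has norm greater than \<open>1 / \<theta>\<close>: a Neumann series shows one direction, a rank one
  perturbation the other.

  For the first inclusion, suppose that the projected pencil is bounded below by \<open>\<delta>\<close>. Then the compression
  is bounded below by \<open>\<gamma>\<^sub>m\<close>, so its square factors \<open>U'\<^sup>* V\<close>, \<open>J - z\<close> and \<open>W\<^sup>* X V'\<close> are invertible. Solving for
  the middle factor bounds \<open>V (z - J)\<^sup>-\<^sup>1 W\<^sup>*\<close> (lemma \<open>exact_pencil_lower_bound\<close>).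

  For the second inclusion, a vector on which the projected pencil is small has to be turned into one on
  which \<open>B\<close> itself is small. The operator \<open>B\<close> maps into the range of \<open>A0\<close> and vanishes on its kernel, and
  the angles between the singular subspaces of \<open>A0\<close> and of its approximation have sines at most
  \<open>\<eta> = \<parallel>A0\<^sup>\<dagger>\<parallel> \<epsilon>\<close>. So only a factor \<open>1 - \<eta>\<^sup>2\<close> is lost (lemma \<open>exact_pencil_small_vector\<close>). This loss is of
  second order in \<open>\<epsilon>\<close> and is covered by the term \<open>2 \<parallel>A0\<^sup>\<dagger>\<parallel> \<parallel>A1\<parallel> \<epsilon>\<close> of \<open>\<gamma>\<^sub>p\<close> as soon as \<open>\<gamma>\<^sub>p\<close> is small. The
  smallest singular values of \<open>V W\<^sup>*\<close> and \<open>V W\<^sup>* X\<close> then bound \<open>V (z - J)\<^sup>-\<^sup>1 W\<^sup>*\<close> from below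
  (lemma \<open>resolvent_large\<close>).

  Three foundations are needed. Singular values are defined by a definite description, and
  \<open>singular_value_full_rank\<close> shows by a variational characterization that it denotes. The contour
  is only rectifiable, and \<open>has_path_integral_nearby\<close> reduces its Riemann-Stieltjes integrals to the residue
  calculus on a smooth path. Finally the smallness constant must not depend on the chosen expansion, which
  follows from the uniqueness of \<open>V W\<^sup>*\<close> and \<open>R\<close> (lemma \<open>keldysh_expansion_unique\<close>).
\<close>

section \<open>Linear algebra in complex Hilbert spaces\<close>

lemma cinner_add_left: "cinner (x + y) z = cinner x z + cinner y z"
  by (metis cinner_commute cinner_add_right complex_cnj_add)

lemma cinner_scaleC_left: "cinner (a *\<^sub>C x) y = cnj a * cinner x y"
  by (metis cinner_commute cinner_scaleC_right complex_cnj_mult)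

lemma cinner_zero_right [simp]: "cinner x 0 = 0"
  by (metis cinner_scaleC_right cvs.scale_zero_left mult_zero_left)

lemma cinner_zero_left [simp]: "cinner 0 x = 0"
  by (metis cinner_commute cinner_zero_right complex_cnj_zero)

lemma cinner_diff_right: "cinner x (y - z) = cinner x y - cinner x z"
  by (metis add_diff_cancel cinner_add_right diff_add_cancel)

lemma cinner_diff_left: "cinner (x - y) z = cinner x z - cinner y z"
  by (metis add_diff_cancel cinner_add_left diff_add_cancel)

lemma cinner_sum_right: "cinner x (\<Sum>i\<in>I. f i) = (\<Sum>i\<in>I. cinner x (f i))"
  by (induction I rule: infinite_finite_induct) (auto simp: cinner_add_right)

lemma cinner_sum_left: "cinner (\<Sum>i\<in>I. f i) x = (\<Sum>i\<in>I. cinner (f i) x)"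
  by (induction I rule: infinite_finite_induct) (auto simp: cinner_add_left)

lemma norm_eq_cinner: "(norm x)\<^sup>2 = Re (cinner x x)"
  by (simp add: cinner_self)

lemma cinner_self_eq_0 [simp]: "cinner x x = 0 \<longleftrightarrow> x = 0"
  by (simp add: cinner_self)

lemma norm_scaleC [simp]: "norm (a *\<^sub>C x) = cmod a * norm x"
proof -
  have "complex_of_real ((norm (a *\<^sub>C x))\<^sup>2) = a * cnj a * cinner x x"
    by (simp only: cinner_self[symmetric] cinner_scaleC_left cinner_scaleC_right mult_ac)
  also have "\<dots> = complex_of_real ((cmod a * norm x)\<^sup>2)"
    by (simp only: cinner_self complex_norm_square[symmetric] power_mult_distrib of_real_mult of_real_power)
  finally have "(norm (a *\<^sub>C x))\<^sup>2 = (cmod a * norm x)\<^sup>2"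
    by (simp only: of_real_eq_iff)
  then show ?thesis by (simp add: power2_eq_iff_nonneg)
qed

lemma norm_add_squared:
  "(norm (x + y))\<^sup>2 = (norm x)\<^sup>2 + (norm y)\<^sup>2 + 2 * Re (cinner x y)"
proof -
  have "Re (cinner y x) = Re (cinner x y)"
    by (metis cinner_commute cnj.simps(1))
  then show ?thesis by (simp add: norm_eq_cinner cinner_add_left cinner_add_right)
qed

lemma norm_diff_squared:
  "(norm (x - y))\<^sup>2 = (norm x)\<^sup>2 + (norm y)\<^sup>2 - 2 * Re (cinner x y)"
proof -
  have "Re (cinner y x) = Re (cinner x y)"
    by (metis cinner_commute cnj.simps(1))
  then show ?thesis by (simp add: norm_eq_cinner cinner_diff_left cinner_diff_right)
qed

lemma cauchy_schwarz: "cmod (cinner x y) \<le> norm x * norm y"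
proof (cases "y = 0")
  case False
  define a where "a = cinner y x / complex_of_real ((norm y)\<^sup>2)"
  have n: "norm y > 0" using False by simp
  have "cinner x (a *\<^sub>C y) = cinner y x * cnj (cinner y x) / complex_of_real ((norm y)\<^sup>2)"
    by (simp add: a_def cinner_scaleC_right flip: cinner_commute)
  also have "\<dots> = complex_of_real ((cmod (cinner y x))\<^sup>2 / (norm y)\<^sup>2)"
    by (metis complex_norm_square of_real_divide of_real_power)
  finally have c: "Re (cinner x (a *\<^sub>C y)) = (cmod (cinner y x))\<^sup>2 / (norm y)\<^sup>2"
    by (metis Re_complex_of_real)
  have "cmod a = cmod (cinner y x) / (norm y)\<^sup>2"
    by (simp add: a_def norm_divide norm_power)
  then have "(norm (a *\<^sub>C y))\<^sup>2 = (cmod (cinner y x))\<^sup>2 / (norm y)\<^sup>2"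
    using n by (simp add: power_mult_distrib power_divide field_simps power2_eq_square)
  with c norm_diff_squared[of x "a *\<^sub>C y"]
  have "0 \<le> (norm x)\<^sup>2 - (cmod (cinner y x))\<^sup>2 / (norm y)\<^sup>2"
    by (smt (verit) zero_le_power2)
  then have "(cmod (cinner y x))\<^sup>2 \<le> (norm x * norm y)\<^sup>2"
    using n by (simp add: field_simps power_mult_distrib)
  then have "cmod (cinner y x) \<le> norm x * norm y"
    by (simp add: power2_le_iff_abs_le)
  then show ?thesis by (metis cinner_commute complex_mod_cnj)
qed simp

lemma cinner_eqI: "(\<And>x. cinner x y = cinner x z) \<Longrightarrow> y = z"
  by (metis cinner_diff_right cinner_self_eq_0 right_minus_eq)


lemma clinear_add: "clinear A \<Longrightarrow> A (x + y) = A x + A y"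
  unfolding clinear_def by (rule module_hom.add[OF Vector_Spaces.linear.axioms(3)])

lemma clinear_scaleC: "clinear A \<Longrightarrow> A (a *\<^sub>C x) = a *\<^sub>C A x"
  unfolding clinear_def by (rule module_hom.scale[OF Vector_Spaces.linear.axioms(3)])

lemma clinearI:
  assumes "\<And>x y. A (x + y) = A x + A y" "\<And>a x. A (a *\<^sub>C x) = a *\<^sub>C A x"
  shows "clinear A"
  unfolding clinear_def using assms by unfold_locales auto

lemma clinear_zero: "clinear A \<Longrightarrow> A 0 = 0"
  by (metis clinear_scaleC cvs.scale_zero_left)

lemma clinear_diff: "clinear A \<Longrightarrow> A (x - y) = A x - A y"
  by (metis add_diff_cancel clinear_add diff_add_cancel)

lemma clinear_sum: "clinear A \<Longrightarrow> A (\<Sum>i\<in>I. f i) = (\<Sum>i\<in>I. A (f i))"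
  by (induction I rule: infinite_finite_induct) (auto simp: clinear_add clinear_zero)

lemma clinear_compose: "clinear A \<Longrightarrow> clinear B \<Longrightarrow> clinear (A \<circ> B)"
  by (intro clinearI) (auto simp: clinear_add clinear_scaleC)

lemma clinear_imp_linear: "clinear A \<Longrightarrow> linear A"
  by (intro linearI) (auto simp: clinear_add clinear_scaleC scaleR_scaleC)

lemma clinear_bounded_linear:
  fixes A :: "complex ^ 'n \<Rightarrow> 'h::complex_hilbert"
  shows "clinear A \<Longrightarrow> bounded_linear A"
  using clinear_imp_linear linear_conv_bounded_linear by blast

lemma clinear_inj_iff:
  assumes "clinear A"
  shows "inj A \<longleftrightarrow> (\<forall>x. A x = 0 \<longrightarrow> x = 0)"
proof
  assume "inj A"
  then show "\<forall>x. A x = 0 \<longrightarrow> x = 0"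
    using clinear_zero[OF assms] by (metis injD)
next
  assume z: "\<forall>x. A x = 0 \<longrightarrow> x = 0"
  show "inj A"
  proof (rule injI)
    fix x y assume "A x = A y"
    then have "A (x - y) = 0" by (simp add: clinear_diff[OF assms])
    with z have "x - y = 0" by blast
    then show "x = y" by simp
  qed
qed

lemma scaleC_vec_nth [simp]: "(a *\<^sub>C x) $ i = a * (x :: complex ^ 'n) $ i"
  by (simp add: scaleC_vec_def scaleC_complex_def)

lemma scaleC_eq_vector_scalar_mult: "(*\<^sub>C) = ((*s) :: complex \<Rightarrow> complex ^ 'n \<Rightarrow> _)"
  by (auto simp: fun_eq_iff vec_eq_iff)

lemma clinear_matrix_vector_mult: "clinear ((*v) (A :: complex ^ 'm ^ 'n))"
  by (intro clinearI)
    (auto simp: vec_eq_iff matrix_vector_mult_def distrib_left sum.distrib sum_distrib_left mult_ac)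

lemma vec_sum_axis: "(x :: complex ^ 'm) = (\<Sum>i\<in>UNIV. (x $ i) *\<^sub>C axis i 1)"
  by (auto simp: vec_eq_iff axis_def if_distrib cong: if_cong)

lemma clinear_sum_axis:
  fixes A :: "complex ^ 'm \<Rightarrow> 'h::complex_hilbert"
  assumes "clinear A"
  shows "A x = (\<Sum>i\<in>UNIV. (x $ i) *\<^sub>C A (axis i 1))"
  by (subst vec_sum_axis) (simp add: clinear_sum[OF assms] clinear_scaleC[OF assms])

lemma cinner_axis_left [simp]: "cinner (axis i 1) (x :: complex ^ 'm) = x $ i"
  by (simp add: cinner_vec_def cinner_complex_def axis_def if_distrib[of cnj] if_distrib[of "\<lambda>a. a * _"] cong: if_cong)

lemma norm_axis_complex: "norm (axis i 1 :: complex ^ 'm) = 1"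
  using norm_eq_cinner[of "axis i 1 :: complex ^ 'm"] norm_ge_zero[of "axis i 1 :: complex ^ 'm"]
  by (simp add: power2_eq_1_iff)

lemma clinear_inj_iff_surj:
  fixes G :: "complex ^ 'm \<Rightarrow> complex ^ 'm"
  assumes "clinear G"
  shows "inj G \<longleftrightarrow> surj G"
proof -
  have "Vector_Spaces.linear (*s) (*s) G"
    using assms by (simp add: clinear_def scaleC_eq_vector_scalar_mult)
  then show ?thesis
    using vec.linear_injective_imp_surjective vec.linear_surjective_imp_injective by blast
qed

text \<open>If \<open>V (G (c b)) = b\<close> for the elements \<open>b\<close> of a basis of the range, then the vectors \<open>G (c b)\<close> are
  \<open>m\<close> independent vectors of \<open>complex ^ 'm\<close>. They form a basis, contained in the range of \<open>G\<close>,
  that \<open>V\<close> maps to independent vectors.\<close>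

lemma crank_factorization:
  fixes V :: "complex ^ 'm \<Rightarrow> 'b::complex_hilbert" and G :: "'a::complex_hilbert \<Rightarrow> complex ^ 'm"
  assumes V: "clinear V" and G: "clinear G" and r: "crank (V \<circ> G) = CARD('m)"
  shows "inj V \<and> surj G"
proof -
  interpret V: Vector_Spaces.linear "(*\<^sub>C)" "(*\<^sub>C)" V
    using V by (simp add: clinear_def)
  interpret P: vector_space_pair "(*\<^sub>C) :: complex \<Rightarrow> complex ^ 'm \<Rightarrow> _" "(*\<^sub>C) :: complex \<Rightarrow> 'b \<Rightarrow> _"
    by unfold_locales
  obtain B where B: "B \<subseteq> range (V \<circ> G)" "\<not> cvs.dependent B" "card B = CARD('m)"
    using cvs.basis_exists[of "range (V \<circ> G)"] r by (metis crank_def)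
  have fB: "finite B"
    using B(3) card.infinite by fastforce
  define c where "c b = (SOME x. V (G x) = b)" for b
  have c: "V (G (c b)) = b" if "b \<in> B" for b
  proof -
    from that B(1) have "\<exists>x. V (G x) = b" by auto
    then show ?thesis unfolding c_def by (rule someI_ex)
  qed
  define E where "E = (\<lambda>b. G (c b)) ` B"
  have injE: "inj_on V E" and VE: "V ` E = B"
    by (auto simp: E_def c inj_on_def image_image)
  have fE: "finite E" using fB by (simp add: E_def)
  have cE: "card E = CARD('m)" using card_image[OF injE] VE B(3) by simp
  have indE: "\<not> cvs.dependent E"
  proof
    assume "cvs.dependent E"
    then obtain e where e: "e \<in> E" "e \<in> cvs.span (E - {e})"
      by (auto simp: cvs.dependent_def)
    have "V e \<in> cvs.span (V ` (E - {e}))"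
      using e(2) by (simp add: V.span_image)
    also have "V ` (E - {e}) = B - {V e}"
      using injE e(1) VE by (auto simp: inj_on_def)
    finally show False
      using B(2) e(1) VE by (auto simp: cvs.dependent_def)
  qed
  have spanE: "cvs.span E = UNIV"
    using vec.card_ge_dim_independent[of E UNIV] indE cE
    by (auto simp: scaleC_eq_vector_scalar_mult card_cart_basis)
  have "inj V"
    unfolding clinear_inj_iff[OF V]
  proof (intro allI impI)
    fix x assume "V x = 0"
    then show "x = 0"
      using P.linear_indep_image_lemma[OF _ fE _ injE, of x] V spanE VE B(2)
      by (simp add: clinear_def)
  qed
  moreover have "surj G"
  proof -
    interpret G: Vector_Spaces.linear "(*\<^sub>C)" "(*\<^sub>C)" G
      using G by (simp add: clinear_def)
    have "cvs.span E \<subseteq> range G"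
      by (intro cvs.span_minimal) (auto simp: E_def G.subspace_image cvs.subspace_UNIV)
    then show ?thesis using spanE by auto
  qed
  ultimately show ?thesis by blast
qed

section \<open>Adjoints\<close>

lemma cadjoint_eqI:
  assumes "\<And>x y. cinner (A x) y = cinner x (B y)"
  shows "cadjoint A = B"
  unfolding cadjoint_def
proof (rule the_equality)
  fix C assume C: "\<forall>x y. cinner (A x) y = cinner x (C y)"
  show "C = B"
    by (rule ext, rule cinner_eqI) (metis C assms)
qed (use assms in blast)

lemma cadjoint_explicit:
  fixes A :: "complex ^ 'm \<Rightarrow> 'h::complex_hilbert"
  assumes "clinear A"
  shows "cadjoint A = (\<lambda>y. \<chi> i. cinner (A (axis i 1)) y)"
proof (rule cadjoint_eqI)
  fix x y
  show "cinner (A x) y = cinner x (\<chi> i. cinner (A (axis i 1)) y)"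
    by (subst clinear_sum_axis[OF assms])
      (simp add: cinner_sum_left cinner_scaleC_left cinner_vec_def cinner_complex_def)
qed

lemma cadjoint_nth:
  fixes A :: "complex ^ 'm \<Rightarrow> 'h::complex_hilbert"
  shows "clinear A \<Longrightarrow> cadjoint A y $ i = cinner (A (axis i 1)) y"
  by (simp add: cadjoint_explicit)

lemma cinner_cadjoint:
  fixes A :: "complex ^ 'm \<Rightarrow> 'h::complex_hilbert"
  assumes "clinear A"
  shows "cinner x (cadjoint A y) = cinner (A x) y"
proof -
  have "cinner (A x) y = (\<Sum>i\<in>UNIV. cnj (x $ i) * cinner (A (axis i 1)) y)"
    by (subst clinear_sum_axis[OF assms]) (simp add: cinner_sum_left cinner_scaleC_left)
  then show ?thesis
    by (simp add: cinner_vec_def cinner_complex_def cadjoint_nth assms)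
qed

lemma clinear_cadjoint:
  fixes A :: "complex ^ 'm \<Rightarrow> 'h::complex_hilbert"
  assumes "clinear A"
  shows "clinear (cadjoint A)"
  by (intro clinearI) (simp_all add: vec_eq_iff cadjoint_nth assms cinner_add_right cinner_scaleC_right)

lemma bounded_linear_cinner: "bounded_linear (cinner x)"
proof (rule bounded_linear_intro)
  show "norm (cinner x y) \<le> norm y * norm x" for y
    using cauchy_schwarz[of x y] by (simp add: mult.commute)
  show "cinner x (r *\<^sub>R y) = r *\<^sub>R cinner x y" for r y
    by (simp only: scaleR_scaleC[of r y] cinner_scaleC_right scaleR_conv_of_real)
qed (rule cinner_add_right)

lemma bounded_linear_cadjoint:
  fixes A :: "complex ^ 'm \<Rightarrow> 'h::complex_hilbert"
  assumes "clinear A"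
  shows "bounded_linear (cadjoint A)"
proof (rule bounded_linear_intro)
  fix y :: 'h
  have "norm (cadjoint A y) \<le> (\<Sum>i\<in>UNIV. norm (cadjoint A y $ i))"
    by (simp add: norm_vec_def L2_set_le_sum)
  also have "\<dots> \<le> (\<Sum>i\<in>UNIV. norm (A (axis i 1)) * norm y)"
    by (intro sum_mono) (simp add: cadjoint_nth assms cauchy_schwarz)
  finally show "norm (cadjoint A y) \<le> norm y * (\<Sum>i\<in>UNIV. norm (A (axis i 1)))"
    by (simp add: sum_distrib_left mult.commute)
qed (simp_all add: clinear_add clinear_cadjoint assms clinear_scaleC scaleR_scaleC)

lemma orthonormal_columns_clinear: "orthonormal_columns U \<Longrightarrow> clinear U"
  by (simp add: orthonormal_columns_def)

lemma cadjoint_orthonormal: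
  assumes "orthonormal_columns U"
  shows "cadjoint U (U x) = x"
proof -
  have U: "clinear U" "\<And>i j. cinner (U (axis i 1)) (U (axis j 1)) = (if i = j then 1 else 0)"
    using assms by (auto simp: orthonormal_columns_def)
  have "cadjoint U (U x) $ i = x $ i" for i
    by (simp add: cadjoint_nth[OF U(1)], subst clinear_sum_axis[OF U(1)])
      (simp add: cinner_sum_right cinner_scaleC_right U(2) if_distrib cong: if_cong)
  then show ?thesis by (simp add: vec_eq_iff)
qed

lemma norm_orthonormal:
  assumes "orthonormal_columns U"
  shows "norm (U x) = norm x"
proof -
  have "cinner (U x) (U x) = cinner x x"
    using cinner_cadjoint[OF orthonormal_columns_clinear[OF assms], of x "U x"]
    by (simp add: cadjoint_orthonormal[OF assms])
  then show ?thesis by (metis cinner_self norm_ge_zero of_real_eq_iff power2_eq_iff_nonneg)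
qed

lemma norm_cadjoint_orthonormal_le:
  assumes "orthonormal_columns U"
  shows "norm (cadjoint U y) \<le> norm y"
proof -
  let ?c = "cadjoint U y"
  have "(norm ?c)\<^sup>2 = Re (cinner (U ?c) y)"
    by (simp add: norm_eq_cinner cinner_cadjoint[OF orthonormal_columns_clinear[OF assms]])
  also have "\<dots> \<le> norm (U ?c) * norm y"
    by (rule order_trans[OF complex_Re_le_cmod cauchy_schwarz])
  finally have "norm ?c * norm ?c \<le> norm y * norm ?c"
    by (simp add: norm_orthonormal[OF assms] power2_eq_square mult.commute)
  then show ?thesis
    by (cases "?c = 0") simp_all
qed

section \<open>Singular values of operators of full rank\<close>

definition orthonormal_system :: "nat \<Rightarrow> (nat \<Rightarrow> 'h::complex_hilbert) \<Rightarrow> bool" where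
  "orthonormal_system k v \<longleftrightarrow> (\<forall>i<k. \<forall>j<k. cinner (v i) (v j) = (if i = j then 1 else 0))"

lemma cinner_orthonormal_sum:
  assumes "orthonormal_system k v" "i < k"
  shows "cinner (v i) (\<Sum>j<k. a j *\<^sub>C v j) = a i"
proof -
  have "cinner (v i) (\<Sum>j<k. a j *\<^sub>C v j) = (\<Sum>j<k. if j = i then a j else 0)"
    unfolding cinner_sum_right
    by (rule sum.cong) (use assms in \<open>auto simp: cinner_scaleC_right orthonormal_system_def\<close>)
  then show ?thesis using assms(2) by simp
qed

lemma norm_orthonormal_sum:
  assumes "orthonormal_system k v"
  shows "(norm (\<Sum>j<k. a j *\<^sub>C v j))\<^sup>2 = (\<Sum>j<k. (cmod (a j))\<^sup>2)"
proof -
  have "complex_of_real ((norm (\<Sum>j<k. a j *\<^sub>C v j))\<^sup>2)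
      = (\<Sum>i<k. cnj (a i) * cinner (v i) (\<Sum>j<k. a j *\<^sub>C v j))"
    unfolding cinner_self[symmetric] by (subst cinner_sum_left) (simp add: cinner_scaleC_left)
  also have "\<dots> = (\<Sum>i<k. complex_of_real ((cmod (a i))\<^sup>2))"
  proof (rule sum.cong)
    fix i assume "i \<in> {..<k}"
    then have "cinner (v i) (\<Sum>j<k. a j *\<^sub>C v j) = a i"
      by (simp add: cinner_orthonormal_sum[OF assms])
    then show "cnj (a i) * cinner (v i) (\<Sum>j<k. a j *\<^sub>C v j) = complex_of_real ((cmod (a i))\<^sup>2)"
      by (simp only: complex_norm_square mult.commute)
  qed simp
  finally show ?thesis
    by (simp only: of_real_sum[symmetric] of_real_eq_iff)
qed

lemma norm_orthonormal_member:
  assumes "orthonormal_system k v" "i < k"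
  shows "norm (v i) = 1"
proof -
  have "cinner (v i) (v i) = 1"
    using assms by (simp add: orthonormal_system_def)
  then have "(norm (v i))\<^sup>2 = 1" by (simp add: norm_eq_cinner)
  then show ?thesis using norm_ge_zero[of "v i"] by (simp add: power2_eq_1_iff)
qed

text \<open>This is the dimension count for \<open>range B\<close>. An orthonormal system indexed by \<open>'m\<close> turns it into
  the equivalence of injectivity and surjectivity for an endomorphism of \<open>complex ^ 'm\<close>.\<close>

lemma orthonormal_complete:
  fixes B :: "complex ^ 'm \<Rightarrow> 'h::complex_hilbert"
  assumes B: "clinear B" "inj B" and v: "orthonormal_system CARD('m) v"
    and vB: "\<And>i. i < CARD('m) \<Longrightarrow> v i \<in> range B" and x: "x \<in> range B"
  shows "x = (\<Sum>i<CARD('m). cinner (v i) x *\<^sub>C v i)"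
proof -
  from vB have "\<forall>i. \<exists>d. i < CARD('m) \<longrightarrow> v i = B d" by blast
  then obtain d where d: "\<And>i. i < CARD('m) \<Longrightarrow> v i = B (d i)" by metis
  obtain e where e: "bij_betw e (UNIV :: 'm set) {..<CARD('m)}"
    using ex_bij_betw_finite_nat[of "UNIV :: 'm set"] by (auto simp: atLeast0LessThan)
  have e_lt: "e i < CARD('m)" for i using bij_betwE[OF e] by auto
  have e_inj: "e i = e j \<longleftrightarrow> i = j" for i j using e by (auto simp: bij_betw_def inj_on_def)
  define L where "L c = (\<Sum>i\<in>UNIV. (c $ i) *\<^sub>C d (e i))" for c :: "complex ^ 'm"
  have L: "clinear L"
    by (intro clinearI) (simp_all add: L_def cvs.scale_left_distrib sum.distrib
        cvs.scale_sum_right)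
  have BL: "B (L c) = (\<Sum>i\<in>UNIV. (c $ i) *\<^sub>C v (e i))" for c
    by (simp add: L_def clinear_sum[OF B(1)] clinear_scaleC[OF B(1)] d[OF e_lt])
  have coeff: "cinner (v (e j)) (B (L c)) = c $ j" for c j
  proof -
    have "cinner (v (e j)) (B (L c)) = (\<Sum>i\<in>UNIV. if i = j then c $ i else 0)"
      unfolding BL cinner_sum_right using v e_lt
      by (intro sum.cong) (auto simp: cinner_scaleC_right orthonormal_system_def e_inj)
    then show ?thesis by simp
  qed
  have "inj L"
    unfolding clinear_inj_iff[OF L]
  proof (intro allI impI)
    fix c assume "L c = 0"
    then have "c $ j = 0" for j using coeff[of j c] by (simp add: clinear_zero[OF B(1)])
    then show "c = 0" by (simp add: vec_eq_iff)
  qed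
  then have "surj L" using clinear_inj_iff_surj[OF L] by blast
  then obtain c where c: "x = B (L c)" using x by (metis imageE surjD)
  have "x = (\<Sum>i\<in>UNIV. cinner (v (e i)) x *\<^sub>C v (e i))"
    by (simp add: c coeff) (simp add: BL)
  also have "\<dots> = (\<Sum>i<CARD('m). cinner (v i) x *\<^sub>C v i)"
    by (rule sum.reindex_bij_betw[OF e])
  finally show ?thesis .
qed

lemma clinear_range_diff:
  "clinear B \<Longrightarrow> x \<in> range B \<Longrightarrow> y \<in> range B \<Longrightarrow> x - y \<in> range B"
  by (metis (no_types, lifting) clinear_diff imageE rangeI)

lemma clinear_range_scaleC: "clinear B \<Longrightarrow> x \<in> range B \<Longrightarrow> a *\<^sub>C x \<in> range B"
  by (metis (no_types, lifting) clinear_scaleC imageE rangeI)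

lemma clinear_range_sum:
  assumes "clinear B" "\<And>i. i \<in> I \<Longrightarrow> f i \<in> range B"
  shows "(\<Sum>i\<in>I. f i) \<in> range B"
proof -
  from assms(2) have "\<forall>i. \<exists>d. i \<in> I \<longrightarrow> f i = B d" by blast
  then obtain d where d: "\<And>i. i \<in> I \<Longrightarrow> f i = B (d i)" by metis
  then have "(\<Sum>i\<in>I. f i) = B (\<Sum>i\<in>I. d i)" by (simp add: clinear_sum[OF assms(1)])
  then show ?thesis by simp
qed

text \<open>Otherwise expansion in the \<open>v i\<close> would make an endomorphism of \<open>complex ^ 'm\<close> surjective that has
  at most \<open>r\<close> nonzero columns.\<close>

lemma orthonormal_incomplete:
  fixes B :: "complex ^ 'm \<Rightarrow> 'h::complex_hilbert"
  assumes B: "clinear B" "inj B" and v: "orthonormal_system r v" and r: "r < CARD('m)"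
    and vB: "\<And>i. i < r \<Longrightarrow> v i \<in> range B"
  obtains x where "x \<in> range B" "norm x = 1" "\<And>i. i < r \<Longrightarrow> cinner (v i) x = 0"
proof -
  have "\<exists>x\<in>range B. x \<noteq> 0 \<and> (\<forall>i<r. cinner (v i) x = 0)"
  proof (rule ccontr)
    assume none: "\<not> ?thesis"
    have complete: "B y = (\<Sum>i<r. cinner (v i) (B y) *\<^sub>C v i)" for y
    proof -
      let ?z = "B y - (\<Sum>i<r. cinner (v i) (B y) *\<^sub>C v i)"
      have "?z \<in> range B"
        using vB by (intro clinear_range_diff clinear_range_sum clinear_range_scaleC B(1)) auto
      moreover have "\<forall>i<r. cinner (v i) ?z = 0"
        by (simp add: cinner_diff_right cinner_orthonormal_sum[OF v])
      ultimately have "?z = 0" using none by blast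
      then show ?thesis by simp
    qed
    from vB have "\<forall>i. \<exists>d. i < r \<longrightarrow> v i = B d" by blast
    then obtain d where d: "\<And>i. i < r \<Longrightarrow> v i = B (d i)" by metis
    obtain e where e: "bij_betw e (UNIV :: 'm set) {..<CARD('m)}"
      using ex_bij_betw_finite_nat[of "UNIV :: 'm set"] by (auto simp: atLeast0LessThan)
    define d' where "d' k = (if k < r then d k else 0)" for k
    define L where "L c = (\<Sum>i\<in>UNIV. (c $ i) *\<^sub>C d' (e i))" for c :: "complex ^ 'm"
    have L: "clinear L"
      by (intro clinearI) (simp_all add: L_def cvs.scale_left_distrib sum.distrib
          cvs.scale_sum_right)
    have "surj L"
    proof (rule surjI)
      fix y
      let ?a = "\<lambda>k. cinner (v k) (B y)"
      have "L (\<chi> i. ?a (e i)) = (\<Sum>k<CARD('m). ?a k *\<^sub>C d' k)"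
        unfolding L_def vec_lambda_beta by (rule sum.reindex_bij_betw[OF e])
      also have "\<dots> = (\<Sum>k<r. ?a k *\<^sub>C d' k)"
        by (rule sum.mono_neutral_right) (use r in \<open>auto simp: d'_def\<close>)
      also have "B \<dots> = (\<Sum>k<r. ?a k *\<^sub>C v k)"
        by (simp add: clinear_sum[OF B(1)] clinear_scaleC[OF B(1)] d'_def d)
      also have "\<dots> = B y" by (rule complete[symmetric])
      finally have "B (L (\<chi> i. ?a (e i))) = B y" .
      then show "L (\<chi> i. ?a (e i)) = y" using B(2) by (simp add: inj_eq)
    qed
    then have "inj L" using clinear_inj_iff_surj[OF L] by blast
    moreover from e r obtain j where j: "e j = r"
      by (metis bij_betw_iff_bijections lessThan_iff)
    have "L (axis j 1) = 0"
      unfolding L_def by (rule sum.neutral) (auto simp: axis_def d'_def j)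
    ultimately have "axis j (1::complex) = 0" using clinear_inj_iff[OF L] by blast
    then show False by (metis axis_nth zero_index zero_neq_one)
  qed
  then obtain x where x: "x \<in> range B" "x \<noteq> 0" "\<And>i. i < r \<Longrightarrow> cinner (v i) x = 0" by blast
  show thesis
  proof (rule that)
    show "complex_of_real (1 / norm x) *\<^sub>C x \<in> range B"
      by (intro clinear_range_scaleC B x)
  qed (use x in \<open>auto simp: cinner_scaleC_right norm_divide\<close>)
qed

text \<open>The minimum of the norm of \<open>B\<close> over the compact unit sphere is attained, hence positive.\<close>

lemma clinear_bounded_below:
  fixes B :: "complex ^ 'm \<Rightarrow> 'h::complex_hilbert"
  assumes B: "clinear B" "inj B"
  obtains b where "b > 0" "\<And>x. b * norm x \<le> norm (B x)"
proof -
  have "axis undefined 1 \<in> sphere 0 1 \<inter> (UNIV :: (complex ^ 'm) set)"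
    by (simp add: norm_axis_complex)
  then have "sphere 0 1 \<noteq> ({} :: (complex ^ 'm) set)" by blast
  moreover have "continuous_on (sphere 0 1) (\<lambda>x. norm (B x))"
    by (intro continuous_intros linear_continuous_on clinear_bounded_linear B)
  ultimately obtain y where y: "y \<in> sphere 0 1" "\<And>x. x \<in> sphere 0 1 \<Longrightarrow> norm (B y) \<le> norm (B x)"
    using continuous_attains_inf[of "sphere 0 1" "\<lambda>x. norm (B x)"] by auto
  show thesis
  proof (rule that)
    have "y \<noteq> 0" using y(1) by auto
    then have "B y \<noteq> 0" using clinear_inj_iff[OF B(1)] B(2) by blast
    then show "norm (B y) > 0" by simp
    fix x
    show "norm (B y) * norm x \<le> norm (B x)"
    proof (cases "x = 0")
      case False
      then have "norm (B y) \<le> norm (B (complex_of_real (1 / norm x) *\<^sub>C x))"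
        by (intro y) (simp add: norm_divide)
      then show ?thesis using False
        by (simp add: clinear_scaleC[OF B(1)] norm_divide field_simps)
    qed (simp add: clinear_zero[OF B(1)])
  qed
qed

text \<open>Singular vectors are found by successive maximization of the norm of \<open>A\<close> over unit vectors
  of \<open>range B\<close> orthogonal to the previous ones.\<close>

lemma maximizing_system:
  fixes B :: "complex ^ 'm \<Rightarrow> 'h::complex_hilbert" and A :: "'h \<Rightarrow> 'k::complex_hilbert"
  assumes B: "clinear B" "inj B" and A: "clinear A" and r: "r \<le> CARD('m)"
  shows "\<exists>v. orthonormal_system r v \<and> (\<forall>i<r. v i \<in> range B) \<and>
    (\<forall>i<r. \<forall>x\<in>range B. (\<forall>j<i. cinner (v j) x = 0) \<longrightarrow> norm (A x) \<le> norm (A (v i)) * norm x)"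
  using r
proof (induction r)
  case 0
  show ?case by (auto simp: orthonormal_system_def)
next
  case (Suc r)
  from Suc.IH[OF Suc_leD[OF Suc.prems]] obtain v where IH: "orthonormal_system r v" "\<forall>i<r. v i \<in> range B"
    "\<forall>i<r. \<forall>x\<in>range B. (\<forall>j<i. cinner (v j) x = 0) \<longrightarrow> norm (A x) \<le> norm (A (v i)) * norm x"
    by (elim exE conjE)
  note v = IH(1) IH(2)[rule_format] and max = IH(3)[rule_format]
  have lB: "bounded_linear B" using clinear_bounded_linear[OF B(1)] .
  have lAB: "bounded_linear (A \<circ> B)"
    using clinear_bounded_linear[OF clinear_compose[OF A B(1)]] .
  define K where "K = {c. norm (B c) = 1} \<inter> (\<Inter>j\<in>{..<r}. {c. cinner (v j) (B c) = 0})"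
  have cB: "continuous_on UNIV B" using lB by (rule linear_continuous_on)
  have "closed K"
    unfolding K_def
    by (intro closed_Int closed_INT ballI closed_Collect_eq continuous_intros cB
        bounded_linear.continuous_on[OF bounded_linear_cinner])
  moreover have "bounded K"
  proof -
    obtain b where b: "b > 0" "\<And>x. b * norm x \<le> norm (B x)"
      using clinear_bounded_below[OF B] by metis
    have "norm c \<le> 1 / b" if "c \<in> K" for c
      using b(2)[of c] b(1) that by (simp add: K_def field_simps)
    then show ?thesis unfolding bounded_iff by blast
  qed
  ultimately have "compact K" by (simp add: compact_eq_bounded_closed)
  moreover have "K \<noteq> {}"
  proof -
    obtain x where "x \<in> range B" "norm x = 1" "\<And>i. i < r \<Longrightarrow> cinner (v i) x = 0"
      using orthonormal_incomplete[OF B v(1) _ v(2)] Suc.prems by (metis Suc_le_lessD)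
    then show ?thesis by (auto simp: K_def)
  qed
  moreover have "continuous_on K (\<lambda>c. norm ((A \<circ> B) c))"
    by (intro continuous_intros linear_continuous_on lAB)
  ultimately obtain c0 where c0: "c0 \<in> K" "\<And>c. c \<in> K \<Longrightarrow> norm (A (B c)) \<le> norm (A (B c0))"
    using continuous_attains_sup[of K "\<lambda>c. norm ((A \<circ> B) c)"] by auto
  define w where "w = v(r := B c0)"
  have w_old: "w i = v i" if "i < r" for i using that by (simp add: w_def)
  have w_new: "w r = B c0" by (simp add: w_def)
  have perp: "cinner (v j) (B c0) = 0" if "j < r" for j using c0(1) that by (auto simp: K_def)
  have n1: "norm (B c0) = 1" using c0(1) by (auto simp: K_def)
  have "orthonormal_system (Suc r) w"
    unfolding orthonormal_system_def
  proof (intro allI impI)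
    fix i j assume "i < Suc r" "j < Suc r"
    then consider "i < r" "j < r" | "i < r" "j = r" | "i = r" "j < r" | "i = r" "j = r"
      by (metis less_Suc_eq)
    then show "cinner (w i) (w j) = (if i = j then 1 else 0)"
    proof cases
      case 1 then show ?thesis using v(1) by (simp add: w_old orthonormal_system_def)
    next
      case 2 then show ?thesis using perp by (simp add: w_old w_new)
    next
      case 3 then show ?thesis using perp[of j] cinner_commute[of "B c0" "v j"] by (simp add: w_old w_new)
    next
      case 4 then show ?thesis using n1 by (simp add: w_new cinner_self)
    qed
  qed
  moreover have "w i \<in> range B" if "i < Suc r" for i
    using that v(2) by (auto simp: less_Suc_eq w_old w_new)
  moreover have "norm (A x) \<le> norm (A (w i)) * norm x"
    if i: "i < Suc r" and x: "x \<in> range B" and o: "\<forall>j<i. cinner (w j) x = 0" for i x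
  proof (cases "i < r")
    case True
    then show ?thesis using max[OF True x] o by (simp add: w_old)
  next
    case False
    then have ir: "i = r" using i by simp
    show ?thesis
    proof (cases "x = 0")
      case False
      define a where "a = complex_of_real (1 / norm x)"
      obtain c where c: "x = B c" using x by blast
      have "a *\<^sub>C c \<in> K"
        using o False by (auto simp: K_def a_def clinear_scaleC[OF B(1)] c[symmetric]
            norm_divide cinner_scaleC_right ir w_old)
      from c0(2)[OF this] have "norm (A x) / norm x \<le> norm (A (B c0))"
        by (simp add: clinear_scaleC[OF B(1)] clinear_scaleC[OF A] c[symmetric] a_def norm_divide)
      then show ?thesis using False by (simp add: ir w_new field_simps)
    qed (simp add: clinear_zero[OF A])
  qed
  ultimately show ?case by blast
qed

text \<open>The first order condition at a constrained maximizer: \<open>v\<close> is varied in the direction \<open>w\<close> with the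
  phase that makes the first order term of the squared norm positive.\<close>

lemma maximizer_orthogonal:
  assumes A: "clinear A" and o: "cinner v w = 0" "norm v = 1" "norm w = 1"
    and max: "\<And>t. norm (A (v + t *\<^sub>C w)) \<le> norm (A v) * norm (v + t *\<^sub>C w)"
  shows "cinner (A v) (A w) = 0"
proof (rule ccontr)
  define h where "h = cinner (A v) (A w)"
  assume "cinner (A v) (A w) \<noteq> 0"
  then have h: "cmod h > 0" by (simp add: h_def)
  define q where "q = (norm (A v))\<^sup>2"
  define s where "s = 1 / (q + 1)"
  have q: "q \<ge> 0" by (simp add: q_def)
  then have s: "s > 0" "s * q < 1" by (simp_all add: s_def)
  define t where "t = complex_of_real s * cnj h"
  have ct: "cmod t = s * cmod h" using s by (simp add: t_def norm_mult)
  have "t * h = complex_of_real (s * (cmod h)\<^sup>2)"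
    using complex_norm_square[of h] by (simp add: t_def mult_ac)
  then have re: "Re (cinner (A v) (t *\<^sub>C A w)) = s * (cmod h)\<^sup>2"
    by (simp add: cinner_scaleC_right flip: h_def)
  have n: "(norm (v + t *\<^sub>C w))\<^sup>2 = 1 + (cmod t)\<^sup>2"
    by (simp add: norm_add_squared cinner_scaleC_right o power_mult_distrib)
  have "(norm (A (v + t *\<^sub>C w)))\<^sup>2 \<le> (norm (A v) * norm (v + t *\<^sub>C w))\<^sup>2"
    by (rule power_mono[OF max]) simp
  then have "q + (norm (t *\<^sub>C A w))\<^sup>2 + 2 * (s * (cmod h)\<^sup>2) \<le> q * (1 + (cmod t)\<^sup>2)"
    by (simp only: clinear_add[OF A] clinear_scaleC[OF A] norm_add_squared[of "A v"] power_mult_distrib n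
        re flip: q_def)
  moreover have "(norm (t *\<^sub>C A w))\<^sup>2 \<ge> 0" by simp
  moreover have "q * (1 + (cmod t)\<^sup>2) = q + (s * q) * (s * (cmod h)\<^sup>2)"
    by (simp add: ct power2_eq_square algebra_simps)
  ultimately have "2 * (s * (cmod h)\<^sup>2) \<le> (s * q) * (s * (cmod h)\<^sup>2)" by linarith
  moreover have "(s * q) * (s * (cmod h)\<^sup>2) \<le> 1 * (s * (cmod h)\<^sup>2)"
    using s by (intro mult_right_mono) auto
  ultimately have "s * (cmod h)\<^sup>2 \<le> 0" by linarith
  then show False using s h by (simp add: mult_le_0_iff)
qed

lemma gram_surj:
  fixes G :: "complex ^ 'm \<Rightarrow> 'h::complex_hilbert"
  assumes G: "clinear G" "inj G"
  obtains c where "cadjoint G (G c) = d"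
proof -
  have L: "clinear (cadjoint G \<circ> G)" by (intro clinear_compose clinear_cadjoint G)
  have "inj (cadjoint G \<circ> G)"
    unfolding clinear_inj_iff[OF L]
  proof (intro allI impI)
    fix c assume "(cadjoint G \<circ> G) c = 0"
    then have "cinner (G c) (G c) = 0" by (simp add: cinner_cadjoint[OF G(1), symmetric])
    then show "c = 0" using G clinear_inj_iff by auto
  qed
  then have "surj (cadjoint G \<circ> G)" using clinear_inj_iff_surj[OF L] by blast
  then show thesis using that by (metis comp_apply surjD)
qed

text \<open>The vector \<open>G c\<close> is the orthogonal projection of \<open>x\<close> onto \<open>range G\<close>; the orthogonal complement
  is the kernel of the adjoint.\<close>

lemma range_adjoint_projection:
  fixes G :: "complex ^ 'm \<Rightarrow> 'h::complex_hilbert"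
  assumes G: "clinear G" "inj G"
  obtains c where "cadjoint G (x - G c) = 0"
  using gram_surj[OF G, of "cadjoint G x"] clinear_diff[OF clinear_cadjoint[OF G(1)]]
  by (metis right_minus_eq)

context
  fixes V :: "complex ^ 'm \<Rightarrow> 'b::complex_hilbert" and G :: "complex ^ 'm \<Rightarrow> 'a::complex_hilbert"
  assumes V: "clinear V" "inj V" and G: "clinear G" "inj G"
begin

lemma full_rank_eq_0_iff: "V (cadjoint G x) = 0 \<longleftrightarrow> cadjoint G x = 0"
  using V clinear_inj_iff clinear_zero by metis

lemma full_rank_inj_on_range: "V (cadjoint G (G c)) = 0 \<Longrightarrow> G c = 0"
  using full_rank_eq_0_iff cinner_cadjoint[OF G(1), of c "G c"] by simp

text \<open>Successive maximization on \<open>range G\<close> yields orthonormal \<open>v i\<close> with orthogonal, nonzero images,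
  whose normalizations are the left singular vectors.\<close>

lemma full_rank_svd_exists: "\<exists>u s v. finite_svd CARD('m) (V \<circ> cadjoint G) u s v"
proof -
  let ?A = "V \<circ> cadjoint G" and ?m = "CARD('m)"
  have A: "clinear ?A" by (intro clinear_compose V clinear_cadjoint G)
  obtain v where v: "orthonormal_system ?m v" "\<And>i. i < ?m \<Longrightarrow> v i \<in> range G"
    and max: "\<And>i x. i < ?m \<Longrightarrow> x \<in> range G \<Longrightarrow> (\<forall>j<i. cinner (v j) x = 0)
      \<Longrightarrow> norm (?A x) \<le> norm (?A (v i)) * norm x"
    using maximizing_system[OF G A order_refl] by blast
  define s where "s i = norm (?A (v i))" for i
  define u where "u i = complex_of_real (1 / s i) *\<^sub>C ?A (v i)" for i
  have n1: "norm (v i) = 1" if "i < ?m" for i using norm_orthonormal_member[OF v(1) that] .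
  have s_pos: "s i > 0" if i: "i < ?m" for i
  proof -
    obtain c where "v i = G c" using v(2)[OF i] by blast
    then show ?thesis using full_rank_inj_on_range[of c] n1[OF i] by (auto simp: s_def)
  qed
  have orth: "cinner (?A (v i)) (?A (v j)) = 0" if ij: "i < j" "j < ?m" for i j
  proof (rule maximizer_orthogonal[OF A])
    show "cinner (v i) (v j) = 0" using v(1) ij by (simp add: orthonormal_system_def)
    show "norm (?A (v i + t *\<^sub>C v j)) \<le> norm (?A (v i)) * norm (v i + t *\<^sub>C v j)" for t
    proof (rule max)
      show "i < ?m" using ij by simp
      obtain c d where "v i = G c" "v j = G d" using v(2) ij by (meson imageE less_trans)
      then have "v i + t *\<^sub>C v j = G (c + t *\<^sub>C d)" using G by (simp add: clinear_add clinear_scaleC)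
      then show "v i + t *\<^sub>C v j \<in> range G" by simp
      show "\<forall>k<i. cinner (v k) (v i + t *\<^sub>C v j) = 0"
        using v(1) ij by (auto simp: orthonormal_system_def cinner_add_right cinner_scaleC_right)
    qed
  qed (use n1 ij in auto)
  have "finite_svd ?m ?A u s v"
    unfolding finite_svd_def
  proof (intro conjI allI impI)
    fix i j assume i: "i < ?m" and j: "j < ?m"
    show "cinner (v i) (v j) = (if i = j then 1 else 0)"
      using v(1) i j by (simp add: orthonormal_system_def)
    show "cinner (u i) (u j) = (if i = j then 1 else 0)"
    proof (cases "i = j")
      case True
      have "norm (u i) = 1" using s_pos[OF i] by (simp add: u_def s_def norm_divide)
      then show ?thesis using True by (simp add: cinner_self)
    next
      case False
      then have "cinner (?A (v i)) (?A (v j)) = 0"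
        using orth[of i j] orth[of j i] i j cinner_commute[of "?A (v i)" "?A (v j)"]
        by (cases "i < j") auto
      then show ?thesis using False by (simp add: u_def cinner_scaleC_left cinner_scaleC_right)
    qed
    show "s j \<le> s i" if "i \<le> j"
    proof -
      have "norm (?A (v j)) \<le> norm (?A (v i)) * norm (v j)"
        using max[OF i v(2)[OF j]] v(1) i j that by (auto simp: orthonormal_system_def)
      then show ?thesis by (simp add: s_def n1[OF j])
    qed
  next
    fix i show "0 \<le> s i" by (simp add: s_def)
  next
    fix x
    obtain c where c: "cadjoint G (x - G c) = 0" using range_adjoint_projection[OF G] .
    have coeff: "cinner (v i) (G c) = cinner (v i) x" if i: "i < ?m" for i
    proof -
      obtain d where "v i = G d" using v(2)[OF i] by blast
      then have "cinner (v i) (x - G c) = 0"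
        using c cinner_cadjoint[OF G(1), of d "x - G c"] by simp
      then show ?thesis by (simp add: cinner_diff_right)
    qed
    have "?A x = ?A (G c)"
      using c by (simp add: clinear_diff[OF clinear_cadjoint[OF G(1)]])
    also have "G c = (\<Sum>i<?m. cinner (v i) (G c) *\<^sub>C v i)"
      by (rule orthonormal_complete[OF G v]) auto
    also have "?A \<dots> = (\<Sum>i<?m. cinner (v i) x *\<^sub>C ?A (v i))"
      by (simp only: clinear_sum[OF A] clinear_scaleC[OF A]) (simp add: coeff)
    also have "\<dots> = (\<Sum>i<?m. (complex_of_real (s i) * cinner (v i) x) *\<^sub>C u i)"
    proof (rule sum.cong)
      fix i assume "i \<in> {..<?m}"
      then have "s i \<noteq> 0" using s_pos[of i] by simp
      then show "cinner (v i) x *\<^sub>C ?A (v i) = (complex_of_real (s i) * cinner (v i) x) *\<^sub>C u i"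
        by (simp add: u_def)
    qed simp
    finally show "?A x = (\<Sum>i<?m. (complex_of_real (s i) * cinner (v i) x) *\<^sub>C u i)" .
  qed
  then show ?thesis by blast
qed

text \<open>Every singular value decomposition has exactly \<open>m\<close> nonzero singular values, and the smallest
  of them is the minimum of \<open>norm (A x) / norm x\<close> over the orthogonal complement \<open>range G\<close> of the
  kernel of \<open>A\<close>. This minimum does not depend on the decomposition.\<close>

lemma full_rank_svd_least:
  assumes svd: "finite_svd k (V \<circ> cadjoint G) u s v"
  shows "CARD('m) \<le> k \<and> s (CARD('m) - 1) > 0
    \<and> (\<forall>c. s (CARD('m) - 1) * norm (G c) \<le> norm (V (cadjoint G (G c))))
    \<and> (\<exists>c. G c \<noteq> 0 \<and> norm (V (cadjoint G (G c))) = s (CARD('m) - 1) * norm (G c))"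
proof -
  let ?A = "V \<circ> cadjoint G" and ?m = "CARD('m)"
  have u: "orthonormal_system k u" and v: "orthonormal_system k v"
    and s0: "\<And>i. i < k \<Longrightarrow> 0 \<le> s i" and mono: "\<And>i j. i \<le> j \<Longrightarrow> j < k \<Longrightarrow> s j \<le> s i"
    and A: "\<And>x. ?A x = (\<Sum>i<k. (complex_of_real (s i) * cinner (v i) x) *\<^sub>C u i)"
    using svd unfolding finite_svd_def orthonormal_system_def by auto
  define r where "r = (LEAST i. i \<ge> k \<or> s i = 0)"
  have r1: "r \<ge> k \<or> s r = 0" unfolding r_def by (rule LeastI[of _ k]) simp
  have rk: "r \<le> k" unfolding r_def by (rule Least_le) simp
  have pos: "s i > 0" if "i < r" for i
    using not_less_Least[of i "\<lambda>i. i \<ge> k \<or> s i = 0"] that s0[of i] by (auto simp: r_def)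
  have zero: "s i = 0" if "r \<le> i" "i < k" for i
    using r1 mono[of r i] s0[of i] that by fastforce
  have Ar: "?A x = (\<Sum>i<r. (complex_of_real (s i) * cinner (v i) x) *\<^sub>C u i)" for x
    unfolding A by (rule sum.mono_neutral_right) (use rk zero in auto)
  have ur: "orthonormal_system r u" and vr: "orthonormal_system r v"
    using u v rk by (auto simp: orthonormal_system_def)
  have normA: "(norm (?A x))\<^sup>2 = (\<Sum>i<r. (s i * cmod (cinner (v i) x))\<^sup>2)" for x
    unfolding Ar norm_orthonormal_sum[OF ur]
    by (rule sum.cong) (simp_all add: norm_mult power_mult_distrib)
  have v_range: "v i \<in> range G" if i: "i < r" for i
  proof -
    obtain c where c: "cadjoint G (v i - G c) = 0" using range_adjoint_projection[OF G] .
    let ?y = "v i - G c"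
    have "?A ?y = 0" using c by (simp add: clinear_zero[OF V(1)])
    then have "(\<Sum>j<r. (s j * cmod (cinner (v j) ?y))\<^sup>2) = 0" using normA[of ?y] by simp
    then have "(s i * cmod (cinner (v i) ?y))\<^sup>2 = 0"
      using i by (subst (asm) sum_nonneg_eq_0_iff) auto
    then have 1: "cinner (v i) ?y = 0" using pos[OF i] by simp
    have "cinner (G c) ?y = 0" using c cinner_cadjoint[OF G(1), of c ?y] by simp
    with 1 have "cinner ?y ?y = 0" by (subst cinner_diff_left) simp
    then have "v i = G c" by simp
    then show ?thesis by simp
  qed
  have rm: "r = ?m"
  proof (rule antisym)
    show "?m \<le> r"
    proof (rule ccontr)
      assume "\<not> ?m \<le> r"
      then obtain x where x: "x \<in> range G" "norm x = 1" "\<And>i. i < r \<Longrightarrow> cinner (v i) x = 0"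
        using orthonormal_incomplete[OF G vr _ v_range] by (metis not_le)
      then obtain c where c: "x = G c" by blast
      have "?A x = 0" unfolding Ar using x by simp
      then have "G c = 0" using c full_rank_inj_on_range[of c] by simp
      then show False using x(2) c by simp
    qed
    show "r \<le> ?m"
    proof (rule ccontr)
      assume m: "\<not> r \<le> ?m"
      have "v ?m = (\<Sum>i<?m. cinner (v i) (v ?m) *\<^sub>C v i)"
        by (rule orthonormal_complete[OF G]) (use m vr v_range in \<open>auto simp: orthonormal_system_def\<close>)
      also have "\<dots> = 0"
        using vr m by (intro sum.neutral) (auto simp: orthonormal_system_def)
      finally show False using norm_orthonormal_member[OF vr, of ?m] m by simp
    qed
  qed
  have m: "?m - 1 < r" unfolding rm by (simp add: zero_less_card_finite)
  let ?t = "s (?m - 1)"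
  have lower: "?t * norm (G c) \<le> norm (?A (G c))" for c
  proof -
    have "G c = (\<Sum>i<r. cinner (v i) (G c) *\<^sub>C v i)"
      unfolding rm by (rule orthonormal_complete[OF G vr[unfolded rm] v_range[unfolded rm]]) auto
    then have "(norm (G c))\<^sup>2 = (\<Sum>i<r. (cmod (cinner (v i) (G c)))\<^sup>2)"
      using norm_orthonormal_sum[OF vr, of "\<lambda>i. cinner (v i) (G c)"] by simp
    then have "(?t * norm (G c))\<^sup>2 = (\<Sum>i<r. (?t * cmod (cinner (v i) (G c)))\<^sup>2)"
      by (simp add: power_mult_distrib sum_distrib_left)
    also have "\<dots> \<le> (\<Sum>i<r. (s i * cmod (cinner (v i) (G c)))\<^sup>2)"
      using pos[OF m] mono[of _ "?m - 1"] rk m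
      by (intro sum_mono power_mono mult_right_mono mult_nonneg_nonneg) (auto simp: rm)
    also have "\<dots> = (norm (?A (G c)))\<^sup>2" by (rule normA[symmetric])
    finally show ?thesis by (rule power2_le_imp_le) simp
  qed
  obtain c where c: "v (?m - 1) = G c" using v_range[OF m] by blast
  have "(norm (?A (G c)))\<^sup>2 = (\<Sum>i<r. if i = ?m - 1 then ?t\<^sup>2 else 0)"
    unfolding normA c[symmetric] using vr m
    by (intro sum.cong) (auto simp: orthonormal_system_def)
  then have "(norm (?A (G c)))\<^sup>2 = ?t\<^sup>2" using m by simp
  then have "norm (?A (G c)) = ?t" using pos[OF m] by (simp add: power2_eq_iff_nonneg)
  moreover have "norm (G c) = 1" using norm_orthonormal_member[OF vr m] c by simp
  ultimately have "\<exists>c. G c \<noteq> 0 \<and> norm (V (cadjoint G (G c))) = ?t * norm (G c)"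
    by (intro exI[of _ c]) auto
  then show ?thesis using rm rk pos[OF m] lower by simp
qed

text \<open>Two numbers that are both attained as a quotient \<open>norm (A x) / norm x\<close> on \<open>range G\<close> and are both
  lower bounds for it coincide. This justifies the definite description in \<open>singular_value\<close>.\<close>

lemma singular_value_full_rank:
  shows "singular_value CARD('m) (V \<circ> cadjoint G) > 0"
    and "singular_value CARD('m) (V \<circ> cadjoint G) * norm (G c) \<le> norm (V (cadjoint G (G c)))"
proof -
  let ?A = "V \<circ> cadjoint G" and ?m = "CARD('m)"
  obtain u s v where svd: "finite_svd ?m ?A u s v" using full_rank_svd_exists by blast
  have "singular_value ?m ?A = s (?m - 1)"
    unfolding singular_value_def
  proof (rule the_equality)
    show "\<exists>k u s' v. finite_svd k ?A u s' v \<and> s (?m - 1) = (if ?m \<le> k then s' (?m - 1) else 0)"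
      using svd by (metis order_refl)
  next
    fix t assume "\<exists>k u s v. finite_svd k ?A u s v \<and> t = (if ?m \<le> k then s (?m - 1) else 0)"
    then obtain k u' s' v' where svd': "finite_svd k ?A u' s' v'"
      and t: "t = (if ?m \<le> k then s' (?m - 1) else 0)" by blast
    note 1 = full_rank_svd_least[OF svd] and 2 = full_rank_svd_least[OF svd']
    then have t: "t = s' (?m - 1)" using t by simp
    have least: "a \<le> b" if lower: "\<forall>c. a * norm (G c) \<le> norm (V (cadjoint G (G c)))"
      and attained: "\<exists>c. G c \<noteq> 0 \<and> norm (V (cadjoint G (G c))) = b * norm (G c)" for a b
    proof -
      obtain c where "G c \<noteq> 0" "norm (V (cadjoint G (G c))) = b * norm (G c)" using attained by blast
      with lower have "a * norm (G c) \<le> b * norm (G c)" by metis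
      then show ?thesis using \<open>G c \<noteq> 0\<close> by simp
    qed
    from 1 2 show "t = s (?m - 1)"
      unfolding t by (intro antisym least) blast+
  qed
  then show "singular_value ?m ?A > 0"
    and "singular_value ?m ?A * norm (G c) \<le> norm (V (cadjoint G (G c)))"
    using full_rank_svd_least[OF svd] by auto
qed

end

section \<open>Riemann-Stieltjes integrals along rectifiable curves\<close>

lemma tagged_division_unit_interval:
  assumes "p tagged_division_of {0..1::real}" "(t, k) \<in> p"
  obtains a b where "k = {a..b}" "a \<le> t" "t \<le> b" "0 \<le> a" "b \<le> 1" "Inf k = a" "Sup k = b"
proof -
  note 1 = tagged_division_ofD(2,3)[OF assms] and 2 = tagged_division_ofD(4)[OF assms]
  from 2 obtain a b where k: "k = {a..b}" by (metis box_real(2))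
  with 1 have "a \<le> b" "a \<le> t" "t \<le> b" "0 \<le> a" "b \<le> 1"
    by (auto simp: subset_eq)
  with k show thesis using that by simp
qed

lemma has_path_integral_unique:
  assumes "has_path_integral f I g" "has_path_integral f I' g"
  shows "I = I'"
proof (rule ccontr)
  assume "I \<noteq> I'"
  define e where "e = norm (I - I') / 2"
  have "e > 0" using \<open>I \<noteq> I'\<close> by (simp add: e_def)
  let ?S = "\<lambda>p. \<Sum>(t, k)\<in>p. (g (Sup k) - g (Inf k)) *\<^sub>C f (g t)"
  obtain d1 where d1: "d1 > 0" "\<And>p. p tagged_division_of {0..1} \<Longrightarrow> (\<forall>(t, k)\<in>p. Sup k - Inf k < d1)
      \<Longrightarrow> norm (?S p - I) < e"
    using assms(1) \<open>e > 0\<close> unfolding has_path_integral_def by meson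
  obtain d2 where d2: "d2 > 0" "\<And>p. p tagged_division_of {0..1} \<Longrightarrow> (\<forall>(t, k)\<in>p. Sup k - Inf k < d2)
      \<Longrightarrow> norm (?S p - I') < e"
    using assms(2) \<open>e > 0\<close> unfolding has_path_integral_def by meson
  define d where "d = min d1 d2"
  have "gauge (\<lambda>x::real. ball x (d / 2))" using d1(1) d2(1) by (intro gauge_ball) (simp add: d_def)
  then obtain p where p: "p tagged_division_of {0..1::real}" "(\<lambda>x. ball x (d / 2)) fine p"
    by (metis fine_division_exists box_real(2))
  have mesh: "Sup k - Inf k < d" if tk: "(t, k) \<in> p" for t k
  proof -
    obtain a b where ab: "k = {a..b}" "a \<le> t" "t \<le> b" "Inf k = a" "Sup k = b"
      using tagged_division_unit_interval[OF p(1) tk] by metis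
    moreover have "k \<subseteq> ball t (d / 2)" using p(2) tk by (auto simp: fine_def)
    moreover have "a \<in> k" "b \<in> k" using ab by auto
    ultimately have "a \<in> ball t (d / 2)" "b \<in> ball t (d / 2)" by blast+
    then have "dist a b < d" using dist_triangle2[of a b t] by (simp add: dist_commute)
    then show ?thesis using ab by (simp add: dist_real_def)
  qed
  have "norm (?S p - I) < e" "norm (?S p - I') < e"
    using mesh by (intro d1 d2 p; force simp: d_def)+
  then have "norm (I - I') < e + e"
    using norm_triangle_ineq4[of "?S p - I'" "?S p - I"] by simp
  then show False by (simp add: e_def)
qed

lemma has_path_integral_eq:
  assumes I: "has_path_integral f I g" and eq: "\<And>z. z \<in> path_image g \<Longrightarrow> f z = f' z"
  shows "has_path_integral f' I g"
proof -
  have "(\<Sum>(t, k)\<in>p. (g (Sup k) - g (Inf k)) *\<^sub>C f (g t))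
      = (\<Sum>(t, k)\<in>p. (g (Sup k) - g (Inf k)) *\<^sub>C f' (g t))"
    if p: "p tagged_division_of {0..1}" for p
  proof (rule sum.cong)
    fix x assume x: "x \<in> p"
    obtain t k where tk: "x = (t, k)" by (cases x)
    have "t \<in> {0..1}" using tagged_division_ofD(2,3)[OF p] x tk by blast
    then show "(case x of (t, k) \<Rightarrow> (g (Sup k) - g (Inf k)) *\<^sub>C f (g t))
        = (case x of (t, k) \<Rightarrow> (g (Sup k) - g (Inf k)) *\<^sub>C f' (g t))"
      by (simp add: tk eq path_image_def)
  qed simp
  note sums = this
  show ?thesis
    unfolding has_path_integral_def
  proof (intro allI impI)
    fix e :: real assume "e > 0"
    with I obtain d where d: "d > 0" "\<And>p. p tagged_division_of {0..1} \<and> (\<forall>(t, k)\<in>p. Sup k - Inf k < d)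
      \<Longrightarrow> norm ((\<Sum>(t, k)\<in>p. (g (Sup k) - g (Inf k)) *\<^sub>C f (g t)) - I) < e"
      unfolding has_path_integral_def by blast
    show "\<exists>d>0. \<forall>p. p tagged_division_of {0..1} \<and> (\<forall>(t, k)\<in>p. Sup k - Inf k < d) \<longrightarrow>
        norm ((\<Sum>(t, k)\<in>p. (g (Sup k) - g (Inf k)) *\<^sub>C f' (g t)) - I) < e"
    proof (intro exI conjI allI impI)
      fix p assume p: "p tagged_division_of {0..1} \<and> (\<forall>(t, k)\<in>p. Sup k - Inf k < d)"
      show "norm ((\<Sum>(t, k)\<in>p. (g (Sup k) - g (Inf k)) *\<^sub>C f' (g t)) - I) < e"
        using d(2)[OF p] sums[OF conjunct1[OF p]] by (simp only:)
    qed (rule d(1))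
  qed
qed

lemma path_integral_eqI: "has_path_integral f I g \<Longrightarrow> path_integral g f = I"
  unfolding path_integral_def by (rule the_equality) (auto intro: has_path_integral_unique)

text \<open>On a convex set a holomorphic function has a primitive. Hence the integral over the chord of
  \<open>g\<close> differs from the integral over the corresponding arc of a nearby smooth path \<open>q\<close> by boundary
  terms, which telescope over a division.\<close>

lemma contour_integral_chord:
  assumes f: "f holomorphic_on S" and S: "open S" and q: "valid_path q" "path_image q \<subseteq> S"
    and ab: "0 \<le> a" "a \<le> b" "b \<le> 1"
    and C: "convex C" "open C" "C \<subseteq> S" "g a \<in> C" "g b \<in> C" "q ` {a..b} \<subseteq> C"
  defines "\<Phi> \<equiv> \<lambda>t. contour_integral (subpath 0 t q) f + contour_integral (linepath (q t) (g t)) f"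
  shows "contour_integral (linepath (g a) (g b)) f = \<Phi> b - \<Phi> a"
proof -
  have "continuous_on C f" using f C(3) holomorphic_on_imp_continuous_on holomorphic_on_subset by blast
  moreover have "f field_differentiable at x" if "x \<in> interior C - {}" for x
    using f S C that by (meson Diff_iff holomorphic_on_imp_differentiable_at interior_subset subsetD)
  ultimately obtain F where F: "\<And>x. x \<in> C \<Longrightarrow> (F has_field_derivative f x) (at x within C)"
    using holomorphic_convex_primitive[OF C(1), of "{}" f] by blast
  have prim: "contour_integral c f = F (pathfinish c) - F (pathstart c)"
    if "valid_path c" "path_image c \<subseteq> C" for c
    using contour_integral_primitive[OF F that] by (rule contour_integral_unique)
  have seg: "contour_integral (linepath x y) f = F y - F x" if "x \<in> C" "y \<in> C" for x y
    using prim[of "linepath x y"] that C(1) by (simp add: closed_segment_subset)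
  have qa: "q a \<in> C" "q b \<in> C" using C(6) ab by auto
  have "contour_integral (subpath a b q) f = F (q b) - F (q a)"
    using prim[of "subpath a b q"] C(6) ab q(1)
    by (simp add: valid_path_subpath path_image_subpath)
  moreover have "contour_integral (subpath 0 a q) f + contour_integral (subpath a b q) f
      = contour_integral (subpath 0 b q) f"
    using ab q f S
    by (intro contour_integral_subpath_combine contour_integrable_holomorphic_simple[OF f S]) auto
  ultimately have "contour_integral (subpath 0 b q) f = contour_integral (subpath 0 a q) f + (F (q b) - F (q a))"
    by metis
  then show ?thesis by (simp only: \<Phi>_def seg[OF qa(1) C(4)] seg[OF qa(2) C(5)] seg[OF C(4,5)]) simp
qed

text \<open>Two different members of a tagged division can share their interval only if it is degenerate,
  so the sum over tagged intervals is a sum over the intervals of a division.\<close>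

lemma rectifiable_variation_bound:
  assumes "rectifiable_path g"
  obtains B where "B \<ge> 0"
    "\<And>p. p tagged_division_of {0..1} \<Longrightarrow> (\<Sum>(t, k)\<in>p. norm (g (Sup k) - g (Inf k))) \<le> B"
proof -
  obtain B where B: "\<And>d. d division_of {0..1} \<Longrightarrow> (\<Sum>k\<in>d. norm (g (Sup k) - g (Inf k))) \<le> B"
    using assms unfolding rectifiable_path_def by blast
  have bound: "(\<Sum>(t, k)\<in>p. norm (g (Sup k) - g (Inf k))) \<le> B" if p: "p tagged_division_of {0..1}" for p
  proof -
    have d: "snd ` p division_of {0..1}" using division_of_tagged_division[OF p] .
    \<comment> \<open>\<open>Sup\<close> and \<open>Inf\<close> of the empty set are unspecified reals, so the empty interval is treated apart.\<close>
    define h where "h k = (if k = {} then 0 else norm (g (Sup k) - g (Inf k)))" for k :: "real set"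
    have ne: "k \<noteq> {}" if "k \<in> snd ` p" for k using division_ofD(3)[OF d that] .
    have "(\<Sum>(t, k)\<in>p. norm (g (Sup k) - g (Inf k))) = (\<Sum>(t, k)\<in>p. h k)"
      using ne by (intro sum.cong) (force simp: h_def)+
    also have "\<dots> = (\<Sum>k\<in>snd ` p. h k)"
    proof (rule sum.over_tagged_division_lemma[OF p])
      fix u v :: real assume "box u v = {}"
      then have "v \<le> u" by (simp add: box_real)
      then show "h (cbox u v) = 0" by (cases "u = v") (auto simp: h_def cbox_interval)
    qed
    also have "\<dots> = (\<Sum>k\<in>snd ` p. norm (g (Sup k) - g (Inf k)))"
      using ne by (intro sum.cong) (auto simp: h_def)
    also have "\<dots> \<le> B" by (rule B[OF d])
    finally show ?thesis .
  qed
  show thesis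
  proof (rule that[of "max B 0"])
    show "(\<Sum>(t, k)\<in>p. norm (g (Sup k) - g (Inf k))) \<le> max B 0" if "p tagged_division_of {0..1}" for p
      using bound[OF that] by simp
  qed simp
qed

text \<open>Every inner product with \<open>f\<close> is holomorphic, so its integral over a nearby smooth path equals the
  sum of its integrals over the chords of \<open>g\<close>. A Riemann-Stieltjes sum of \<open>f\<close> differs from the
  latter by at most the oscillation of \<open>f\<close> times the variation of \<open>g\<close>, uniformly over unit
  vectors. Testing with the error vector \<open>y\<close> itself bounds its norm.\<close>

lemma has_path_integral_nearby:
  fixes f :: "complex \<Rightarrow> 'h::complex_hilbert"
  assumes g: "rectifiable_path g" "pathfinish g = pathstart g"
    and S: "open S" "path_image g \<subseteq> S"
    and f: "continuous_on S f" "\<And>y. (\<lambda>w. cinner y (f w)) holomorphic_on S"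
  shows "\<exists>d>0. \<forall>q I. valid_path q \<and> pathstart q = pathstart g \<and> pathfinish q = pathfinish g
      \<and> (\<forall>t\<in>{0..1}. norm (q t - g t) < d)
      \<and> (\<forall>y. ((\<lambda>w. cinner y (f w)) has_contour_integral cinner y I) q)
      \<longrightarrow> has_path_integral f I g"
proof -
  have pg: "path g" using g(1) by (simp add: rectifiable_path_def)
  obtain r where r: "r > 0" "(\<Union>x\<in>path_image g. cball x r) \<subseteq> S"
    using compact_subset_open_imp_cball_epsilon_subset[OF compact_path_image[OF pg] S] .
  obtain B where B: "B \<ge> 0"
    "\<And>p. p tagged_division_of {0..1} \<Longrightarrow> (\<Sum>(t, k)\<in>p. norm (g (Sup k) - g (Inf k))) \<le> B"
    using rectifiable_variation_bound[OF g(1)] by blast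
  show ?thesis
  proof (intro exI[of _ "r / 2"] conjI allI impI; (elim conjE)?)
    show "r / 2 > 0" using r(1) by simp
    fix q I
    assume q: "valid_path q" "pathstart q = pathstart g" "pathfinish q = pathfinish g"
      and "\<forall>t\<in>{0..1}. norm (q t - g t) < r / 2"
      and "\<forall>y. ((\<lambda>w. cinner y (f w)) has_contour_integral cinner y I) q"
    then have near: "\<And>t. t \<in> {0..1} \<Longrightarrow> norm (q t - g t) < r / 2"
      and I: "\<And>y. ((\<lambda>w. cinner y (f w)) has_contour_integral cinner y I) q" by blast+
    have g_in: "g t \<in> path_image g" if "t \<in> {0..1}" for t using that by (simp add: path_image_def)
    have qS: "path_image q \<subseteq> S"
    proof
      fix w assume "w \<in> path_image q"
      then obtain t where t: "t \<in> {0..1}" "w = q t" by (auto simp: path_image_def)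
      then have "w \<in> cball (g t) r" using near[OF t(1)] r(1) by (simp add: dist_norm norm_minus_commute)
      then show "w \<in> S" using r(2) g_in[OF t(1)] by blast
    qed
    show "has_path_integral f I g"
      unfolding has_path_integral_def
    proof (intro allI impI)
      fix e :: real assume "e > 0"
      define e' where "e' = e / (B + 1)"
      have e': "e' > 0" "e' * B < e" using \<open>e > 0\<close> B(1) by (simp_all add: e'_def field_simps)
      define K where "K = (\<lambda>(x, y). x + y) ` (path_image g \<times> cball 0 r)"
      have "compact K" unfolding K_def
        by (intro compact_continuous_image compact_Times compact_path_image pg compact_cball)
          (auto intro!: continuous_intros simp: split_beta)
      moreover have ball_K: "w \<in> K" if "t \<in> {0..1}" "norm (w - g t) \<le> r" for w t
        unfolding K_def using that g_in by (intro image_eqI[of _ _ "(g t, w - g t)"]) auto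
      moreover have "K \<subseteq> S"
        using r(2) by (force simp: K_def dist_norm)
      ultimately have "uniformly_continuous_on K f"
        using f(1) compact_uniformly_continuous continuous_on_subset by blast
      then obtain \<eta> where \<eta>: "\<eta> > 0" "\<And>x x'. x \<in> K \<Longrightarrow> x' \<in> K \<Longrightarrow> dist x' x < \<eta> \<Longrightarrow> dist (f x') (f x) < e'"
        unfolding uniformly_continuous_on_def using e'(1) by metis
      have "uniformly_continuous_on {0..1} g"
        using pg by (simp add: path_def compact_uniformly_continuous)
      moreover have "min (r / 2) \<eta> > 0" using r(1) \<eta>(1) by simp
      ultimately obtain d where d: "d > 0"
        "\<And>s t. s \<in> {0..1} \<Longrightarrow> t \<in> {0..1} \<Longrightarrow> dist t s < d \<Longrightarrow> dist (g t) (g s) < min (r / 2) \<eta>"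
        unfolding uniformly_continuous_on_def by metis
      show "\<exists>d>0. \<forall>p. p tagged_division_of {0..1} \<and> (\<forall>(t, k)\<in>p. Sup k - Inf k < d) \<longrightarrow>
        norm ((\<Sum>(t, k)\<in>p. (g (Sup k) - g (Inf k)) *\<^sub>C f (g t)) - I) < e"
      proof (intro exI conjI allI impI; (elim conjE)?)
        show "d > 0" by fact
        fix p assume p: "p tagged_division_of {0..1}" and mesh: "\<forall>(t, k)\<in>p. Sup k - Inf k < d"
        define \<Sigma> where "\<Sigma> = (\<Sum>(t, k)\<in>p. (g (Sup k) - g (Inf k)) *\<^sub>C f (g t))"
        define y where "y = \<Sigma> - I"
        define h where "h w = cinner y (f w)" for w
        have hol: "h holomorphic_on S" unfolding h_def by (rule f(2))
        define \<Phi> where "\<Phi> t = contour_integral (subpath 0 t q) h + contour_integral (linepath (q t) (g t)) h" for t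
        have piece: "cmod ((g (Sup k) - g (Inf k)) * h (g t) - (\<Phi> (Sup k) - \<Phi> (Inf k)))
            \<le> norm y * e' * norm (g (Sup k) - g (Inf k))" if tk: "(t, k) \<in> p" for t k
        proof -
          obtain a b where ab: "k = {a..b}" "a \<le> t" "t \<le> b" "0 \<le> a" "b \<le> 1" "Inf k = a" "Sup k = b"
            using tagged_division_unit_interval[OF p tk] .
          have t01: "t \<in> {0..1}" using ab by simp
          have close: "dist (g s) (g t) < min (r / 2) \<eta>" if "s \<in> {a..b}" for s
            using that ab mesh tk t01 by (intro d(2)) (auto simp: dist_real_def)
          let ?C = "ball (g t) r"
          have CS: "?C \<subseteq> S" using r(2) g_in[OF t01] ball_subset_cball by blast
          have chord: "contour_integral (linepath (g a) (g b)) h = \<Phi> b - \<Phi> a"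
            unfolding \<Phi>_def
          proof (rule contour_integral_chord[OF hol S(1) q(1) qS, where C = ?C])
            show "g a \<in> ?C" "g b \<in> ?C"
              using close[of a] close[of b] ab r(1) by (auto simp: dist_commute)
            show "q ` {a..b} \<subseteq> ?C"
            proof clarify
              fix s assume s: "s \<in> {a..b}"
              have "dist (q s) (g t) \<le> dist (q s) (g s) + dist (g s) (g t)" by (rule dist_triangle)
              also have "\<dots> < r / 2 + r / 2"
                using near[of s] close[OF s] s ab by (intro add_strict_mono) (auto simp: dist_norm)
              finally show "q s \<in> ?C" by (simp add: dist_commute)
            qed
          qed (use ab CS in auto)
          let ?C' = "ball (g t) (min (r / 2) \<eta>)"
          have seg: "closed_segment (g a) (g b) \<subseteq> ?C'"
            using close[of a] close[of b] ab by (intro closed_segment_subset) (auto simp: dist_commute)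
          have segS: "closed_segment (g a) (g b) \<subseteq> S"
            using seg CS r(1) by force
          have "h contour_integrable_on (linepath (g a) (g b))"
            by (rule contour_integrable_holomorphic_simple[OF hol S(1)]) (use segS in auto)
          then have "((\<lambda>w. h w - h (g t)) has_contour_integral (\<Phi> b - \<Phi> a - h (g t) * (g b - g a)))
              (linepath (g a) (g b))"
            unfolding chord[symmetric]
            by (intro has_contour_integral_diff has_contour_integral_integral has_contour_integral_const_linepath)
          moreover have "norm (h w - h (g t)) \<le> norm y * e'" if w: "w \<in> closed_segment (g a) (g b)" for w
          proof -
            have wt: "dist w (g t) < min (r / 2) \<eta>"
              using subsetD[OF seg w] by (simp add: dist_commute)
            have "dist (f w) (f (g t)) < e'"
              using wt t01 r(1) by (intro \<eta>(2) ball_K[of t]) (auto simp: dist_norm)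
            then have "norm (f w - f (g t)) \<le> e'" by (simp add: dist_norm)
            then show ?thesis
              unfolding h_def cinner_diff_right[symmetric]
              by (rule order_trans[OF cauchy_schwarz mult_left_mono]) simp
          qed
          ultimately have "norm (\<Phi> b - \<Phi> a - h (g t) * (g b - g a)) \<le> norm y * e' * norm (g b - g a)"
            using e'(1) by (intro has_contour_integral_bound_linepath) auto
          then show ?thesis using ab by (simp add: norm_minus_commute mult.commute)
        qed
        have "(\<Sum>(t, k)\<in>p. \<Phi> (Sup k) - \<Phi> (Inf k)) = \<Phi> 1 - \<Phi> 0"
          by (rule additive_tagged_division_1[OF _ p]) simp
        also have "\<dots> = contour_integral q h"
          using q by (simp add: \<Phi>_def pathstart_def pathfinish_def)
        also have "\<dots> = cinner y I" using I[of y] unfolding h_def by (rule contour_integral_unique)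
        finally have \<Phi>_sum: "(\<Sum>(t, k)\<in>p. \<Phi> (Sup k) - \<Phi> (Inf k)) = cinner y I" .
        have "cinner y \<Sigma> = (\<Sum>(t, k)\<in>p. (g (Sup k) - g (Inf k)) * h (g t))"
          by (simp add: \<Sigma>_def h_def cinner_sum_right cinner_scaleC_right split_beta)
        then have "cinner y y = (\<Sum>(t, k)\<in>p. (g (Sup k) - g (Inf k)) * h (g t) - (\<Phi> (Sup k) - \<Phi> (Inf k)))"
          by (subst (2) y_def) (simp add: cinner_diff_right \<Phi>_sum[symmetric] sum_subtractf split_beta)
        then have "cmod (cinner y y) \<le> (\<Sum>(t, k)\<in>p. norm y * e' * norm (g (Sup k) - g (Inf k)))"
          using piece by (auto intro!: order_trans[OF norm_sum] sum_mono simp: split_beta)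
        also have "\<dots> = norm y * e' * (\<Sum>(t, k)\<in>p. norm (g (Sup k) - g (Inf k)))"
          by (simp add: sum_distrib_left split_beta)
        also have "\<dots> \<le> norm y * e' * B"
          using e'(1) B(2)[OF p] by (intro mult_left_mono) auto
        finally have "norm y * norm y \<le> norm y * (e' * B)"
          by (simp add: cinner_self power2_eq_square norm_mult)
        then have "norm y \<le> e' * B \<or> y = 0"
          by (metis mult_left_le_imp_le norm_le_zero_iff not_le)
        then show "norm ((\<Sum>(t, k)\<in>p. (g (Sup k) - g (Inf k)) *\<^sub>C f (g t)) - I) < e"
          using e' \<open>e > 0\<close> by (auto simp: y_def \<Sigma>_def)
      qed
    qed
  qed
qed

text \<open>A polynomial approximation of \<open>g\<close> that avoids \<open>P\<close> and the complement of \<open>N\<close> by a margin is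
  homotopic to \<open>g\<close> in the complement of each of these points.\<close>

lemma nearby_smooth_path:
  assumes g: "simple_path g" "pathfinish g = pathstart g" "\<And>z. z \<in> inside (path_image g) \<Longrightarrow> winding_number g z = 1"
    and N: "open N" "closure (inside (path_image g)) \<subseteq> N" and P: "finite P" "P \<subseteq> inside (path_image g)"
    and d: "d > 0"
  obtains q where "valid_path q" "pathstart q = pathstart g" "pathfinish q = pathfinish g"
    "\<forall>t\<in>{0..1}. norm (q t - g t) < d" "path_image q \<subseteq> N - P"
    "\<forall>w\<in>P. winding_number q w = 1" "\<forall>w. w \<notin> N \<longrightarrow> winding_number q w = 0"
proof -
  have pg: "path g" using g(1) by (rule simple_path_imp_path)
  have fr: "frontier (inside (path_image g)) = path_image g"
    using Jordan_inside_outside[OF g(1,2)] by simp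
  have inS: "path_image g \<subseteq> N - P"
  proof -
    have "path_image g \<subseteq> closure (inside (path_image g))" using fr by (metis frontier_def Diff_subset)
    moreover have "P \<inter> path_image g = {}" using P(2) inside_no_overlap by blast
    ultimately show ?thesis using N(2) by blast
  qed
  have "open (N - P)" using N(1) P(1) by (simp add: finite_imp_closed open_Diff)
  then obtain r where r: "r > 0" "(\<Union>x\<in>path_image g. cball x r) \<subseteq> N - P"
    using compact_subset_open_imp_cball_epsilon_subset[OF compact_path_image[OF pg] _ inS] by blast
  have "min d r > 0" using d r(1) by simp
  then obtain q where q: "polynomial_function q" "pathstart q = pathstart g" "pathfinish q = pathfinish g"
    "\<And>t. t \<in> {0..1} \<Longrightarrow> norm (q t - g t) < min d r"
    using path_approx_polynomial_function[OF pg] by blast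
  have vq: "valid_path q" using q(1) by (rule valid_path_polynomial_function)
  have wn: "winding_number q w = winding_number g w" if w: "w \<notin> N - P" for w
  proof (rule winding_number_nearby_loops_eq)
    fix t :: real assume t: "t \<in> {0..1}"
    have "g t \<in> path_image g" using t by (simp add: path_image_def)
    then have "w \<notin> cball (g t) r" using r(2) w by blast
    then show "norm (q t - g t) < norm (g t - w)" using q(4)[OF t] by (simp add: dist_norm)
  qed (use pg vq q g in \<open>auto simp: valid_path_imp_path\<close>)
  show thesis
  proof (rule that[OF vq q(2,3)])
    show "\<forall>t\<in>{0..1}. norm (q t - g t) < d" using q(4) by simp
    show "path_image q \<subseteq> N - P"
    proof
      fix w assume "w \<in> path_image q"
      then obtain t where t: "t \<in> {0..1}" "w = q t" by (auto simp: path_image_def)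
      then have "w \<in> cball (g t) r" using q(4)[OF t(1)] by (simp add: dist_norm norm_minus_commute)
      moreover have "g t \<in> path_image g" using t(1) by (simp add: path_image_def)
      ultimately show "w \<in> N - P" using r(2) by blast
    qed
    show "\<forall>w\<in>P. winding_number q w = 1" using wn g(3) P(2) by auto
    show "\<forall>w. w \<notin> N \<longrightarrow> winding_number q w = 0"
    proof (intro allI impI)
      fix w assume that: "w \<notin> N"
      have "w \<notin> inside (path_image g) \<union> path_image g"
        using N(2) that closure_subset inS by blast
      then have "w \<in> outside (path_image g)" by (metis UNIV_I Un_iff inside_Un_outside ComplI)
      then show "winding_number q w = 0" using wn[of w] winding_number_zero_in_outside[OF pg g(2)] that by simp
    qed
  qed
qed

section \<open>Resolvents of Jordan matrices\<close>

lemma matrix_inv_apply: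
  fixes A :: "complex ^ 'm ^ 'm"
  assumes "surj ((*v) A)"
  shows "A *v (matrix_inv A *v c) = c" "matrix_inv A *v (A *v c) = c"
proof -
  obtain B where "A ** B = mat 1" using assms matrix_right_invertible_surjective by blast
  then have "\<exists>B. A ** B = mat 1 \<and> B ** A = mat 1" using matrix_left_right_inverse by blast
  then have "A ** matrix_inv A = mat 1 \<and> matrix_inv A ** A = mat 1"
    unfolding matrix_inv_def by (rule someI_ex)
  then show "A *v (matrix_inv A *v c) = c" "matrix_inv A *v (A *v c) = c"
    by (simp_all add: matrix_vector_mul_assoc)
qed

lemma mat_mult_vec: "mat w *v (x :: complex ^ 'm) = w *\<^sub>C x"
  by (simp add: vec_eq_iff matrix_vector_mult_def mat_def if_distrib[of "\<lambda>a. a * _"] cong: if_cong)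

lemma shift_mult_vec: "(mat w - J) *v (x :: complex ^ 'm) = w *\<^sub>C x - J *v x"
  by (simp add: matrix_vector_mult_diff_rdistrib mat_mult_vec)

context
  fixes J :: "complex ^ 'm ^ 'm" and bs :: "('m list \<times> complex) list"
  assumes J: "jordan_form J bs"
begin

lemma jordan_index_exists:
  obtains l b where "l < length bs" "b < length (fst (bs ! l))" "i = fst (bs ! l) ! b"
proof -
  have "i \<in> set (concat (map fst bs))" using J by (simp add: jordan_form_def)
  then obtain x where "x \<in> set bs" "i \<in> set (fst x)" by auto
  then show thesis using that by (metis in_set_conv_nth)
qed

lemma jordan_index_unique:
  assumes "k < length bs" "l < length bs" "a < length (fst (bs ! k))" "b < length (fst (bs ! l))"
  shows "fst (bs ! k) ! a = fst (bs ! l) ! b \<longleftrightarrow> k = l \<and> a = b"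
proof
  assume eq: "fst (bs ! k) ! a = fst (bs ! l) ! b"
  have d: "distinct (concat (map fst bs))" and ne: "[] \<notin> set (map fst bs)"
    using J by (auto simp: jordan_form_def)
  have "distinct (map fst bs)" using d ne by (simp add: distinct_concat_iff)
  moreover have "fst (bs ! k) = fst (bs ! l)"
  proof (rule ccontr)
    assume "fst (bs ! k) \<noteq> fst (bs ! l)"
    then have "set (fst (bs ! k)) \<inter> set (fst (bs ! l)) = {}"
      using d assms(1,2) by (auto simp: distinct_concat_iff)
    then show False using eq assms(3,4) nth_mem by (metis disjoint_iff)
  qed
  ultimately have kl: "k = l" using assms(1,2) by (simp add: distinct_conv_nth) metis
  have "distinct (fst (bs ! l))" using d assms(2) by (auto simp: distinct_concat_iff)
  then show "k = l \<and> a = b" using kl eq assms by (simp add: nth_eq_iff_index_eq)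
qed simp

lemma jordan_column:
  assumes l: "l < length bs" and b: "b < length (fst (bs ! l))"
  shows "J *v axis (fst (bs ! l) ! b) 1 = snd (bs ! l) *\<^sub>C axis (fst (bs ! l) ! b) 1
    + (if b = 0 then 0 else axis (fst (bs ! l) ! (b - 1)) 1)"
proof -
  have "(J *v axis (fst (bs ! l) ! b) 1) $ i = (snd (bs ! l) *\<^sub>C axis (fst (bs ! l) ! b) 1
    + (if b = 0 then 0 else axis (fst (bs ! l) ! (b - 1)) 1)) $ i" for i
  proof -
    obtain k a where ka: "k < length bs" "a < length (fst (bs ! k))" "i = fst (bs ! k) ! a"
      by (rule jordan_index_exists)
    have "(J *v axis (fst (bs ! l) ! b) 1) $ i = J $ i $ (fst (bs ! l) ! b)"
      by (simp add: matrix_vector_mult_def axis_def if_distrib cong: if_cong)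
    also have "\<dots> = (if k = l \<and> a = b then snd (bs ! k) else if k = l \<and> b = Suc a then 1 else 0)"
      using J l b ka unfolding jordan_form_def by blast
    also have "\<dots> = (snd (bs ! l) *\<^sub>C axis (fst (bs ! l) ! b) 1
      + (if b = 0 then 0 else axis (fst (bs ! l) ! (b - 1)) 1)) $ i"
    proof (cases b)
      case 0
      then show ?thesis
        using jordan_index_unique[OF ka(1) l ka(2) b] by (auto simp: axis_def ka(3))
    next
      case (Suc b')
      then have "b' < length (fst (bs ! l))" using b by simp
      then show ?thesis
        using jordan_index_unique[OF ka(1) l ka(2) b] jordan_index_unique[OF ka(1) l ka(2), of b'] Suc
        by (auto simp: axis_def ka(3))
    qed
    finally show ?thesis .
  qed
  then show ?thesis by (simp add: vec_eq_iff)
qed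

lemma jordan_eigenvector:
  assumes "\<mu> \<in> snd ` set bs"
  obtains x where "x \<noteq> 0" "J *v x = \<mu> *\<^sub>C x"
proof -
  obtain l where l: "l < length bs" "snd (bs ! l) = \<mu>" using assms by (metis imageE in_set_conv_nth)
  have "fst (bs ! l) \<noteq> []" using J l(1) by (auto simp: jordan_form_def)
  then have "J *v axis (fst (bs ! l) ! 0) 1 = \<mu> *\<^sub>C axis (fst (bs ! l) ! 0) 1"
    using jordan_column[OF l(1), of 0] l(2) by simp
  moreover have "axis (fst (bs ! l) ! 0) (1::complex) \<noteq> 0"
    by (metis axis_nth zero_index zero_neq_one)
  ultimately show thesis using that by blast
qed

text \<open>Along a Jordan block the equation \<open>(w - J) x = axis i 1\<close> is solved by recursion on the position
  of \<open>i\<close> in the block.\<close>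

lemma jordan_shift_column:
  assumes "l < length bs" "b < length (fst (bs ! l))" "w \<noteq> snd (bs ! l)"
    and "b > 0 \<Longrightarrow> (mat w - J) *v x = axis (fst (bs ! l) ! (b - 1)) 1"
  shows "(mat w - J) *v ((1 / (w - snd (bs ! l))) *\<^sub>C
      (axis (fst (bs ! l) ! b) 1 + (if b = 0 then 0 else x))) = axis (fst (bs ! l) ! b) 1"
proof -
  have "(mat w - J) *v (axis (fst (bs ! l) ! b) 1 + (if b = 0 then 0 else x))
      = (w - snd (bs ! l)) *\<^sub>C axis (fst (bs ! l) ! b) 1"
  proof (cases "b = 0")
    case True
    then show ?thesis
      using jordan_column[OF assms(1,2)] by (simp add: shift_mult_vec cvs.scale_left_diff_distrib)
  next
    case False
    then have x: "(mat w - J) *v x = axis (fst (bs ! l) ! (b - 1)) 1" using assms(4) by simp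
    show ?thesis
      unfolding matrix_vector_right_distrib using False
      by (simp add: x) (simp add: shift_mult_vec jordan_column[OF assms(1,2)] cvs.scale_left_diff_distrib)
  qed
  then show ?thesis
    using assms(3) by (simp only: clinear_scaleC[OF clinear_matrix_vector_mult] cvs.scale_scale) simp
qed

lemma jordan_shift_surj:
  assumes "w \<notin> snd ` set bs"
  shows "surj ((*v) (mat w - J))"
proof -
  have w: "w \<noteq> snd (bs ! l)" if "l < length bs" for l using assms that by (metis imageI nth_mem)
  have "\<exists>x. (mat w - J) *v x = axis i 1" for i
  proof -
    obtain l b where l: "l < length bs" "b < length (fst (bs ! l))" "i = fst (bs ! l) ! b"
      by (rule jordan_index_exists)
    let ?e = "\<lambda>b. axis (fst (bs ! l) ! b) 1 :: complex ^ 'm"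
    have "\<exists>x. (mat w - J) *v x = ?e b" if "b < length (fst (bs ! l))" for b
      using that
    proof (induction b)
      case 0
      then show ?case using jordan_shift_column[OF l(1) 0 w[OF l(1)]] by blast
    next
      case (Suc b)
      then obtain x where "(mat w - J) *v x = ?e b" by auto
      then show ?case using jordan_shift_column[OF l(1) Suc.prems w[OF l(1)], of x] by auto
    qed
    then show ?thesis using l by blast
  qed
  then obtain x where x: "\<And>i. (mat w - J) *v x i = axis i 1" by metis
  show ?thesis
  proof (rule surjI)
    fix c :: "complex ^ 'm"
    show "(mat w - J) *v (\<Sum>i\<in>UNIV. (c $ i) *\<^sub>C x i) = c"
      by (subst (2) vec_sum_axis)
        (simp add: clinear_sum[OF clinear_matrix_vector_mult] clinear_scaleC[OF clinear_matrix_vector_mult] x)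
  qed
qed

abbreviation resolvent_apply :: "complex \<Rightarrow> complex ^ 'm \<Rightarrow> complex ^ 'm" where
  "resolvent_apply w c \<equiv> matrix_inv (mat w - J) *v c"

lemma resolvent_column:
  assumes l: "l < length bs" "b < length (fst (bs ! l))" and w: "w \<notin> snd ` set bs"
  shows "resolvent_apply w (axis (fst (bs ! l) ! b) 1) = (1 / (w - snd (bs ! l))) *\<^sub>C
      (axis (fst (bs ! l) ! b) 1 + (if b = 0 then 0 else resolvent_apply w (axis (fst (bs ! l) ! (b - 1)) 1)))"
proof -
  have "w \<noteq> snd (bs ! l)" using w l by (metis imageI nth_mem)
  note inv = matrix_inv_apply[OF jordan_shift_surj[OF w]]
  from jordan_shift_column[OF l \<open>w \<noteq> _\<close> inv(1)] show ?thesis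
    by (metis inv(2))
qed

lemma resolvent_apply_sum_axis:
  "resolvent_apply w c $ i = (\<Sum>j\<in>UNIV. c $ j * resolvent_apply w (axis j 1) $ i)"
  by (subst clinear_sum_axis[OF clinear_matrix_vector_mult]) simp

lemma resolvent_holomorphic: "(\<lambda>w. resolvent_apply w c $ i) holomorphic_on (- (snd ` set bs))"
proof -
  have col: "(\<lambda>w. resolvent_apply w (axis j 1) $ i) holomorphic_on (- (snd ` set bs))" for j
  proof -
    obtain l b where l: "l < length bs" "b < length (fst (bs ! l))" "j = fst (bs ! l) ! b"
      by (rule jordan_index_exists)
    let ?e = "\<lambda>b. axis (fst (bs ! l) ! b) 1 :: complex ^ 'm"
    have "(\<lambda>w. resolvent_apply w (?e b) $ i) holomorphic_on (- (snd ` set bs))"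
      if "b < length (fst (bs ! l))" for b
      using that
    proof (induction b)
      case 0
      have "(\<lambda>w. (1 / (w - snd (bs ! l))) * ?e 0 $ i) holomorphic_on (- (snd ` set bs))"
        using l(1) by (intro holomorphic_intros) auto
      then show ?case
        by (rule holomorphic_transform) (simp add: resolvent_column[OF l(1) 0])
    next
      case (Suc b)
      have "(\<lambda>w. (1 / (w - snd (bs ! l))) * (?e (Suc b) $ i
          + resolvent_apply w (?e b) $ i)) holomorphic_on (- (snd ` set bs))"
        using l(1) Suc by (intro holomorphic_intros) auto
      then show ?case
        by (rule holomorphic_transform) (subst resolvent_column[OF l(1) Suc.prems], auto)
    qed
    then show ?thesis using l by blast
  qed
  show ?thesis
    unfolding resolvent_apply_sum_axis[of _ c] by (intro holomorphic_intros col)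
qed

text \<open>The higher order terms of the partial fraction expansion have primitives, so only the residue
  \<open>c\<close> of \<open>resolvent_apply w c\<close> contributes. The induction needs the integrals with the additional
  factors \<open>1 / (w - \<mu>) ^ n\<close>.\<close>

lemma resolvent_contour_integral:
  assumes q: "valid_path q" "pathfinish q = pathstart q" "path_image q \<inter> snd ` set bs = {}"
    and wn: "\<And>\<mu>. \<mu> \<in> snd ` set bs \<Longrightarrow> winding_number q \<mu> = 1"
  shows "((\<lambda>w. resolvent_apply w c $ i) has_contour_integral 2 * pi * \<i> * c $ i) q"
proof -
  have base: "((\<lambda>w. 1 / (w - \<mu>) ^ Suc n) has_contour_integral (if n = 0 then 2 * pi * \<i> else 0)) q"
    if \<mu>: "\<mu> \<in> snd ` set bs" for \<mu> n
  proof (cases "n = 0")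
    case True
    have "\<mu> \<notin> path_image q" using q(3) \<mu> by blast
    then show ?thesis
      using has_contour_integral_winding_number[OF q(1)] wn[OF \<mu>] True by fastforce
  next
    case False
    obtain k where n: "n = Suc k" using False by (cases n) auto
    have "((\<lambda>w. 1 / (w - \<mu>) ^ Suc n) has_contour_integral 0) q"
    proof (rule Cauchy_theorem_primitive[of "- {\<mu>}" "\<lambda>w. (- 1 / (1 + of_nat k)) * inverse ((w - \<mu>) ^ Suc k)"])
      fix w assume "w \<in> - {\<mu>}"
      define u where "u = w - \<mu>"
      have u: "u \<noteq> 0" using \<open>w \<in> - {\<mu>}\<close> by (simp add: u_def)
      have k: "1 + of_nat k \<noteq> (0::complex)" by (metis of_nat_Suc of_nat_neq_0)
      have "((\<lambda>w. w - \<mu>) has_field_derivative 1) (at w)"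
        by (auto intro!: derivative_eq_intros)
      then have "((\<lambda>w. (- 1 / (1 + of_nat k)) * inverse ((w - \<mu>) ^ Suc k)) has_field_derivative
          (- 1 / (1 + of_nat k)) * - (inverse (u ^ Suc k) * ((1 + of_nat k) * (1 * u ^ k)) * inverse (u ^ Suc k))) (at w)"
        unfolding u_def using u
        by (intro DERIV_cmult DERIV_inverse' DERIV_power_Suc) (auto simp: u_def)
      also have "(- 1 / (1 + of_nat k)) * - (inverse (u ^ Suc k) * ((1 + of_nat k) * (1 * u ^ k)) * inverse (u ^ Suc k))
          = 1 / u ^ Suc n"
        using u k by (simp add: n divide_simps)
      finally show "((\<lambda>w. (- 1 / (1 + of_nat k)) * inverse ((w - \<mu>) ^ Suc k)) has_field_derivative 1 / (w - \<mu>) ^ Suc n)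
          (at w within - {\<mu>})"
        unfolding u_def by (rule has_field_derivative_at_within)
    qed (use q \<mu> in auto)
    then show ?thesis using False by simp
  qed
  have col: "((\<lambda>w. resolvent_apply w (axis j 1) $ i) has_contour_integral 2 * pi * \<i> * axis j 1 $ i) q" for j
  proof -
    obtain l b where l: "l < length bs" "b < length (fst (bs ! l))" "j = fst (bs ! l) ! b"
      by (rule jordan_index_exists)
    let ?e = "\<lambda>b. axis (fst (bs ! l) ! b) 1 :: complex ^ 'm"
    let ?\<mu> = "snd (bs ! l)"
    have \<mu>: "?\<mu> \<in> snd ` set bs" using l(1) by auto
    have "((\<lambda>w. resolvent_apply w (?e b) $ i / (w - ?\<mu>) ^ n) has_contour_integral
        (if n = 0 then 2 * pi * \<i> * ?e b $ i else 0)) q"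
      if "b < length (fst (bs ! l))" for b n
      using that
    proof (induction b arbitrary: n)
      case 0
      have "((\<lambda>w. (1 / (w - ?\<mu>) ^ Suc n) * ?e 0 $ i) has_contour_integral
          (if n = 0 then 2 * pi * \<i> else 0) * ?e 0 $ i) q"
        by (intro has_contour_integral_rmul base \<mu>)
      then have "((\<lambda>w. resolvent_apply w (?e 0) $ i / (w - ?\<mu>) ^ n) has_contour_integral
          (if n = 0 then 2 * pi * \<i> else 0) * ?e 0 $ i) q"
        by (rule has_contour_integral_eq) (subst resolvent_column[OF l(1) 0], use q(3) in auto)
      then show ?case by (cases "n = 0") auto
    next
      case (Suc b)
      have "((\<lambda>w. (1 / (w - ?\<mu>) ^ Suc n) * ?e (Suc b) $ i
            + resolvent_apply w (?e b) $ i / (w - ?\<mu>) ^ Suc n) has_contour_integral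
          (if n = 0 then 2 * pi * \<i> else 0) * ?e (Suc b) $ i
            + (if Suc n = 0 then 2 * pi * \<i> * ?e b $ i else 0)) q"
        using Suc.prems by (intro has_contour_integral_add has_contour_integral_rmul base \<mu> Suc.IH) simp
      then have "((\<lambda>w. resolvent_apply w (?e (Suc b)) $ i / (w - ?\<mu>) ^ n) has_contour_integral
          (if n = 0 then 2 * pi * \<i> else 0) * ?e (Suc b) $ i
            + (if Suc n = 0 then 2 * pi * \<i> * ?e b $ i else 0)) q"
        by (rule has_contour_integral_eq)
          (subst resolvent_column[OF l(1) Suc.prems], use q(3) in \<open>auto simp: add_divide_distrib\<close>)
      then show ?case by (cases "n = 0") auto
    qed
    from this[OF l(2), of 0] show ?thesis using l(3) by simp
  qed
  have "((\<lambda>w. \<Sum>j\<in>UNIV. c $ j * resolvent_apply w (axis j 1) $ i) has_contour_integral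
      (\<Sum>j\<in>UNIV. c $ j * (2 * pi * \<i> * axis j 1 $ i))) q"
    by (intro has_contour_integral_sum has_contour_integral_lmul col) simp
  also have "(\<Sum>j\<in>UNIV. c $ j * (2 * pi * \<i> * axis j 1 $ i)) = 2 * pi * \<i> * c $ i"
    by (simp add: axis_def if_distrib[of "\<lambda>a. _ * a"] cong: if_cong)
  finally show ?thesis unfolding resolvent_apply_sum_axis[of _ c] .
qed

end

section \<open>Operator-valued holomorphic functions\<close>

lemma bounded_bilinear_scaleC: "bounded_bilinear ((*\<^sub>C) :: complex \<Rightarrow> 'a \<Rightarrow> 'a::complex_hilbert)"
proof
  show "\<exists>K. \<forall>a b. norm (a *\<^sub>C (b :: 'a)) \<le> norm a * norm b * K"
    by (rule exI[of _ 1]) simp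
  show "(r *\<^sub>R a) *\<^sub>C (b :: 'a) = r *\<^sub>R (a *\<^sub>C b)" for r a b
    by (simp add: scaleR_scaleC[of r "a *\<^sub>C b"] scaleR_conv_of_real)
  show "a *\<^sub>C (r *\<^sub>R (b :: 'a)) = r *\<^sub>R (a *\<^sub>C b)" for r a b
    by (simp add: scaleR_scaleC mult.commute)
qed (simp_all add: scaleC_add_left scaleC_add_right)

lemmas continuous_on_scaleC = bounded_bilinear.continuous_on[OF bounded_bilinear_scaleC]
lemmas tendsto_scaleC = bounded_bilinear.tendsto[OF bounded_bilinear_scaleC]
lemmas bounded_linear_scaleC_right = bounded_bilinear.bounded_linear_right[OF bounded_bilinear_scaleC]

lemma bounded_linear_difference_quotient:
  fixes A B C :: "'h \<Rightarrow> 'h::complex_hilbert"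
  assumes "bounded_linear A" "bounded_linear B" "bounded_linear C"
  shows "bounded_linear (\<lambda>u. a *\<^sub>C (A u - B u) - C u)"
  by (intro bounded_linear_sub bounded_linear_compose[OF bounded_linear_scaleC_right] assms)

lemma op_holomorphic_pointwise:
  assumes R: "op_holomorphic_on R N" and z: "z \<in> N"
  obtains A where "\<And>u. ((\<lambda>w. (1 / (w - z)) *\<^sub>C (R w u - R z u)) \<longlongrightarrow> A u) (at z within N)"
proof -
  have bl: "bounded_linear (R w)" if "w \<in> N" for w
    using R that by (simp add: op_holomorphic_on_def bounded_clinear_def)
  obtain A where A: "bounded_clinear A"
    and lim: "((\<lambda>w. onorm (\<lambda>u. (1 / (w - z)) *\<^sub>C (R w u - R z u) - A u)) \<longlongrightarrow> 0) (at z within N)"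
    using R z unfolding op_holomorphic_on_def by blast
  have blA: "bounded_linear A" using A by (simp add: bounded_clinear_def)
  show thesis
  proof (rule that)
    fix u
    have "((\<lambda>w. (1 / (w - z)) *\<^sub>C (R w u - R z u) - A u) \<longlongrightarrow> 0) (at z within N)"
    proof (rule Lim_null_comparison)
      show "\<forall>\<^sub>F w in at z within N. norm ((1 / (w - z)) *\<^sub>C (R w u - R z u) - A u)
          \<le> onorm (\<lambda>u. (1 / (w - z)) *\<^sub>C (R w u - R z u) - A u) * norm u"
        unfolding eventually_at_filter
        by (intro always_eventually allI impI onorm bounded_linear_difference_quotient bl z blA)
      show "((\<lambda>w. onorm (\<lambda>u. (1 / (w - z)) *\<^sub>C (R w u - R z u) - A u) * norm u) \<longlongrightarrow> 0) (at z within N)"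
        using tendsto_mult_left_zero[OF lim] by simp
    qed
    then show "((\<lambda>w. (1 / (w - z)) *\<^sub>C (R w u - R z u)) \<longlongrightarrow> A u) (at z within N)"
      by (simp add: LIM_zero_iff)
  qed
qed

lemma op_holomorphic_continuous:
  assumes R: "op_holomorphic_on R N"
  shows "continuous_on N (\<lambda>w. R w u)"
  unfolding continuous_on_def
proof
  fix z assume z: "z \<in> N"
  obtain A where A: "\<And>u. ((\<lambda>w. (1 / (w - z)) *\<^sub>C (R w u - R z u)) \<longlongrightarrow> A u) (at z within N)"
    using op_holomorphic_pointwise[OF R z] by blast
  have "((\<lambda>w. R z u + (w - z) *\<^sub>C ((1 / (w - z)) *\<^sub>C (R w u - R z u))) \<longlongrightarrow> R z u + (z - z) *\<^sub>C A u) (at z within N)"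
    by (intro tendsto_intros tendsto_scaleC A)
  then have "((\<lambda>w. R z u + (w - z) *\<^sub>C ((1 / (w - z)) *\<^sub>C (R w u - R z u))) \<longlongrightarrow> R z u) (at z within N)"
    by simp
  then show "((\<lambda>w. R w u) \<longlongrightarrow> R z u) (at z within N)"
    by (rule Lim_transform_eventually) (simp add: eventually_at_filter)
qed

lemma op_holomorphic_cinner:
  assumes R: "op_holomorphic_on R N"
  shows "(\<lambda>w. cinner y (R w u)) holomorphic_on N"
  unfolding holomorphic_on_def
proof
  fix z assume z: "z \<in> N"
  obtain A where A: "\<And>u. ((\<lambda>w. (1 / (w - z)) *\<^sub>C (R w u - R z u)) \<longlongrightarrow> A u) (at z within N)"
    using op_holomorphic_pointwise[OF R z] by blast
  have "((\<lambda>w. cinner y ((1 / (w - z)) *\<^sub>C (R w u - R z u))) \<longlongrightarrow> cinner y (A u)) (at z within N)"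
    by (rule bounded_linear.tendsto[OF bounded_linear_cinner A])
  then have "((\<lambda>w. cinner y (R w u)) has_field_derivative cinner y (A u)) (at z within N)"
    by (simp add: has_field_derivative_iff cinner_scaleC_right cinner_diff_right)
  then show "(\<lambda>w. cinner y (R w u)) field_differentiable at z within N"
    using field_differentiable_def by blast
qed

text \<open>The difference quotients converge in norm, so \<open>R\<close> is bounded near each point.\<close>

lemma op_holomorphic_bdd_on_compact:
  assumes R: "op_holomorphic_on R N" and K: "compact K" "K \<subseteq> N"
  shows "bdd_above ((\<lambda>z. onorm (R z)) ` K)"
proof -
  have bl: "bounded_linear (R w)" if "w \<in> N" for w
    using R that by (simp add: op_holomorphic_on_def bounded_clinear_def)
  have "\<exists>d c. d > 0 \<and> (\<forall>w\<in>N \<inter> ball z d. onorm (R w) \<le> c)" if z: "z \<in> N" for z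
  proof -
    obtain A where A: "bounded_clinear A"
      and lim: "((\<lambda>w. onorm (\<lambda>u. (1 / (w - z)) *\<^sub>C (R w u - R z u) - A u)) \<longlongrightarrow> 0) (at z within N)"
      using R z unfolding op_holomorphic_on_def by blast
    have blA: "bounded_linear A" using A by (simp add: bounded_clinear_def)
    from lim have "\<forall>\<^sub>F w in at z within N. onorm (\<lambda>u. (1 / (w - z)) *\<^sub>C (R w u - R z u) - A u) < 1"
      by (rule order_tendstoD(2)) simp
    then obtain d where d: "d > 0" "\<And>w. w \<in> N \<Longrightarrow> w \<noteq> z \<Longrightarrow> dist w z < d
        \<Longrightarrow> onorm (\<lambda>u. (1 / (w - z)) *\<^sub>C (R w u - R z u) - A u) < 1"
      unfolding eventually_at by blast
    let ?c = "onorm (R z) + onorm A + 1"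
    have "onorm (R w) \<le> ?c" if w: "w \<in> N \<inter> ball z (min d 1)" for w
    proof (cases "w = z")
      case True
      then show ?thesis using onorm_pos_le[OF blA] by simp
    next
      case False
      let ?Q = "\<lambda>u. (1 / (w - z)) *\<^sub>C (R w u - R z u) - A u"
      have wN: "w \<in> N" and dz: "dist w z < d" "cmod (w - z) \<le> 1"
        using w by (auto simp: dist_commute dist_norm norm_minus_commute)
      show ?thesis
      proof (rule onorm_bound)
        show "0 \<le> ?c" using onorm_pos_le[OF bl[OF z]] onorm_pos_le[OF blA] by simp
        fix u
        have "norm (?Q u) \<le> onorm ?Q * norm u"
          by (intro onorm bounded_linear_difference_quotient bl blA z wN)
        also have "\<dots> \<le> 1 * norm u"
          using d(2)[OF wN False dz(1)] by (intro mult_right_mono) auto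
        finally have Q: "norm (?Q u) \<le> norm u" by simp
        have "R w u = R z u + (w - z) *\<^sub>C (A u + ?Q u)" using False by simp
        also have "norm \<dots> \<le> norm (R z u) + cmod (w - z) * norm (A u + ?Q u)"
          by (metis norm_scaleC norm_triangle_ineq)
        also have "\<dots> \<le> norm (R z u) + 1 * (norm (A u) + norm (?Q u))"
          using dz(2) by (intro add_left_mono mult_mono norm_triangle_ineq) auto
        also have "\<dots> \<le> onorm (R z) * norm u + 1 * (onorm A * norm u + norm u)"
          using Q by (intro add_mono mult_left_mono onorm bl blA z) auto
        finally show "norm (R w u) \<le> ?c * norm u" by (simp add: algebra_simps)
      qed
    qed
    moreover have "min d 1 > 0" using d(1) by simp
    ultimately show ?thesis by blast
  qed
  then have "\<forall>z. \<exists>d c. z \<in> N \<longrightarrow> d > 0 \<and> (\<forall>w\<in>N \<inter> ball z d. onorm (R w) \<le> c)" by blast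
  then obtain d c where dc: "\<And>z. z \<in> N \<Longrightarrow> d z > 0" "\<And>z w. z \<in> N \<Longrightarrow> w \<in> N \<inter> ball z (d z) \<Longrightarrow> onorm (R w) \<le> c z"
    by metis
  have "K \<subseteq> (\<Union>z\<in>K. ball z (d z))" using dc(1) K(2) by force
  then obtain F where F: "F \<subseteq> K" "finite F" "K \<subseteq> (\<Union>z\<in>F. ball z (d z))"
    using compactE_image[OF K(1), of K "\<lambda>z. ball z (d z)"] by blast
  have "onorm (R w) \<le> Max (c ` F)" if w: "w \<in> K" for w
  proof -
    obtain z where z: "z \<in> F" "w \<in> ball z (d z)" using F(3) w by blast
    then have "onorm (R w) \<le> c z" using dc(2)[of z w] F(1) K(2) w by blast
    also have "\<dots> \<le> Max (c ` F)" using z(1) F(2) by simp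
    finally show ?thesis .
  qed
  then show ?thesis by (intro bdd_aboveI2)
qed

section \<open>Contour moments of Keldysh's expansion\<close>

lemma continuous_on_vec:
  fixes f :: "complex \<Rightarrow> complex ^ 'm"
  assumes "\<And>i. continuous_on S (\<lambda>w. f w $ i)"
  shows "continuous_on S f"
  using continuous_on_vec_lambda[of S "\<lambda>i w. f w $ i"] assms by (simp add: vec_lambda_eta)

lemma cinner_sum_axis:
  fixes V :: "complex ^ 'm \<Rightarrow> 'h::complex_hilbert"
  assumes "clinear V"
  shows "cinner y (V x) = (\<Sum>i\<in>UNIV. x $ i * cinner y (V (axis i 1)))"
proof -
  have "cinner y (V x) = cinner y (\<Sum>i\<in>UNIV. (x $ i) *\<^sub>C V (axis i 1))"
    by (rule arg_cong[OF clinear_sum_axis[OF assms]])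
  then show ?thesis by (simp only: cinner_sum_right cinner_scaleC_right)
qed

context
  fixes \<Omega> :: "complex set" and D :: "'h::complex_hilbert set" and T :: "complex \<Rightarrow> 'h \<Rightarrow> 'h"
    and g :: "real \<Rightarrow> complex" and V W :: "complex ^ 'm \<Rightarrow> 'h" and J :: "complex ^ 'm ^ 'm"
    and R :: "complex \<Rightarrow> 'h \<Rightarrow> 'h"
  assumes adm: "admissible_contour \<Omega> D T g" and kel: "keldysh_expansion \<Omega> D T g V W J R"
begin

abbreviation "region \<equiv> inside (path_image g)"

lemma keldysh_linear: "clinear V" "clinear W"
  using kel by (simp_all add: keldysh_expansion_def)

lemma keldysh_data:
  obtains bs N where "jordan_form J bs" "snd ` set bs = nl_spectrum \<Omega> D T \<inter> region"
    "open N" "closure region \<subseteq> N" "op_holomorphic_on R N"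
    "\<And>z f. z \<in> N \<Longrightarrow> z \<notin> nl_spectrum \<Omega> D T
      \<Longrightarrow> inv_into D (T z) f = V (matrix_inv (mat z - J) *v cadjoint W f) + R z f"
  using kel unfolding keldysh_expansion_def by blast

lemma contour_facts:
  "rectifiable_path g" "simple_path g" "pathfinish g = pathstart g" "path g"
  "\<And>z. z \<in> region \<Longrightarrow> winding_number g z = 1"
  "path_image g \<inter> nl_spectrum \<Omega> D T = {}"
  using adm by (auto simp: admissible_contour_def simple_path_imp_path)

lemma contour_subset_closure_inside: "path_image g \<subseteq> closure region"
  using Jordan_inside_outside[OF contour_facts(2,3)] by (metis frontier_def Diff_subset)

lemma bounded_interior: "bounded region" "open region"
  using Jordan_inside_outside[OF contour_facts(2,3)] by auto

text \<open>The integrand agrees with Keldysh's expansion only off the spectrum, which is known to be finite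
  only inside the contour. The smooth path is therefore used for the right hand side of the
  expansion, which is holomorphic off the eigenvalues of \<open>J\<close> and the poles \<open>P\<close> of the weight \<open>\<phi>\<close>,
  and the two sides are identified on the contour itself.\<close>

lemma keldysh_path_integral:
  assumes P: "finite P" "P \<subseteq> region" and \<phi>: "\<phi> holomorphic_on (- P)"
    and I: "\<And>q bs N y. jordan_form J bs \<Longrightarrow> valid_path q \<Longrightarrow> pathfinish q = pathstart q \<Longrightarrow>
      path_image q \<inter> snd ` set bs = {} \<Longrightarrow> (\<And>\<mu>. \<mu> \<in> snd ` set bs \<union> P \<Longrightarrow> winding_number q \<mu> = 1) \<Longrightarrow>
      snd ` set bs = nl_spectrum \<Omega> D T \<inter> region \<Longrightarrow>
      open N \<Longrightarrow> closure region \<subseteq> N \<Longrightarrow> op_holomorphic_on R N \<Longrightarrow> path_image q \<subseteq> N - P \<Longrightarrow>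
      (\<And>w. w \<notin> N \<Longrightarrow> winding_number q w = 0) \<Longrightarrow>
      ((\<lambda>w. \<phi> w * cinner y (V (matrix_inv (mat w - J) *v cadjoint W h) + R w h)) has_contour_integral cinner y I) q"
  shows "has_path_integral (\<lambda>w. \<phi> w *\<^sub>C inv_into D (T w) h) I g"
proof -
  obtain bs N where J: "jordan_form J bs" and ev: "snd ` set bs = nl_spectrum \<Omega> D T \<inter> region"
    and N: "open N" "closure region \<subseteq> N" and R: "op_holomorphic_on R N"
    and exp: "\<And>z f. z \<in> N \<Longrightarrow> z \<notin> nl_spectrum \<Omega> D T
      \<Longrightarrow> inv_into D (T z) f = V (matrix_inv (mat z - J) *v cadjoint W f) + R z f"
    by (rule keldysh_data) (blast intro: that)
  define E where "E = snd ` set bs \<union> P"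
  have E: "finite E" "E \<subseteq> region" using P by (simp add: E_def) (use P ev in \<open>auto simp: E_def\<close>)
  let ?S = "N - E"
  let ?c = "cadjoint W h"
  define f where "f w = \<phi> w *\<^sub>C (V (matrix_inv (mat w - J) *v ?c) + R w h)" for w
  have S: "open ?S" using N(1) E(1) by (simp add: finite_imp_closed open_Diff)
  have gS: "path_image g \<subseteq> ?S"
    using contour_subset_closure_inside N(2) E(2) inside_no_overlap[of "path_image g"] by blast
  have res: "(\<lambda>w. (matrix_inv (mat w - J) *v ?c) $ i) holomorphic_on ?S" for i
    by (rule holomorphic_on_subset[OF resolvent_holomorphic[OF J]]) (auto simp: E_def)
  have \<phi>S: "\<phi> holomorphic_on ?S" by (rule holomorphic_on_subset[OF \<phi>]) (auto simp: E_def)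
  have cont: "continuous_on ?S f"
    unfolding f_def
  proof (intro continuous_on_scaleC continuous_on_add)
    show "continuous_on ?S \<phi>" using \<phi>S by (rule holomorphic_on_imp_continuous_on)
    show "continuous_on ?S (\<lambda>w. R w h)"
      by (rule continuous_on_subset[OF op_holomorphic_continuous[OF R]]) auto
    show "continuous_on ?S (\<lambda>w. V (matrix_inv (mat w - J) *v ?c))"
      by (intro bounded_linear.continuous_on[OF clinear_bounded_linear[OF keldysh_linear(1)]]
          continuous_on_vec holomorphic_on_imp_continuous_on res)
  qed
  have hol: "(\<lambda>w. cinner y (f w)) holomorphic_on ?S" for y
  proof -
    have "(\<lambda>w. \<phi> w * ((\<Sum>i\<in>UNIV. (matrix_inv (mat w - J) *v ?c) $ i * cinner y (V (axis i 1)))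
        + cinner y (R w h))) holomorphic_on ?S"
      by (intro holomorphic_intros \<phi>S res holomorphic_on_subset[OF op_holomorphic_cinner[OF R]]) auto
    moreover have "cinner y (f w) = \<phi> w * ((\<Sum>i\<in>UNIV. (matrix_inv (mat w - J) *v ?c) $ i * cinner y (V (axis i 1)))
        + cinner y (R w h))" for w
      unfolding f_def cinner_scaleC_right cinner_add_right
      by (subst cinner_sum_axis[OF keldysh_linear(1), of y]) (rule refl)
    ultimately show ?thesis by (simp only:)
  qed
  obtain d where d: "d > 0"
    "\<forall>q I. valid_path q \<and> pathstart q = pathstart g \<and> pathfinish q = pathfinish g
      \<and> (\<forall>t\<in>{0..1}. norm (q t - g t) < d)
      \<and> (\<forall>y. ((\<lambda>w. cinner y (f w)) has_contour_integral cinner y I) q)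
      \<longrightarrow> has_path_integral f I g"
    using has_path_integral_nearby[OF contour_facts(1,3) S gS cont hol] by (elim exE conjE)
  obtain q where q: "valid_path q" "pathstart q = pathstart g" "pathfinish q = pathfinish g"
    "\<forall>t\<in>{0..1}. norm (q t - g t) < d" "path_image q \<subseteq> N - E"
    "\<forall>w\<in>E. winding_number q w = 1" "\<forall>w. w \<notin> N \<longrightarrow> winding_number q w = 0"
    using nearby_smooth_path[OF contour_facts(2,3,5) N E d(1)] .
  have "has_path_integral f I g"
  proof (intro d(2)[rule_format] conjI allI)
    fix y
    have "((\<lambda>w. \<phi> w * cinner y (V (matrix_inv (mat w - J) *v ?c) + R w h)) has_contour_integral cinner y I) q"
      by (rule I[OF J q(1) _ _ _ ev N R]) (use q contour_facts(3) in \<open>auto simp: E_def\<close>)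
    then show "((\<lambda>w. cinner y (f w)) has_contour_integral cinner y I) q"
      by (simp add: f_def cinner_scaleC_right)
  qed (rule q(1-4))+
  then show ?thesis
  proof (rule has_path_integral_eq)
    fix w assume w: "w \<in> path_image g"
    then have "w \<in> N" "w \<notin> nl_spectrum \<Omega> D T" using gS contour_facts(6) by blast+
    then show "f w = \<phi> w *\<^sub>C inv_into D (T w) h" by (simp add: f_def exp)
  qed
qed

lemma contour_integral_through_V:
  fixes r :: "complex \<Rightarrow> complex ^ 'm"
  assumes "\<And>i. ((\<lambda>w. \<phi> w * r w $ i) has_contour_integral c * d $ i) q"
  shows "((\<lambda>w. \<phi> w * cinner y (V (r w))) has_contour_integral c * cinner y (V d)) q"
proof -
  have "((\<lambda>w. \<Sum>i\<in>UNIV. \<phi> w * r w $ i * cinner y (V (axis i 1))) has_contour_integral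
      (\<Sum>i\<in>UNIV. c * d $ i * cinner y (V (axis i 1)))) q"
    by (intro has_contour_integral_sum has_contour_integral_rmul assms) simp
  moreover have "(\<Sum>i\<in>UNIV. \<phi> w * r w $ i * cinner y (V (axis i 1))) = \<phi> w * cinner y (V (r w))" for w
    unfolding cinner_sum_axis[OF keldysh_linear(1), of y "r w"] by (simp only: sum_distrib_left mult.assoc)
  moreover have "(\<Sum>i\<in>UNIV. c * d $ i * cinner y (V (axis i 1))) = c * cinner y (V d)"
    unfolding cinner_sum_axis[OF keldysh_linear(1), of y d] by (simp only: sum_distrib_left mult.assoc)
  ultimately show ?thesis by (simp only:)
qed

lemma keldysh_moment_0:
  "has_path_integral (\<lambda>w. 1 *\<^sub>C inv_into D (T w) h) ((2 * pi * \<i>) *\<^sub>C V (cadjoint W h)) g"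
proof (rule keldysh_path_integral[where P = "{}"])
  fix q bs N y
  assume A: "jordan_form J bs" "valid_path q" "pathfinish q = pathstart q" "path_image q \<inter> snd ` set bs = {}"
    "\<And>\<mu>. \<mu> \<in> snd ` set bs \<union> {} \<Longrightarrow> winding_number q \<mu> = 1"
    "open N" "op_holomorphic_on R N" "path_image q \<subseteq> N - {}" "\<And>w. w \<notin> N \<Longrightarrow> winding_number q w = 0"
  have "((\<lambda>w. 1 * cinner y (V (matrix_inv (mat w - J) *v cadjoint W h))) has_contour_integral
      2 * pi * \<i> * cinner y (V (cadjoint W h))) q"
    by (rule contour_integral_through_V) (use resolvent_contour_integral[OF A(1-4)] A(5) in simp)
  moreover have "((\<lambda>w. cinner y (R w h)) has_contour_integral 0) q"
    by (rule Cauchy_theorem_global[OF A(6) op_holomorphic_cinner[OF A(7)] A(2,3)]) (use A in auto)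
  ultimately have "((\<lambda>w. 1 * cinner y (V (matrix_inv (mat w - J) *v cadjoint W h)) + cinner y (R w h))
      has_contour_integral 2 * pi * \<i> * cinner y (V (cadjoint W h)) + 0) q"
    by (rule has_contour_integral_add)
  then show "((\<lambda>w. 1 * cinner y (V (matrix_inv (mat w - J) *v cadjoint W h) + R w h))
      has_contour_integral cinner y ((2 * pi * \<i>) *\<^sub>C V (cadjoint W h))) q"
    by (simp add: cinner_add_right cinner_scaleC_right)
qed auto

text \<open>Here \<open>w (w - J)\<^sup>-\<^sup>1 = 1 + J (w - J)\<^sup>-\<^sup>1\<close> reduces the first moment to the resolvent.\<close>

lemma keldysh_moment_1:
  "has_path_integral (\<lambda>w. w *\<^sub>C inv_into D (T w) h) ((2 * pi * \<i>) *\<^sub>C V (J *v cadjoint W h)) g"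
proof (rule keldysh_path_integral[where P = "{}"])
  fix q bs N y
  assume A: "jordan_form J bs" "valid_path q" "pathfinish q = pathstart q" "path_image q \<inter> snd ` set bs = {}"
    "\<And>\<mu>. \<mu> \<in> snd ` set bs \<union> {} \<Longrightarrow> winding_number q \<mu> = 1"
    "open N" "op_holomorphic_on R N" "path_image q \<subseteq> N - {}" "\<And>w. w \<notin> N \<Longrightarrow> winding_number q w = 0"
  let ?c = "cadjoint W h"
  let ?r = "\<lambda>w. matrix_inv (mat w - J) *v ?c"
  have "((\<lambda>w. w * ?r w $ i) has_contour_integral 2 * pi * \<i> * (J *v ?c) $ i) q" for i
  proof -
    have "((\<lambda>w. ?c $ i) has_contour_integral 0) q"
      by (rule Cauchy_theorem_global[of UNIV]) (use A in auto)
    moreover have "((\<lambda>w. \<Sum>j\<in>UNIV. J $ i $ j * ?r w $ j) has_contour_integral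
        (\<Sum>j\<in>UNIV. J $ i $ j * (2 * pi * \<i> * ?c $ j))) q"
      by (intro has_contour_integral_sum has_contour_integral_lmul resolvent_contour_integral[OF A(1-4)])
        (use A(5) in auto)
    ultimately have "((\<lambda>w. ?c $ i + (\<Sum>j\<in>UNIV. J $ i $ j * ?r w $ j)) has_contour_integral
        0 + (\<Sum>j\<in>UNIV. J $ i $ j * (2 * pi * \<i> * ?c $ j))) q"
      by (rule has_contour_integral_add)
    also have "0 + (\<Sum>j\<in>UNIV. J $ i $ j * (2 * pi * \<i> * ?c $ j)) = 2 * pi * \<i> * (J *v ?c) $ i"
      by (simp add: matrix_vector_mult_def sum_distrib_left mult_ac)
    finally have "((\<lambda>w. ?c $ i + (\<Sum>j\<in>UNIV. J $ i $ j * ?r w $ j)) has_contour_integral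
        2 * pi * \<i> * (J *v ?c) $ i) q" .
    then show ?thesis
    proof (rule has_contour_integral_eq)
      fix w assume "w \<in> path_image q"
      then have w: "w \<notin> snd ` set bs" using A(4) by blast
      have "w *\<^sub>C ?r w - J *v ?r w = ?c"
        using matrix_inv_apply(1)[OF jordan_shift_surj[OF A(1) w], of ?c] by (simp add: shift_mult_vec)
      then have "(w *\<^sub>C ?r w) $ i = (?c + J *v ?r w) $ i" by (metis diff_add_cancel)
      then show "?c $ i + (\<Sum>j\<in>UNIV. J $ i $ j * ?r w $ j) = w * ?r w $ i"
        by (simp add: matrix_vector_mult_def[of J])
    qed
  qed
  then have "((\<lambda>w. w * cinner y (V (?r w))) has_contour_integral 2 * pi * \<i> * cinner y (V (J *v ?c))) q"
    by (rule contour_integral_through_V)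
  moreover have "((\<lambda>w. w * cinner y (R w h)) has_contour_integral 0) q"
    by (rule Cauchy_theorem_global[OF A(6) _ A(2,3)])
      (use A in \<open>auto intro!: holomorphic_intros op_holomorphic_cinner\<close>)
  ultimately have "((\<lambda>w. w * cinner y (V (?r w)) + w * cinner y (R w h)) has_contour_integral
      2 * pi * \<i> * cinner y (V (J *v ?c)) + 0) q"
    by (rule has_contour_integral_add)
  then show "((\<lambda>w. w * cinner y (V (?r w) + R w h)) has_contour_integral
      cinner y ((2 * pi * \<i>) *\<^sub>C V (J *v ?c))) q"
    by (simp add: cinner_add_right cinner_scaleC_right distrib_left)
qed auto

text \<open>The resolvent part of the expansion decays like \<open>1 / w\<^sup>2\<close> after division by \<open>w - z\<close> and has all
  its poles inside the contour, so it does not contribute to the Cauchy integral. This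
  recovers \<open>R z\<close> from the values of the inverse of \<open>T\<close> on the contour.\<close>

lemma keldysh_remainder_integral:
  assumes z: "z \<in> region" "z \<notin> nl_spectrum \<Omega> D T"
  shows "has_path_integral (\<lambda>w. (1 / (w - z)) *\<^sub>C inv_into D (T w) h) ((2 * pi * \<i>) *\<^sub>C R z h) g"
proof (rule keldysh_path_integral[where P = "{z}"])
  show "(\<lambda>w. 1 / (w - z)) holomorphic_on - {z}" by (intro holomorphic_intros) auto
  fix q bs N y
  assume A: "jordan_form J bs" "valid_path q" "pathfinish q = pathstart q" "path_image q \<inter> snd ` set bs = {}"
    "\<And>\<mu>. \<mu> \<in> snd ` set bs \<union> {z} \<Longrightarrow> winding_number q \<mu> = 1"
    "snd ` set bs = nl_spectrum \<Omega> D T \<inter> region" "closure region \<subseteq> N"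
    "open N" "op_holomorphic_on R N" "path_image q \<subseteq> N - {z}" "\<And>w. w \<notin> N \<Longrightarrow> winding_number q w = 0"
  let ?r = "\<lambda>w c. matrix_inv (mat w - J) *v c"
  have "z \<notin> snd ` set bs" using z(2) A(6) by blast
  then obtain d where d: "(mat z - J) *v d = cadjoint W h"
    using matrix_inv_apply(1)[OF jordan_shift_surj[OF A(1)]] by metis
  have "((\<lambda>w. 1 / (w - z) * ?r w (cadjoint W h) $ i) has_contour_integral 0 * (0 :: complex ^ 'm) $ i) q" for i
  proof -
    have "((\<lambda>w. 1 / (w - z) * d $ i) has_contour_integral 2 * pi * \<i> * d $ i) q"
      using has_contour_integral_winding_number[OF A(2), of z] A(5)[of z] A(10)
      by (intro has_contour_integral_rmul) auto
    moreover have "((\<lambda>w. ?r w d $ i) has_contour_integral 2 * pi * \<i> * d $ i) q"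
      by (rule resolvent_contour_integral[OF A(1-4)]) (use A(5) in auto)
    ultimately have "((\<lambda>w. 1 / (w - z) * d $ i - ?r w d $ i) has_contour_integral
        2 * pi * \<i> * d $ i - 2 * pi * \<i> * d $ i) q"
      by (rule has_contour_integral_diff)
    then have "((\<lambda>w. 1 / (w - z) * ?r w (cadjoint W h) $ i) has_contour_integral
        2 * pi * \<i> * d $ i - 2 * pi * \<i> * d $ i) q"
    proof (rule has_contour_integral_eq)
      fix w assume w: "w \<in> path_image q"
      then have w': "w \<notin> snd ` set bs" "w - z \<noteq> 0" using A(4,10) by auto
      have "cadjoint W h = (mat w - J) *v d - (w - z) *\<^sub>C d"
        unfolding d[symmetric] by (simp add: shift_mult_vec cvs.scale_left_diff_distrib)
      then have "?r w (cadjoint W h) = d - (w - z) *\<^sub>C ?r w d"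
        by (simp add: clinear_diff[OF clinear_matrix_vector_mult] clinear_scaleC[OF clinear_matrix_vector_mult]
            matrix_inv_apply(2)[OF jordan_shift_surj[OF A(1) w'(1)]])
      then have "?r w (cadjoint W h) $ i = d $ i - (w - z) * ?r w d $ i" by simp
      then show "1 / (w - z) * d $ i - ?r w d $ i = 1 / (w - z) * ?r w (cadjoint W h) $ i"
        using w'(2) by (simp add: right_diff_distrib)
    qed
    then show ?thesis by simp
  qed
  then have "((\<lambda>w. 1 / (w - z) * cinner y (V (?r w (cadjoint W h)))) has_contour_integral 0 * cinner y (V 0)) q"
    by (rule contour_integral_through_V)
  moreover have "((\<lambda>w. cinner y (R w h) / (w - z)) has_contour_integral
      2 * pi * \<i> * winding_number q z * cinner y (R z h)) q"
  proof (rule Cauchy_integral_formula_global[OF A(8) op_holomorphic_cinner[OF A(9)] _ A(2)])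
    show "z \<in> N" using z(1) A(7) closure_subset by blast
  qed (use A in auto)
  ultimately have "((\<lambda>w. 1 / (w - z) * cinner y (V (?r w (cadjoint W h))) + cinner y (R w h) / (w - z))
      has_contour_integral 0 * cinner y (V 0) + 2 * pi * \<i> * winding_number q z * cinner y (R z h)) q"
    by (rule has_contour_integral_add)
  then show "((\<lambda>w. 1 / (w - z) * cinner y (V (?r w (cadjoint W h)) + R w h)) has_contour_integral
      cinner y ((2 * pi * \<i>) *\<^sub>C R z h)) q"
    using A(5)[of z] by (simp add: cinner_add_right cinner_scaleC_right distrib_left)
qed (use z in auto)

lemma keldysh_contour_moments:
  "contour_moment 0 D T g X x = V (cadjoint W (X x))"
  "contour_moment 1 D T g X x = V (J *v cadjoint W (X x))"
  using path_integral_eqI[OF keldysh_moment_0[of "X x"]] path_integral_eqI[OF keldysh_moment_1[of "X x"]]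
  by (simp_all add: contour_moment_def)

lemma keldysh_remainder_bounded:
  shows "bdd_above ((\<lambda>z. onorm (R z)) ` region)"
    and "\<And>z. z \<in> region \<Longrightarrow> bounded_linear (R z)"
proof -
  obtain bs N where J: "jordan_form J bs" and ev: "snd ` set bs = nl_spectrum \<Omega> D T \<inter> region"
    and N: "open N" "closure region \<subseteq> N" and R: "op_holomorphic_on R N"
    by (rule keldysh_data) (blast intro: that)
  have "compact (closure region)" using bounded_interior(1) by simp
  from op_holomorphic_bdd_on_compact[OF R this N(2)]
  show "bdd_above ((\<lambda>z. onorm (R z)) ` region)"
    by (rule bdd_above_mono) (auto intro: subsetD[OF closure_subset])
  show "bounded_linear (R z)" if "z \<in> region" for z
    using R N(2) that closure_subset by (auto simp: op_holomorphic_on_def bounded_clinear_def)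
qed

lemma keldysh_inside:
  assumes z: "z \<in> region"
  shows "z \<in> nl_spectrum \<Omega> D T \<Longrightarrow> \<exists>x. x \<noteq> 0 \<and> J *v x = z *\<^sub>C x"
    and "z \<notin> nl_spectrum \<Omega> D T \<Longrightarrow> surj ((*v) (mat z - J))"
    and "z \<notin> nl_spectrum \<Omega> D T \<Longrightarrow> inv_into D (T z) f = V (matrix_inv (mat z - J) *v cadjoint W f) + R z f"
proof -
  obtain bs N where J: "jordan_form J bs" and ev: "snd ` set bs = nl_spectrum \<Omega> D T \<inter> region"
    and N: "open N" "closure region \<subseteq> N"
    and exp: "\<And>z f. z \<in> N \<Longrightarrow> z \<notin> nl_spectrum \<Omega> D T
      \<Longrightarrow> inv_into D (T z) f = V (matrix_inv (mat z - J) *v cadjoint W f) + R z f"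
    by (rule keldysh_data) (blast intro: that)
  show "\<exists>x. x \<noteq> 0 \<and> J *v x = z *\<^sub>C x" if "z \<in> nl_spectrum \<Omega> D T"
  proof -
    have "z \<in> snd ` set bs" using ev z that by simp
    from jordan_eigenvector[OF J this] show ?thesis by metis
  qed
  show "surj ((*v) (mat z - J))" if "z \<notin> nl_spectrum \<Omega> D T"
    by (rule jordan_shift_surj[OF J]) (simp add: ev that)
  show "inv_into D (T z) f = V (matrix_inv (mat z - J) *v cadjoint W f) + R z f"
    if "z \<notin> nl_spectrum \<Omega> D T"
    by (rule exp[OF _ that]) (use z N(2) closure_subset in blast)
qed

lemma keldysh_remainder_near:
  assumes z: "z \<in> region"
  shows "((\<lambda>w. R w h) \<longlongrightarrow> R z h) (at z)"
    and "\<forall>\<^sub>F w in at z. w \<in> region \<and> w \<notin> nl_spectrum \<Omega> D T"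
proof -
  obtain bs N where J: "jordan_form J bs" and ev: "snd ` set bs = nl_spectrum \<Omega> D T \<inter> region"
    and N: "open N" "closure region \<subseteq> N" and R: "op_holomorphic_on R N"
    by (rule keldysh_data) (blast intro: that)
  have zN: "z \<in> N" using z N(2) closure_subset by blast
  show "((\<lambda>w. R w h) \<longlongrightarrow> R z h) (at z)"
    using op_holomorphic_continuous[OF R, of h] zN N(1)
    by (metis at_within_open continuous_on_def)
  have "finite (snd ` set bs - {z})" by simp
  then have "open (region - (snd ` set bs - {z}))"
    using bounded_interior(2) by (intro open_Diff finite_imp_closed)
  moreover have "z \<in> region - (snd ` set bs - {z})" using z by simp
  ultimately have "\<forall>\<^sub>F w in at z. w \<in> region - (snd ` set bs - {z})"
    using eventually_at_in_open' by blast
  moreover have "\<forall>\<^sub>F w in at z. w \<noteq> z" by (simp add: eventually_at_filter)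
  ultimately show "\<forall>\<^sub>F w in at z. w \<in> region \<and> w \<notin> nl_spectrum \<Omega> D T"
    by eventually_elim (use ev in auto)
qed

end

text \<open>\<open>V W\<^sup>*\<close> is the zeroth moment and \<open>R z\<close> a Cauchy integral over the contour for regular \<open>z\<close>; at the
  eigenvalues \<open>R z\<close> is determined by continuity. Hence a constant that is built from the norms
  and singular values of one expansion serves for all of them.\<close>

lemma keldysh_expansion_unique:
  assumes adm: "admissible_contour \<Omega> D T g"
    and 1: "keldysh_expansion \<Omega> D T g V W J R" and 2: "keldysh_expansion \<Omega> D T g V' W' J' R'"
  shows "V \<circ> cadjoint W = V' \<circ> cadjoint W'"
    and "z \<in> inside (path_image g) \<Longrightarrow> R z = R' z"
proof -
  show "V \<circ> cadjoint W = V' \<circ> cadjoint W'"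
  proof
    fix f
    show "(V \<circ> cadjoint W) f = (V' \<circ> cadjoint W') f"
      using has_path_integral_unique[OF keldysh_moment_0[OF adm 1, of f] keldysh_moment_0[OF adm 2, of f]]
      by simp
  qed
  have regular: "R w h = R' w h" if "w \<in> inside (path_image g)" "w \<notin> nl_spectrum \<Omega> D T" for w h
    using has_path_integral_unique[OF keldysh_remainder_integral[OF adm 1 that]
        keldysh_remainder_integral[OF adm 2 that]] by simp
  assume z: "z \<in> inside (path_image g)"
  show "R z = R' z"
  proof
    fix h
    have "((\<lambda>w. R w h) \<longlongrightarrow> R' z h) (at z)"
      by (rule Lim_transform_eventually[OF keldysh_remainder_near(1)[OF adm 2 z]])
        (use keldysh_remainder_near(2)[OF adm 1 z] regular in \<open>auto elim!: eventually_mono\<close>)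
    then show "R z h = R' z h"
      using keldysh_remainder_near(1)[OF adm 1 z] tendsto_unique[OF at_neq_bot] by blast
  qed
qed

section \<open>Pseudospectra and the norm of the inverse\<close>

lemma clinear_inv:
  assumes A: "clinear A" "bij A"
  shows "clinear (inv A)"
proof (rule clinearI)
  have 1: "A (inv A x) = x" for x using A(2) by (simp add: bij_is_surj surj_f_inv_f)
  have 2: "inv A (A x) = x" for x using A(2) by (simp add: bij_is_inj)
  show "inv A (x + y) = inv A x + inv A y" for x y
    by (metis 1 2 clinear_add[OF A(1)])
  show "inv A (a *\<^sub>C x) = a *\<^sub>C inv A x" for a x
    by (metis 1 2 clinear_scaleC[OF A(1)])
qed

text \<open>The Neumann series, in the form of the contraction \<open>g \<mapsto> f - K g\<close>.\<close>

lemma bounded_clinear_identity_plus: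
  assumes K: "bounded_clinear K" and q: "q < 1" "\<And>g. norm (K g) \<le> q * norm g"
  shows "bij (\<lambda>g. g + K g)" "bounded_clinear (inv (\<lambda>g. g + K g))"
proof -
  let ?L = "\<lambda>g. g + K g"
  have lin: "clinear K" using K by (simp add: bounded_clinear_def)
  have linL: "clinear ?L"
    by (intro clinearI) (simp_all add: clinear_add[OF lin] clinear_scaleC[OF lin] scaleC_add_right)
  have lower: "(1 - q) * norm g \<le> norm (?L g)" for g
    using norm_triangle_ineq2[of g "- K g"] q(2)[of g] by (simp add: algebra_simps)
  have ex: "\<exists>g. ?L g = f" for f
  proof -
    define q' where "q' = max q 0"
    have lip: "dist (f - K x) (f - K y) \<le> q' * dist x y" for x y
    proof -
      have "dist (f - K x) (f - K y) = norm (K (y - x))"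
        by (simp add: dist_norm clinear_diff[OF lin])
      also have "\<dots> \<le> q * norm (y - x)" by (rule q(2))
      also have "\<dots> \<le> q' * norm (y - x)" by (intro mult_right_mono) (auto simp: q'_def)
      finally show ?thesis by (simp add: dist_norm norm_minus_commute)
    qed
    have "\<exists>!x. f - K x = x"
      by (rule banach_fix_type[where c = q']) (use q(1) lip in \<open>auto simp: q'_def\<close>)
    then obtain x where "f - K x = x" by blast
    then have "x + K x = f" by (metis diff_add_cancel)
    then show ?thesis by blast
  qed
  have "inj ?L"
    unfolding clinear_inj_iff[OF linL]
  proof (intro allI impI)
    fix g assume "g + K g = 0"
    with lower[of g] q(1) show "g = 0" by (simp add: mult_le_0_iff)
  qed
  moreover have "surj ?L" using ex by (metis surjI surj_def)
  ultimately show bij: "bij ?L" by (simp add: bij_def)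
  have lin': "clinear (inv ?L)" by (rule clinear_inv[OF linL bij])
  have "bounded_linear (inv ?L)"
  proof (rule bounded_linear_intro)
    fix f
    have "(1 - q) * norm (inv ?L f) \<le> norm (?L (inv ?L f))" by (rule lower)
    also have "?L (inv ?L f) = f" using surj_f_inv_f[OF bij_is_surj[OF bij]] .
    finally show "norm (inv ?L f) \<le> norm f * (1 / (1 - q))" using q(1) by (simp add: field_simps)
  qed (simp_all add: clinear_add[OF lin'] clinear_scaleC[OF lin'] scaleR_scaleC)
  with lin' show "bounded_clinear (inv ?L)" by (simp add: bounded_clinear_def)
qed

lemma invertible_on_perturb:
  assumes A: "invertible_on D A" and E: "bounded_clinear E"
    and q: "q < 1" "\<And>f. norm (E (inv_into D A f)) \<le> q * norm f"
  shows "invertible_on D (\<lambda>u. A u + E u)"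
proof -
  let ?S = "inv_into D A" and ?B = "\<lambda>u. A u + E u"
  have bij: "bij_betw A D UNIV" and S: "bounded_clinear ?S" using A by (auto simp: invertible_on_def)
  have SA: "?S (A u) = u" if "u \<in> D" for u using bij that by (simp add: bij_betw_inv_into_left)
  have "f \<in> A ` D" for f using bij by (simp add: bij_betw_def)
  then have AS: "A (?S f) = f" and SD: "?S f \<in> D" for f
    by (simp_all add: f_inv_into_f inv_into_into)
  have K: "bounded_clinear (\<lambda>g. E (?S g))"
    using E S clinear_compose[of E ?S] bounded_linear_compose[of E ?S]
    by (auto simp: bounded_clinear_def comp_def)
  let ?L = "\<lambda>g. g + E (?S g)"
  note L = bounded_clinear_identity_plus[OF K q]
  have BL: "?B u = ?L (A u)" if "u \<in> D" for u by (simp add: SA[OF that])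
  have "bij_betw (?L \<circ> A) D UNIV" using bij_betw_trans[OF bij L(1)] .
  then have bijB: "bij_betw ?B D UNIV"
    by (rule bij_betw_cong[THEN iffD1, rotated]) (simp add: BL)
  have "inv_into D ?B = ?S \<circ> inv ?L"
  proof
    fix f
    show "inv_into D ?B f = (?S \<circ> inv ?L) f"
    proof (rule inv_into_f_eq)
      show "inj_on ?B D" using bijB by (simp add: bij_betw_def)
      show "(?S \<circ> inv ?L) f \<in> D" by (simp add: SD)
      show "?B ((?S \<circ> inv ?L) f) = f"
        using surj_f_inv_f[OF bij_is_surj[OF L(1)], of f] by (simp add: AS)
    qed
  qed
  moreover have "bounded_clinear (?S \<circ> inv ?L)"
    using S L(2) clinear_compose[of ?S "inv ?L"] bounded_linear_compose[of ?S "inv ?L"]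
    by (auto simp: bounded_clinear_def comp_def)
  ultimately show ?thesis using bijB by (simp add: invertible_on_def)
qed

lemma bounded_clinear_const_holomorphic:
  assumes "bounded_clinear E"
  shows "op_holomorphic_on (\<lambda>_. E) \<Omega>"
  unfolding op_holomorphic_on_def
proof (intro conjI ballI exI[of _ "\<lambda>_. 0"])
  show "bounded_clinear E" by fact
  show "bounded_clinear (\<lambda>_ :: 'a. 0 :: 'a)"
    by (auto simp: bounded_clinear_def intro!: clinearI)
qed (simp_all add: onorm_zero)

lemma pseudospectrumI_const:
  assumes z: "z \<in> \<Omega>" and E: "bounded_clinear E" "onorm E < \<eta>"
    and sing: "\<not> invertible_on D (\<lambda>u. T z u + E u)"
  shows "z \<in> pseudospectrum \<eta> \<Omega> D T"
proof -
  have img: "(\<lambda>w. onorm ((\<lambda>_. E) w)) ` \<Omega> = {onorm E}" using z by auto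
  have "op_holomorphic_on (\<lambda>_. E) \<Omega> \<and> bdd_above ((\<lambda>w. onorm ((\<lambda>_. E) w)) ` \<Omega>) \<and>
        (SUP w\<in>\<Omega>. onorm ((\<lambda>_. E) w)) < \<eta>"
    using bounded_clinear_const_holomorphic[OF E(1)] E(2) unfolding img by simp
  moreover have "z \<in> nl_spectrum \<Omega> D (\<lambda>w u. T w u + (\<lambda>_. E) w u)"
    using z sing by (simp add: nl_spectrum_def)
  ultimately show ?thesis unfolding pseudospectrum_def by blast
qed

lemma spectrum_subset_pseudospectrum:
  assumes "z \<in> nl_spectrum \<Omega> D T" "\<eta> > 0"
  shows "z \<in> pseudospectrum \<eta> \<Omega> D T"
proof (rule pseudospectrumI_const[where E = "\<lambda>_. 0"])
  show "bounded_clinear (\<lambda>_ :: 'a. 0 :: 'a)"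
    by (auto simp: bounded_clinear_def intro!: clinearI)
qed (use assms in \<open>auto simp: nl_spectrum_def onorm_zero\<close>)

text \<open>If \<open>T z u = f\<close> with \<open>f\<close> small compared to \<open>u\<close>, then the rank one perturbation that maps
  \<open>u\<close> to \<open>-f\<close> and vanishes on the orthogonal complement of \<open>u\<close> puts \<open>u\<close> into the kernel.\<close>

lemma large_inverse_in_pseudospectrum:
  assumes prob: "nonlinear_eigenproblem \<Omega> D T" and z: "z \<in> \<Omega>" "invertible_on D (T z)"
    and f: "norm f < \<eta> * norm (inv_into D (T z) f)" and \<eta>: "\<eta> > 0"
  shows "z \<in> pseudospectrum \<eta> \<Omega> D T"
proof (rule pseudospectrumI_const)
  define u where "u = inv_into D (T z) f"
  have bij: "bij_betw (T z) D UNIV" using z(2) by (simp add: invertible_on_def)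
  then have "f \<in> T z ` D" by (simp add: bij_betw_def)
  then have u: "u \<in> D" "T z u = f"
    unfolding u_def by (rule inv_into_into, rule f_inv_into_f)
  have un: "norm u > 0" using f norm_ge_zero[of f] by (auto simp: u_def)
  define E where "E v = (- (cinner u v / complex_of_real ((norm u)\<^sup>2))) *\<^sub>C f" for v
  have lin: "clinear E"
  proof (rule clinearI)
    show "E (v + w) = E v + E w" for v w
      unfolding E_def scaleC_add_left[symmetric] by (simp add: cinner_add_right add_divide_distrib)
    show "E (a *\<^sub>C v) = a *\<^sub>C E v" for a v
      unfolding E_def scaleC_scaleC by (simp add: cinner_scaleC_right)
  qed
  have bound: "norm (E v) \<le> norm f / norm u * norm v" for v
  proof -
    have "norm (E v) = cmod (cinner u v) / (norm u)\<^sup>2 * norm f"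
      by (simp add: E_def norm_divide norm_power)
    also have "\<dots> \<le> norm u * norm v / (norm u)\<^sup>2 * norm f"
      by (intro mult_right_mono divide_right_mono cauchy_schwarz) auto
    also have "\<dots> = norm f / norm u * norm v"
      using un by (simp add: power2_eq_square)
    finally show ?thesis .
  qed
  have "bounded_linear E"
  proof (rule bounded_linear_intro)
    show "norm (E v) \<le> norm v * (norm f / norm u)" for v
      using bound[of v] by (simp only: mult.commute)
  qed (simp_all add: clinear_add[OF lin] clinear_scaleC[OF lin] scaleR_scaleC)
  with lin show "bounded_clinear E" by (simp add: bounded_clinear_def)
  have "onorm E \<le> norm f / norm u" by (rule onorm_bound[OF _ bound]) simp
  also have "\<dots> < \<eta>" using f un by (simp add: u_def field_simps)
  finally show "onorm E < \<eta>" .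
  have "0 \<in> D" using prob by (simp add: nonlinear_eigenproblem_def cvs.subspace_0)
  moreover have "T z 0 = 0"
  proof -
    have "closed_operator_on D (T z)" using prob z(1) by (simp add: nonlinear_eigenproblem_def)
    then have "T z (0 *\<^sub>C 0) = 0 *\<^sub>C T z 0"
      using \<open>0 \<in> D\<close> unfolding closed_operator_on_def by blast
    then show ?thesis by simp
  qed
  moreover have "E u = - f" using un by (simp add: E_def cinner_self)
  ultimately have "\<not> inj_on (\<lambda>u. T z u + E u) D"
    using u un clinear_zero[OF lin] inj_onD[of "\<lambda>u. T z u + E u" D u 0] by auto
  then show "\<not> invertible_on D (\<lambda>u. T z u + E u)" by (auto simp: invertible_on_def bij_betw_def)
qed (rule z(1))

lemma small_inverse_not_in_pseudospectrum:
  assumes z: "invertible_on D (T z)" and \<eta>: "\<eta> > 0"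
    and S: "\<And>f. \<eta> * norm (inv_into D (T z) f) \<le> norm f"
  shows "z \<notin> pseudospectrum \<eta> \<Omega> D T"
proof
  assume "z \<in> pseudospectrum \<eta> \<Omega> D T"
  then obtain E where E: "op_holomorphic_on E \<Omega>" "bdd_above ((\<lambda>z. onorm (E z)) ` \<Omega>)"
    "(SUP z\<in>\<Omega>. onorm (E z)) < \<eta>" and sing: "z \<in> nl_spectrum \<Omega> D (\<lambda>z u. T z u + E z u)"
    unfolding pseudospectrum_def by blast
  have z\<Omega>: "z \<in> \<Omega>" and ninv: "\<not> invertible_on D (\<lambda>u. T z u + E z u)"
    using sing by (auto simp: nl_spectrum_def)
  have Ez: "bounded_clinear (E z)" using E(1) z\<Omega> by (simp add: op_holomorphic_on_def)
  then have bl: "bounded_linear (E z)" by (simp add: bounded_clinear_def)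
  have "onorm (E z) \<le> (SUP z\<in>\<Omega>. onorm (E z))" by (rule cSUP_upper[OF z\<Omega> E(2)])
  then have small: "onorm (E z) < \<eta>" using E(3) by simp
  have "invertible_on D (\<lambda>u. T z u + E z u)"
  proof (rule invertible_on_perturb[OF z Ez])
    show "onorm (E z) / \<eta> < 1" using small \<eta> by simp
    fix f
    have "norm (E z (inv_into D (T z) f)) \<le> onorm (E z) * norm (inv_into D (T z) f)"
      by (rule onorm[OF bl])
    also have "\<dots> \<le> onorm (E z) * (norm f / \<eta>)"
      using S[of f] \<eta> onorm_pos_le[OF bl] by (intro mult_left_mono) (simp_all add: field_simps)
    finally show "norm (E z (inv_into D (T z) f)) \<le> onorm (E z) / \<eta> * norm f" by simp
  qed
  with ninv show False ..
qed

section \<open>The pseudoinverse of a finite rank operator\<close>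

text \<open>Penrose's uniqueness argument: \<open>A B = (A C) (A B)\<close> is selfadjoint, hence equal to
  \<open>(A B) (A C) = A C\<close>, and likewise \<open>B A = C A\<close>.\<close>

lemma pseudoinverse_eqI:
  assumes "bounded_clinear B" "A \<circ> B \<circ> A = A" "B \<circ> A \<circ> B = B"
    "\<forall>x y. cinner (A (B x)) y = cinner x (A (B y))" "\<forall>x y. cinner (B (A x)) y = cinner x (B (A y))"
  shows "pseudoinverse A = B"
  unfolding pseudoinverse_def
proof (rule the_equality)
  fix C assume C: "bounded_clinear C \<and> A \<circ> C \<circ> A = A \<and> C \<circ> A \<circ> C = C
     \<and> (\<forall>x y. cinner (A (C x)) y = cinner x (A (C y)))
     \<and> (\<forall>x y. cinner (C (A x)) y = cinner x (C (A y)))"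
  have ABA: "A (B (A x)) = A x" and BAB: "B (A (B y)) = B y" for x y
    using assms(2,3) by (metis comp_apply)+
  have ACA: "A (C (A x)) = A x" and CAC: "C (A (C y)) = C y" for x y
    using C by (metis comp_apply)+
  have AB: "A (B x) = A (C x)" for x
  proof (rule cinner_eqI)
    fix y
    have "cinner y (A (C x)) = cinner y (A (B (A (C x))))" by (simp add: ABA)
    also have "\<dots> = cinner (A (C (A (B y)))) x" using C assms(4) by metis
    also have "\<dots> = cinner y (A (B x))" using assms(4) by (simp add: ACA)
    finally show "cinner y (A (B x)) = cinner y (A (C x))" by simp
  qed
  have BA: "B (A x) = C (A x)" for x
  proof (rule cinner_eqI)
    fix y
    have "cinner y (C (A x)) = cinner y (C (A (B (A x))))" by (simp add: ABA)
    also have "\<dots> = cinner (B (A (C (A y)))) x" using C assms(5) by metis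
    also have "\<dots> = cinner y (B (A x))" using assms(5) by (simp add: ACA)
    finally show "cinner y (B (A x)) = cinner y (C (A x))" by simp
  qed
  show "C = B"
  proof
    fix x
    have "C x = C (A (C x))" by (simp add: CAC)
    also have "\<dots> = B (A (C x))" by (simp add: BA)
    also have "\<dots> = B (A (B x))" by (simp add: AB)
    finally show "C x = B x" by (simp add: BAB)
  qed
qed (use assms in blast)

lemma clinear_economized_svd:
  assumes "economized_svd A U S V0"
  shows "clinear A"
proof -
  have "A = (U \<circ> (*v) S) \<circ> cadjoint ((*v) V0)" "clinear U"
    using assms by (auto simp: economized_svd_def orthonormal_columns_def)
  then show ?thesis by (metis clinear_compose clinear_matrix_vector_mult clinear_cadjoint)
qed

text \<open>A diagonal \<open>S\<close> without zeros is inverted entrywise, which gives the pseudoinverse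
  \<open>V0 S\<^sup>-\<^sup>1 U\<^sup>*\<close>.\<close>

lemma economized_svd_pseudoinverse:
  fixes A :: "complex ^ 'n \<Rightarrow> 'h::complex_hilbert" and U :: "complex ^ 'm \<Rightarrow> 'h"
  assumes svd: "economized_svd A U S V0" and rank: "crank A = CARD('m)"
  shows "inj (U \<circ> (*v) S)" "bounded_linear (pseudoinverse A)"
    "pseudoinverse A (A x) = V0 *v cadjoint ((*v) V0) x" "A (pseudoinverse A (A x)) = A x"
proof -
  have U: "orthonormal_columns U" and V: "orthonormal_columns ((*v) V0)"
    and diag: "\<And>i j. i \<noteq> j \<Longrightarrow> S $ i $ j = 0" and A: "\<And>x. A x = U (S *v cadjoint ((*v) V0) x)"
    using svd by (auto simp: economized_svd_def)
  have linU: "clinear U" using U by (rule orthonormal_columns_clinear)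
  have "A = (U \<circ> (*v) S) \<circ> cadjoint ((*v) V0)" by (auto simp: A)
  with rank show inj: "inj (U \<circ> (*v) S)"
    using crank_factorization[of "U \<circ> (*v) S" "cadjoint ((*v) V0)"]
    by (simp add: clinear_compose linU clinear_matrix_vector_mult clinear_cadjoint)
  have Sx: "(S *v x) $ i = S $ i $ i * x $ i" for x i
  proof -
    have "(S *v x) $ i = (\<Sum>j\<in>UNIV. if j = i then S $ i $ i * x $ i else 0)"
      unfolding matrix_vector_mult_def vec_lambda_beta by (rule sum.cong) (auto simp: diag)
    then show ?thesis by simp
  qed
  have nz: "S $ i $ i \<noteq> 0" for i
  proof
    assume 0: "S $ i $ i = 0"
    have "(S *v axis i 1) $ j = 0" for j using 0 by (auto simp: Sx axis_def)
    then have "S *v axis i 1 = 0" by (simp add: vec_eq_iff)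
    then have "(U \<circ> (*v) S) (axis i 1) = (U \<circ> (*v) S) 0" by simp
    then have "axis i 1 = (0 :: complex ^ 'm)" by (rule injD[OF inj])
    then show False by (metis axis_nth zero_index zero_neq_one)
  qed
  define Q where "Q x = (\<chi> i. x $ i / S $ i $ i)" for x :: "complex ^ 'm"
  have Q: "Q (S *v x) = x" "S *v Q x = x" for x
    using nz by (simp_all add: vec_eq_iff Q_def Sx)
  have linQ: "clinear Q"
    by (intro clinearI) (simp_all add: Q_def vec_eq_iff add_divide_distrib)
  define P where "P y = V0 *v Q (cadjoint U y)" for y
  have "P = ((*v) V0 \<circ> Q) \<circ> cadjoint U" by (auto simp: P_def)
  moreover have "clinear ((*v) V0 \<circ> Q)" by (intro clinear_compose clinear_matrix_vector_mult linQ)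
  ultimately have P: "clinear P" "bounded_linear P"
    using clinear_compose[OF _ clinear_cadjoint[OF linU]]
      bounded_linear_compose[OF clinear_bounded_linear bounded_linear_cadjoint[OF linU]]
    by (auto simp: comp_def)
  note VV = cadjoint_orthonormal[OF V] and UU = cadjoint_orthonormal[OF U]
  have PA: "P (A x) = V0 *v cadjoint ((*v) V0) x" for x by (simp add: P_def A UU Q)
  have AP: "A (P y) = U (cadjoint U y)" for y by (simp add: P_def A VV Q)
  have sym: "cinner (B (cadjoint B x)) y = cinner x (B (cadjoint B y))"
    if "clinear B" for B :: "complex ^ 'k \<Rightarrow> 'a::complex_hilbert" and x y
    using cinner_cadjoint[OF that] by (metis cinner_commute)
  have eq: "pseudoinverse A = P"
  proof (rule pseudoinverse_eqI)
    show "bounded_clinear P" using P by (simp add: bounded_clinear_def)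
    show "A \<circ> P \<circ> A = A" by (rule ext) (simp add: AP, simp add: A UU)
    show "P \<circ> A \<circ> P = P" by (rule ext) (simp add: PA, simp add: P_def VV)
    show "\<forall>x y. cinner (A (P x)) y = cinner x (A (P y))" by (simp add: AP sym linU)
    show "\<forall>x y. cinner (P (A x)) y = cinner x (P (A y))"
      by (simp add: PA sym clinear_matrix_vector_mult)
  qed
  show "bounded_linear (pseudoinverse A)" using P eq by simp
  show "pseudoinverse A (A x) = V0 *v cadjoint ((*v) V0) x" by (simp add: eq PA)
  show "A (pseudoinverse A (A x)) = A x" by (simp add: eq PA) (simp add: A VV)
qed

section \<open>The projected pencil\<close>

lemma sigma_inf_lessD:
  fixes F :: "complex ^ 'm \<Rightarrow> 'h::complex_hilbert"
  assumes "sigma_inf F < \<delta>"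
  obtains x where "norm x = 1" "norm (F x) < \<delta>"
proof -
  have "norm (axis undefined 1 :: complex ^ 'm) = 1"
    by (rule norm_axis_complex)
  then have "{norm (F x) | x. norm x = 1} \<noteq> {}" by blast
  from cInf_lessD[OF this assms[unfolded sigma_inf_def]]
  show thesis using that by auto
qed

lemma sigma_inf_lower:
  assumes F: "clinear F" and \<delta>: "\<not> sigma_inf F < \<delta>"
  shows "\<delta> * norm x \<le> norm (F x)"
proof (cases "x = 0")
  case False
  let ?y = "complex_of_real (1 / norm x) *\<^sub>C x"
  have "norm ?y = 1" using False by (simp add: norm_divide)
  then have "sigma_inf F \<le> norm (F ?y)"
    unfolding sigma_inf_def by (intro cInf_lower) (auto intro: bdd_belowI[of _ 0])
  then have "\<delta> \<le> norm (F x) / norm x"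
    using \<delta> by (simp add: clinear_scaleC[OF F] norm_divide)
  then show ?thesis using False by (simp add: field_simps)
qed (simp add: clinear_zero[OF F])

lemma clinear_projected_pencil:
  assumes "clinear U" "clinear A0" "clinear A1"
  shows "clinear (projected_pencil U V0 A0 A1 z)"
  by (intro clinearI)
    (simp_all add: projected_pencil_def clinear_add clinear_scaleC clinear_cadjoint clinear_matrix_vector_mult assms
      scaleC_add_right cvs.scale_right_diff_distrib mult.commute)

lemma projected_pencil_perturb:
  fixes U :: "complex ^ 'm \<Rightarrow> 'h::complex_hilbert" and V0 :: "complex ^ 'm ^ 'n"
  assumes U: "orthonormal_columns U" and V0: "orthonormal_columns ((*v) V0)"
    and lin: "clinear A0" "clinear A1" "clinear A0'" "clinear A1'"
    and \<epsilon>: "onorm (\<lambda>x. A0 x - A0' x) \<le> \<epsilon>" "onorm (\<lambda>x. A1 x - A1' x) \<le> \<epsilon>"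
  shows "norm (projected_pencil U V0 A0 A1 z x - projected_pencil U V0 A0' A1' z x) \<le> (1 + cmod z) * \<epsilon> * norm x"
proof -
  have diff: "norm (B x - B' x) \<le> \<epsilon> * norm x" if "clinear B" "clinear B'" "onorm (\<lambda>x. B x - B' x) \<le> \<epsilon>"
    for B B' :: "complex ^ 'n \<Rightarrow> 'h" and x
  proof -
    have "norm (B x - B' x) \<le> onorm (\<lambda>x. B x - B' x) * norm x"
      by (intro onorm bounded_linear_sub clinear_bounded_linear that)
    also have "\<dots> \<le> \<epsilon> * norm x" by (intro mult_right_mono that) simp
    finally show ?thesis .
  qed
  let ?v = "V0 *v x" and ?C = "cadjoint U"
  have C: "clinear ?C" by (intro clinear_cadjoint orthonormal_columns_clinear U)
  have "projected_pencil U V0 A0 A1 z x - projected_pencil U V0 A0' A1' z x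
      = ?C (A1 ?v - A1' ?v) - z *\<^sub>C ?C (A0 ?v - A0' ?v)"
    by (simp add: projected_pencil_def clinear_diff[OF C] cvs.scale_right_diff_distrib)
  also have "norm \<dots> \<le> norm (?C (A1 ?v - A1' ?v)) + cmod z * norm (?C (A0 ?v - A0' ?v))"
    by (metis norm_scaleC norm_triangle_ineq4)
  also have "\<dots> \<le> norm (A1 ?v - A1' ?v) + cmod z * norm (A0 ?v - A0' ?v)"
    by (intro add_mono mult_left_mono norm_cadjoint_orthonormal_le U) simp
  also have "\<dots> \<le> \<epsilon> * norm ?v + cmod z * (\<epsilon> * norm ?v)"
    by (intro add_mono mult_left_mono diff lin \<epsilon>) simp
  finally show ?thesis by (simp add: norm_orthonormal[OF V0] algebra_simps)
qed

text \<open>An invertible operator and its adjoint have inverses of the same norm.\<close>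

lemma dual_lower_bound:
  fixes G H :: "complex ^ 'm \<Rightarrow> complex ^ 'm"
  assumes G: "clinear G" and GH: "\<And>c y. cinner (G c) y = cinner c (H y)"
    and s: "s > 0" "\<And>c. s * norm c \<le> norm (G c)"
  shows "s * norm y \<le> norm (H y)"
proof (cases "y = 0")
  case False
  have "inj G"
    unfolding clinear_inj_iff[OF G]
  proof (intro allI impI)
    fix c assume "G c = 0"
    then show "c = 0" using s(2)[of c] s(1) by (simp add: mult_le_0_iff)
  qed
  then obtain c where c: "y = G c" using clinear_inj_iff_surj[OF G] by (metis surjD)
  have "(norm y)\<^sup>2 = cmod (cinner c (H y))"
    unfolding GH[symmetric] c[symmetric] by (simp add: cinner_self norm_power)
  also have "\<dots> \<le> norm c * norm (H y)" by (rule cauchy_schwarz)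
  also have "\<dots> \<le> norm y / s * norm (H y)"
    using s c by (intro mult_right_mono) (simp_all add: field_simps)
  finally have "s * norm y * norm y \<le> norm (H y) * norm y"
    using s(1) by (simp add: field_simps power2_eq_square)
  then show ?thesis using False by simp
qed simp

lemma orthonormal_projection_pythagoras:
  assumes U: "orthonormal_columns U"
  shows "(norm (cadjoint U h))\<^sup>2 = (norm h)\<^sup>2 - (norm (h - U (cadjoint U h)))\<^sup>2"
    and "cadjoint U (h - U (cadjoint U h)) = 0"
proof -
  note C = clinear_cadjoint[OF orthonormal_columns_clinear[OF U]]
  show 0: "cadjoint U (h - U (cadjoint U h)) = 0"
    by (simp add: clinear_diff[OF C] cadjoint_orthonormal[OF U])
  have "cinner (U (cadjoint U h)) (h - U (cadjoint U h)) = 0"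
    using cinner_cadjoint[OF orthonormal_columns_clinear[OF U], of "cadjoint U h" "h - U (cadjoint U h)"] 0
    by simp
  then have "(norm (U (cadjoint U h) + (h - U (cadjoint U h))))\<^sup>2
      = (norm (U (cadjoint U h)))\<^sup>2 + (norm (h - U (cadjoint U h)))\<^sup>2"
    by (simp only: norm_add_squared) simp
  then show "(norm (cadjoint U h))\<^sup>2 = (norm h)\<^sup>2 - (norm (h - U (cadjoint U h)))\<^sup>2"
    by (simp add: norm_orthonormal[OF U])
qed

context
  fixes V W :: "complex ^ 'm \<Rightarrow> 'h::complex_hilbert" and J :: "complex ^ 'm ^ 'm"
    and X A0 A1 :: "complex ^ 'n \<Rightarrow> 'h"
  assumes V: "clinear V" and W: "clinear W" and X: "clinear X"
    and A0: "\<And>x. A0 x = V (cadjoint W (X x))" and A1: "\<And>x. A1 x = V (J *v cadjoint W (X x))"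
    and rank: "crank A0 = CARD('m)"
begin

lemma moments_clinear: "clinear A0" "clinear A1"
proof -
  have "A0 = V \<circ> cadjoint W \<circ> X" "A1 = V \<circ> (*v) J \<circ> cadjoint W \<circ> X"
    by (auto simp: A0 A1)
  then show "clinear A0" "clinear A1"
    by (simp_all only: clinear_compose clinear_cadjoint clinear_matrix_vector_mult V W X)
qed

lemma moments_full_rank: "inj V" "surj (cadjoint W \<circ> X)" "inj W"
proof -
  have "A0 = V \<circ> (cadjoint W \<circ> X)" by (auto simp: A0)
  with rank have "inj V \<and> surj (cadjoint W \<circ> X)"
    by (intro crank_factorization) (simp_all add: V clinear_compose clinear_cadjoint W X)
  then show "inj V" and surj: "surj (cadjoint W \<circ> X)" by auto
  show "inj W"
    unfolding clinear_inj_iff[OF W]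
  proof (intro allI impI)
    fix c assume 0: "W c = 0"
    obtain x where "c = cadjoint W (X x)" using surj by (metis comp_apply surjD)
    then have "cinner c c = cinner (W c) (X x)" using cinner_cadjoint[OF W, of c "X x"] by simp
    then show "c = 0" using 0 by simp
  qed
qed

lemma exact_pencil:
  assumes U: "clinear U"
  shows "projected_pencil U V0 A0 A1 z x
    = cadjoint U (V (J *v cadjoint W (X (V0 *v x)) - z *\<^sub>C cadjoint W (X (V0 *v x))))"
  by (simp add: projected_pencil_def A0 A1 clinear_diff[OF V] clinear_scaleC[OF V]
      clinear_diff[OF clinear_cadjoint[OF U]] clinear_scaleC[OF clinear_cadjoint[OF U]])

text \<open>A lower bound on a compression \<open>U\<^sup>* V (J - z) W\<^sup>* X V0\<close> makes all its square factors
  invertible, and the inverse of \<open>z - J\<close> is recovered from that of the compression.\<close>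

lemma exact_pencil_lower_bound:
  fixes U :: "complex ^ 'm \<Rightarrow> 'h" and V0 :: "complex ^ 'm ^ 'n"
  assumes U: "orthonormal_columns U" and V0: "orthonormal_columns ((*v) V0)"
    and \<gamma>: "\<gamma> > 0" "\<And>x. \<gamma> * norm x \<le> norm (projected_pencil U V0 A0 A1 z x)"
  shows "J *v d = z *\<^sub>C d \<Longrightarrow> d = 0"
    and "(mat z - J) *v c = cadjoint W f
      \<Longrightarrow> \<gamma> * norm (V c) \<le> onorm (V \<circ> cadjoint W) * onorm A0 * norm f"
proof -
  let ?F = "projected_pencil U V0 A0 A1 z"
  define G where "G = cadjoint W \<circ> X \<circ> (*v) V0"
  define H where "H = cadjoint U \<circ> V"
  note linU = orthonormal_columns_clinear[OF U]
  have G: "clinear G" unfolding G_def by (intro clinear_compose clinear_cadjoint W X clinear_matrix_vector_mult)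
  have H: "clinear H" unfolding H_def by (intro clinear_compose clinear_cadjoint linU V)
  have F: "?F x = H (J *v G x - z *\<^sub>C G x)" for x by (simp add: exact_pencil[OF linU] G_def H_def)
  have linF: "clinear ?F" by (intro clinear_projected_pencil linU moments_clinear)
  have injF: "inj ?F"
    unfolding clinear_inj_iff[OF linF]
  proof (intro allI impI)
    fix x assume "?F x = 0"
    then show "x = 0" using \<gamma>(2)[of x] \<gamma>(1) by (simp add: mult_le_0_iff)
  qed
  then have surjF: "surj ?F" using clinear_inj_iff_surj[OF linF] by blast
  have "range ?F \<subseteq> range H" by (auto simp: F)
  then have "surj H" using surjF by auto
  then have injH: "inj H" using clinear_inj_iff_surj[OF H] by blast
  have "inj G"
  proof (rule injI)
    fix x y assume "G x = G y"
    then have "?F x = ?F y" by (simp only: F)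
    then show "x = y" by (rule injD[OF injF])
  qed
  then have surjG: "surj G" using clinear_inj_iff_surj[OF G] by blast
  have ker: "d = 0" if d: "J *v d = z *\<^sub>C d" for d
  proof -
    obtain x where x: "d = G x" using surjG by (metis surjD)
    have "?F x = 0" using d by (simp add: F x[symmetric] clinear_zero[OF H])
    then have "x = 0" using injF clinear_inj_iff[OF linF] by blast
    then show ?thesis by (simp add: x clinear_zero[OF G])
  qed
  show "d = 0" if "J *v d = z *\<^sub>C d" by (rule ker[OF that])
  show "\<gamma> * norm (V c) \<le> onorm (V \<circ> cadjoint W) * onorm A0 * norm f"
    if c: "(mat z - J) *v c = cadjoint W f"
  proof -
    obtain x where x: "?F x = H (cadjoint W f)" using surjF by (metis surjD)
    then have "J *v G x - z *\<^sub>C G x = cadjoint W f" using injH by (simp add: F inj_eq)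
    then have "J *v G x - z *\<^sub>C G x = z *\<^sub>C c - J *v c" using c by (simp add: shift_mult_vec)
    then have "J *v (G x + c) = z *\<^sub>C (G x + c)"
      by (simp add: matrix_vector_right_distrib scaleC_add_right algebra_simps)
    then have "G x + c = 0" by (rule ker)
    then have "c = (-1) *\<^sub>C G x" by (simp add: eq_neg_iff_add_eq_0 add.commute)
    then have "norm (V c) = norm (V (G x))" by (simp only: clinear_scaleC[OF V] norm_scaleC) simp
    also have "V (G x) = A0 (V0 *v x)" by (simp add: G_def A0)
    also have "norm \<dots> \<le> onorm A0 * norm (V0 *v x)"
      by (intro onorm clinear_bounded_linear moments_clinear)
    finally have Vc: "norm (V c) \<le> onorm A0 * norm x" by (simp add: norm_orthonormal[OF V0])
    have VW: "bounded_linear (V \<circ> cadjoint W)"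
      using bounded_linear_compose[OF clinear_bounded_linear[OF V] bounded_linear_cadjoint[OF W]]
      by (simp add: comp_def)
    have "\<gamma> * norm x \<le> norm (H (cadjoint W f))" using \<gamma>(2)[of x] x by simp
    also have "\<dots> \<le> norm ((V \<circ> cadjoint W) f)"
      using norm_cadjoint_orthonormal_le[OF U] by (simp add: H_def)
    also have "\<dots> \<le> onorm (V \<circ> cadjoint W) * norm f" by (rule onorm[OF VW])
    finally have "\<gamma> * norm x \<le> onorm (V \<circ> cadjoint W) * norm f" .
    have "\<gamma> * norm (V c) \<le> onorm A0 * (\<gamma> * norm x)"
      using Vc \<gamma>(1) by (metis mult.left_commute mult_le_cancel_left_pos)
    also have "\<dots> \<le> onorm A0 * (onorm (V \<circ> cadjoint W) * norm f)"
      by (intro mult_left_mono onorm_pos_le clinear_bounded_linear moments_clinear) fact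
    finally show ?thesis
      by (simp add: mult_ac)
  qed
qed

context
  fixes U0 :: "complex ^ 'm \<Rightarrow> 'h" and S0 :: "complex ^ 'm ^ 'm" and V0 :: "complex ^ 'm ^ 'n"
  assumes svd: "economized_svd A0 U0 S0 V0"
begin

lemma svd_facts:
  "orthonormal_columns ((*v) V0)" "A0 x = (U0 \<circ> (*v) S0) (cadjoint ((*v) V0) x)" "clinear (U0 \<circ> (*v) S0)"
  using svd by (auto simp: economized_svd_def orthonormal_columns_def clinear_compose clinear_matrix_vector_mult)

lemma singular_values_positive:
  shows "singular_value CARD('m) (V \<circ> cadjoint W) > 0" (is ?p1)
    and "singular_value CARD('m) (V \<circ> cadjoint W \<circ> X) > 0" (is ?p2)
    and "singular_value CARD('m) (V \<circ> cadjoint W) * norm (W c) \<le> norm (V (cadjoint W (W c)))" (is ?p3)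
    and "singular_value CARD('m) (V \<circ> cadjoint W \<circ> X) * norm x \<le> norm (A0 (V0 *v x))" (is ?p4)
proof -
  note fr = singular_value_full_rank[OF V moments_full_rank(1) W moments_full_rank(3)]
  show ?p1 ?p3
    by (rule fr)+
  have inj: "inj ((*v) V0)"
    using norm_orthonormal[OF svd_facts(1)] clinear_inj_iff[OF clinear_matrix_vector_mult, of V0]
    by (metis norm_eq_zero)
  note fr = singular_value_full_rank[OF svd_facts(3) economized_svd_pseudoinverse(1)[OF svd rank]
      clinear_matrix_vector_mult inj]
  have eq: "V \<circ> cadjoint W \<circ> X = (U0 \<circ> (*v) S0) \<circ> cadjoint ((*v) V0)"
    using svd_facts(2) by (auto simp: A0)
  show ?p2 unfolding eq by (rule fr(1))
  show ?p4
    using fr(2)[of x] by (simp only: eq svd_facts(2) norm_orthonormal[OF svd_facts(1)])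
qed

text \<open>The singular subspaces of \<open>A0\<close> and \<open>A0'\<close> enclose an angle whose sine is at most
  \<open>\<eta> = onorm (pseudoinverse A0) * \<epsilon>\<close>. Since the exact pencil annihilates the kernel of \<open>A0\<close> and maps
  into its range, the compression to the computed subspaces loses at most one cosine
  \<open>sqrt (1 - \<eta>\<^sup>2)\<close> on either side.\<close>

lemma exact_pencil_small_vector:
  fixes U :: "complex ^ 'm \<Rightarrow> 'h" and S :: "complex ^ 'm ^ 'm" and Vt :: "complex ^ 'm ^ 'n"
  assumes svd': "economized_svd A0' U S Vt"
    and \<epsilon>: "onorm (\<lambda>x. A0 x - A0' x) \<le> \<epsilon>" "\<epsilon> \<ge> 0"
    and \<eta>: "\<eta> = onorm (pseudoinverse A0) * \<epsilon>" "\<eta> < 1"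
    and y: "norm y = 1" "norm (projected_pencil U Vt A0 A1 z y) < \<beta>"
  obtains x where "(1 - \<eta>\<^sup>2) * norm (A1 (V0 *v x) - z *\<^sub>C A0 (V0 *v x)) < \<beta> * norm x"
proof -
  let ?P = "pseudoinverse A0" and ?C = "cadjoint ((*v) V0)" and ?C' = "cadjoint ((*v) Vt)"
  have U: "orthonormal_columns U" and Vt: "orthonormal_columns ((*v) Vt)"
    and A0': "\<And>x. A0' x = U (S *v ?C' x)"
    using svd' by (auto simp: economized_svd_def)
  have lin': "clinear A0'" by (rule clinear_economized_svd[OF svd'])
  note linU = orthonormal_columns_clinear[OF U] and linV = clinear_matrix_vector_mult
  have P: "bounded_linear ?P" and PA: "\<And>x. ?P (A0 x) = V0 *v ?C x" and APA: "\<And>x. A0 (?P (A0 x)) = A0 x"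
    using economized_svd_pseudoinverse[OF svd rank] by auto
  have \<eta>0: "\<eta> \<ge> 0" using \<eta>(1) \<epsilon>(2) onorm_pos_le[OF P] by simp
  have diff: "norm (A0 x - A0' x) \<le> \<epsilon> * norm x" for x
  proof -
    have "norm (A0 x - A0' x) \<le> onorm (\<lambda>x. A0 x - A0' x) * norm x"
      by (intro onorm bounded_linear_sub clinear_bounded_linear moments_clinear lin')
    also have "\<dots> \<le> \<epsilon> * norm x" by (intro mult_right_mono \<epsilon>) simp
    finally show ?thesis .
  qed
  define s where "s = sqrt (1 - \<eta>\<^sup>2)"
  have "\<eta>\<^sup>2 < 1" using \<eta>(2) \<eta>0 by (simp add: power_less_one_iff abs_square_less_1)
  then have s: "s > 0" "s\<^sup>2 = 1 - \<eta>\<^sup>2" by (simp_all add: s_def)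
  have cosine: "s * norm h \<le> norm k" if "(norm k)\<^sup>2 = (norm h)\<^sup>2 - r\<^sup>2" "\<bar>r\<bar> \<le> \<eta> * norm h"
    for h :: "'a::real_normed_vector" and k :: "'b::real_normed_vector" and r :: real
  proof -
    have "r\<^sup>2 \<le> (\<eta> * norm h)\<^sup>2" using that(2) by (metis abs_ge_zero power2_abs power_mono)
    then have "(s * norm h)\<^sup>2 \<le> (norm k)\<^sup>2"
      by (simp add: that(1) power_mult_distrib s(2) algebra_simps)
    then show ?thesis by (rule power2_le_imp_le) simp
  qed

  \<comment> \<open>The angle between the right singular subspaces. The component \<open>r\<close> of a vector of \<open>range V0\<close> in the
    kernel of \<open>A0'\<close> is short because \<open>A0\<close> is small on it. The bound is needed for the
    adjoint of \<open>G\<close>, to which it passes by duality.\<close>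
  define G where "G = ?C' \<circ> (*v) V0"
  have G: "s * norm c \<le> norm (G c)" for c
  proof -
    define v where "v = V0 *v c"
    define r where "r = v - Vt *v ?C' v"
    have nv: "norm v = norm c" by (simp add: v_def norm_orthonormal[OF svd_facts(1)])
    have r0: "?C' r = 0" unfolding r_def by (rule orthonormal_projection_pythagoras(2)[OF Vt])
    have "A0' r = 0" by (simp add: A0' r0 clinear_zero[OF linU])
    then have "norm (A0 r) \<le> \<epsilon> * norm r" using diff[of r] by simp
    then have Pr: "norm (?P (A0 r)) \<le> \<eta> * norm r"
      using onorm[OF P, of "A0 r"] onorm_pos_le[OF P]
      by (metis \<eta>(1) mult.assoc mult_left_mono order_trans)
    have "cinner r (Vt *v ?C' v) = 0"
      using cinner_cadjoint[OF linV[of Vt], of "?C' v" r] r0 cinner_commute[of r "Vt *v ?C' v"] by simp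
    then have "cinner r r = cinner r v"
      by (subst (2) r_def) (simp add: cinner_diff_right)
    also have "\<dots> = cinner (?P (A0 r)) v"
    proof -
      have "cinner (?P (A0 r)) v = cinner (?C r) (?C v)"
        using cinner_cadjoint[OF linV[of V0], of "?C r" v] by (simp add: PA)
      also have "?C v = c" unfolding v_def by (rule cadjoint_orthonormal[OF svd_facts(1)])
      also have "cinner (?C r) c = cinner r (V0 *v c)"
        using cinner_cadjoint[OF linV[of V0], of c r] cinner_commute[of "?C r" c] cinner_commute[of r "V0 *v c"]
        by simp
      finally show ?thesis by (simp add: v_def)
    qed
    finally have "(norm r)\<^sup>2 = cmod (cinner (?P (A0 r)) v)"
      by (metis cinner_self norm_of_real abs_of_nonneg zero_le_power2)
    also have "\<dots> \<le> norm (?P (A0 r)) * norm v" by (rule cauchy_schwarz)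
    also have "\<dots> \<le> \<eta> * norm r * norm v" by (intro mult_right_mono Pr) simp
    finally have "norm r * norm r \<le> (\<eta> * norm v) * norm r" by (simp add: power2_eq_square mult_ac)
    then have "norm r \<le> \<eta> * norm v" using \<eta>0 by (cases "r = 0") auto
    then show ?thesis
      unfolding nv[symmetric] G_def comp_apply v_def[symmetric]
      by (intro cosine[OF orthonormal_projection_pythagoras(1)[OF Vt]]) (simp add: r_def)
  qed

  define x where "x = ?C (Vt *v y)"
  have nx: "s \<le> norm x"
  proof -
    have "s * norm y \<le> norm ((?C \<circ> (*v) Vt) y)"
    proof (rule dual_lower_bound[OF _ _ s(1) G])
      show "clinear G" unfolding G_def by (intro clinear_compose clinear_cadjoint linV)
      show "cinner (G c) y = cinner c ((?C \<circ> (*v) Vt) y)" for c y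
        using cinner_cadjoint[OF linV[of V0], of c "Vt *v y"] cinner_cadjoint[OF linV[of Vt], of y "V0 *v c"]
          cinner_commute[of "?C' (V0 *v c)" y] cinner_commute[of "V0 *v c" "Vt *v y"]
        by (simp add: G_def)
    qed
    then show ?thesis using y(1) by (simp add: x_def)
  qed

  define h where "h = A1 (V0 *v x) - z *\<^sub>C A0 (V0 *v x)"
  have A0x: "A0 (Vt *v y) = A0 (V0 *v x)"
    by (simp add: svd_facts(2) x_def cadjoint_orthonormal[OF svd_facts(1)])
  then have "cadjoint W (X (Vt *v y)) = cadjoint W (X (V0 *v x))"
    using moments_full_rank(1) by (simp add: A0 inj_eq)
  then have h_eq: "A1 (Vt *v y) - z *\<^sub>C A0 (Vt *v y) = h" by (simp add: h_def A1 A0x)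
  have Uh: "projected_pencil U Vt A0 A1 z y = cadjoint U h"
    unfolding h_eq[symmetric] projected_pencil_def
    by (simp add: clinear_diff[OF clinear_cadjoint[OF linU]] clinear_scaleC[OF clinear_cadjoint[OF linU]])
  have h_range: "A0 (?P h) = h"
  proof -
    have "h = V (J *v cadjoint W (X (V0 *v x)) - z *\<^sub>C cadjoint W (X (V0 *v x)))"
      by (simp add: h_def A0 A1 clinear_diff[OF V] clinear_scaleC[OF V])
    moreover obtain u where "J *v cadjoint W (X (V0 *v x)) - z *\<^sub>C cadjoint W (X (V0 *v x)) = (cadjoint W \<circ> X) u"
      using surjD[OF moments_full_rank(2)] by blast
    ultimately have "h = A0 u" by (simp only: A0 comp_apply)
    then show ?thesis using APA by simp
  qed
  \<comment> \<open>The angle between the left singular subspaces, for a vector \<open>h = A0 w\<close>.\<close>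
  have "s * norm h \<le> norm (cadjoint U h)"
  proof (rule cosine[OF orthonormal_projection_pythagoras(1)[OF U]])
    define w where "w = ?P h"
    define b where "b = A0' w"
    have "U (cadjoint U b) = b" by (simp add: b_def A0' cadjoint_orthonormal[OF U])
    then have "U (cadjoint U (h - b)) = U (cadjoint U h) - b"
      by (simp only: clinear_diff[OF linU] clinear_diff[OF clinear_cadjoint[OF linU]])
    then have "h - U (cadjoint U h) = (h - b) - U (cadjoint U (h - b))" by simp
    moreover have "(norm (h - b - U (cadjoint U (h - b))))\<^sup>2 \<le> (norm (h - b))\<^sup>2"
      using orthonormal_projection_pythagoras(1)[OF U, of "h - b"] zero_le_power2[of "norm (cadjoint U (h - b))"]
      by linarith
    ultimately have "norm (h - U (cadjoint U h)) \<le> norm (h - b)"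
      by (metis norm_ge_zero power2_le_imp_le)
    also have "h - b = A0 w - A0' w" by (simp only: b_def w_def h_range)
    also have "norm \<dots> \<le> \<epsilon> * norm w" by (rule diff)
    also have "\<dots> \<le> \<epsilon> * (onorm ?P * norm h)" unfolding w_def by (intro mult_left_mono onorm P \<epsilon>)
    finally show "\<bar>norm (h - U (cadjoint U h))\<bar> \<le> \<eta> * norm h" by (simp add: \<eta>(1) mult_ac)
  qed
  then have sh: "s * norm h < \<beta>" using y(2) by (simp add: Uh)
  have "\<beta> > 0" using y(2) norm_ge_zero order_le_less_trans by blast
  have "(1 - \<eta>\<^sup>2) * norm h = s * (s * norm h)" unfolding s(2)[symmetric] by (simp add: power2_eq_square)
  also have "\<dots> < s * \<beta>" using sh s(1) by simp
  also have "\<dots> \<le> \<beta> * norm x" using nx \<open>\<beta> > 0\<close> by (simp add: mult.commute)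
  finally show thesis using that unfolding h_def by blast
qed

text \<open>The right hand side \<open>f\<close> is taken in \<open>range W\<close>, the orthogonal complement of the kernel of
  \<open>V W\<^sup>*\<close>, with \<open>W\<^sup>* f = (z - J) d\<close> and \<open>d = W\<^sup>* X V0 x\<close>. There \<open>V W\<^sup>*\<close> is bounded below by its smallest
  singular value, and so is \<open>V W\<^sup>* X\<close> on the range of \<open>V0\<close>.\<close>

lemma resolvent_large:
  assumes z: "surj ((*v) (mat z - J))"
    and x: "norm (A1 (V0 *v x) - z *\<^sub>C A0 (V0 *v x)) < \<gamma> * norm x"
  obtains f where "singular_value CARD('m) (V \<circ> cadjoint W) * singular_value CARD('m) (V \<circ> cadjoint W \<circ> X) * norm f
    < \<gamma> * norm (V (matrix_inv (mat z - J) *v cadjoint W f))"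
proof -
  let ?s1 = "singular_value CARD('m) (V \<circ> cadjoint W)" and ?s2 = "singular_value CARD('m) (V \<circ> cadjoint W \<circ> X)"
  define d where "d = cadjoint W (X (V0 *v x))"
  obtain b where b: "cadjoint W (W b) = (mat z - J) *v d"
    using gram_surj[OF W moments_full_rank(3)] by blast
  have "V ((mat z - J) *v d) = - (A1 (V0 *v x) - z *\<^sub>C A0 (V0 *v x))"
    by (simp add: shift_mult_vec clinear_diff[OF V] clinear_scaleC[OF V] A0 A1 d_def)
  then have "?s1 * norm (W b) \<le> norm (A1 (V0 *v x) - z *\<^sub>C A0 (V0 *v x))"
    using singular_values_positive(3)[of b] by (simp only: b norm_minus_cancel)
  also note x
  finally have 1: "?s1 * norm (W b) < \<gamma> * norm x" .
  have "\<gamma> \<ge> 0"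
    using order_le_less_trans[OF norm_ge_zero x] by (simp add: zero_less_mult_iff)
  have "?s1 * ?s2 * norm (W b) = ?s2 * (?s1 * norm (W b))" by simp
  also have "\<dots> < ?s2 * (\<gamma> * norm x)" using 1 singular_values_positive(2) by simp
  also have "\<dots> = \<gamma> * (?s2 * norm x)" by simp
  also have "\<dots> \<le> \<gamma> * norm (A0 (V0 *v x))"
    using singular_values_positive(4)[of x] \<open>\<gamma> \<ge> 0\<close> by (intro mult_left_mono)
  also have "A0 (V0 *v x) = V (matrix_inv (mat z - J) *v cadjoint W (W b))"
    by (simp add: b matrix_inv_apply(2)[OF z] A0 d_def)
  finally show thesis by (rule that)
qed

end

end

section \<open>Inclusions of pseudospectra\<close>

text \<open>The passage from the computed to the exact moments costs \<open>(1 + S) \<epsilon>\<close>. The remaining part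
  \<open>2 \<kappa> (onorm A1) \<epsilon> = 2 \<eta> (onorm A1)\<close> of the gap between \<open>\<gamma>p\<close> and \<open>\<delta>\<close> absorbs the factor
  \<open>1 - \<eta>\<^sup>2\<close> that is lost by the angles between the singular subspaces, provided that
  \<open>\<gamma>p \<le> onorm A1\<close> and \<open>\<eta> < 1\<close>.\<close>

lemma pseudospectra_inclusions:
  fixes \<Omega> :: "complex set" and D :: "'h::complex_hilbert set" and T :: "complex \<Rightarrow> 'h \<Rightarrow> 'h"
    and V W U0 U0' :: "complex ^ 'm \<Rightarrow> 'h" and X A0 A1 :: "complex ^ 'n \<Rightarrow> 'h"
    and V0 V0' :: "complex ^ 'm ^ 'n"
  assumes prob: "nonlinear_eigenproblem \<Omega> D T" and adm: "admissible_contour \<Omega> D T \<Gamma>"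
    and X: "clinear X" and A0: "A0 = contour_moment 0 D T \<Gamma> X" and A1: "A1 = contour_moment 1 D T \<Gamma> X"
    and rank: "crank A0 = CARD('m)"
    and kel: "keldysh_expansion \<Omega> D T \<Gamma> V W J R" and svd: "economized_svd A0 U0 S0 V0"
    and \<epsilon>: "\<epsilon> > 0" and \<delta>: "\<delta> > 0" and lin': "clinear A0'" "clinear A1'"
    and close: "onorm (\<lambda>x. A0 x - A0' x) \<le> \<epsilon>" "onorm (\<lambda>x. A1 x - A1' x) \<le> \<epsilon>"
    and svd': "economized_svd A0' U0' S0' V0'"
    and M: "M = (SUP z\<in>inside (path_image \<Gamma>). onorm (R z))"
    and \<kappa>: "\<kappa> = onorm (pseudoinverse A0)" and S: "S = (SUP z\<in>inside (path_image \<Gamma>). cmod z)"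
    and \<gamma>m: "\<gamma>m = \<delta> - (2 * \<kappa> * onorm A1 + 1 + S) * \<epsilon>"
    and \<gamma>p: "\<gamma>p = \<delta> + (2 * \<kappa> * onorm A1 + 1 + S) * \<epsilon>"
    and \<sigma>: "\<sigma> = singular_value CARD('m) (V \<circ> cadjoint W) * singular_value CARD('m) (V \<circ> cadjoint W \<circ> X)"
    and pos: "\<gamma>m > 0" and small: "2 * \<kappa> * \<gamma>p < 1" "\<gamma>p \<le> onorm A1" "M * \<gamma>p < \<sigma>"
  shows "pseudospectrum (\<gamma>m / (onorm (V \<circ> cadjoint W) * onorm (V \<circ> cadjoint W \<circ> X) + M * \<gamma>m)) \<Omega> D T
      \<inter> inside (path_image \<Gamma>)
    \<subseteq> matrix_pseudospectrum \<delta> (projected_pencil U0' V0' A0' A1') \<inter> inside (path_image \<Gamma>)" (is ?lower)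
    and "matrix_pseudospectrum \<delta> (projected_pencil U0' V0' A0' A1') \<inter> inside (path_image \<Gamma>)
    \<subseteq> pseudospectrum (\<gamma>p / (\<sigma> - M * \<gamma>p)) \<Omega> D T \<inter> inside (path_image \<Gamma>)" (is ?upper)
proof -
  let ?I = "inside (path_image \<Gamma>)"
  let ?F' = "projected_pencil U0' V0' A0' A1'" and ?F = "projected_pencil U0' V0' A0 A1"
  note VW = keldysh_linear[OF adm kel]
  have A0x: "A0 x = V (cadjoint W (X x))" and A1x: "A1 x = V (J *v cadjoint W (X x))" for x
    using keldysh_contour_moments[OF adm kel] by (simp_all add: A0 A1)
  note ctx = VW X A0x A1x rank
  note lin = moments_clinear[OF ctx]
  have U': "orthonormal_columns U0'" and V': "orthonormal_columns ((*v) V0')"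
    using svd' by (auto simp: economized_svd_def)
  note linF' = clinear_projected_pencil[OF orthonormal_columns_clinear[OF U'] lin']
  have \<kappa>0: "\<kappa> \<ge> 0"
    unfolding \<kappa> by (rule onorm_pos_le[OF economized_svd_pseudoinverse(2)[OF svd rank]])
  have a0: "onorm A1 \<ge> 0" by (intro onorm_pos_le clinear_bounded_linear lin)
  have in_\<Omega>: "z \<in> \<Omega>" if "z \<in> ?I" for z using adm that by (auto simp: admissible_contour_def)
  have zS: "cmod z \<le> S" if "z \<in> ?I" for z
  proof -
    have "bdd_above (cmod ` ?I)"
      using bounded_interior(1)[OF adm kel] by (auto simp: bounded_iff intro: bdd_aboveI2)
    then show ?thesis unfolding S by (rule cSUP_upper[OF that])
  qed
  have RM: "norm (R z f) \<le> M * norm f" and M0: "M \<ge> 0" if z: "z \<in> ?I" for z f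
  proof -
    have "onorm (R z) \<le> M"
      unfolding M by (rule cSUP_upper[OF z keldysh_remainder_bounded(1)[OF adm kel]])
    moreover have R: "bounded_linear (R z)" by (rule keldysh_remainder_bounded(2)[OF adm kel z])
    ultimately show "M \<ge> 0" using onorm_pos_le by fastforce
    have "norm (R z f) \<le> onorm (R z) * norm f" by (rule onorm[OF R])
    also have "\<dots> \<le> M * norm f" using \<open>onorm (R z) \<le> M\<close> by (rule mult_right_mono) simp
    finally show "norm (R z f) \<le> M * norm f" .
  qed
  note sv = singular_values_positive[OF ctx svd]
  have A0_eq: "V \<circ> cadjoint W \<circ> X = A0" by (auto simp: A0x)
  have close_pencils: "norm (?F z x - ?F' z x) \<le> (1 + S) * \<epsilon> * norm x" if "z \<in> ?I" for z x
  proof -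
    have "norm (?F z x - ?F' z x) \<le> (1 + cmod z) * \<epsilon> * norm x"
      by (rule projected_pencil_perturb[OF U' V' lin lin' close])
    also have "\<dots> \<le> (1 + S) * \<epsilon> * norm x"
      using zS[OF that] \<epsilon> by (intro mult_right_mono) auto
    finally show ?thesis .
  qed

  show ?lower
  proof
    fix z assume z: "z \<in> pseudospectrum (\<gamma>m / (onorm (V \<circ> cadjoint W) * onorm (V \<circ> cadjoint W \<circ> X) + M * \<gamma>m)) \<Omega> D T \<inter> ?I"
    then have zI: "z \<in> ?I" by blast
    define n where "n = onorm (V \<circ> cadjoint W) * onorm A0"
    have bl: "bounded_linear (V \<circ> cadjoint W)" "bounded_linear A0"
      using bounded_linear_compose[OF clinear_bounded_linear[OF VW(1)] bounded_linear_cadjoint[OF VW(2)]]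
        clinear_bounded_linear[OF lin(1)] by (simp_all add: comp_def)
    have "A0 \<noteq> (\<lambda>_. 0)"
    proof
      assume "A0 = (\<lambda>_. 0)"
      then show False using sv(4)[of "axis undefined 1"] sv(2)
        by (simp add: mult_le_0_iff)
    qed
    then obtain x where "A0 x \<noteq> 0" by blast
    then have "0 < onorm (V \<circ> cadjoint W)" "0 < onorm A0"
      using onorm_pos_lt[OF bl(1)] onorm_pos_lt[OF bl(2)] by (auto simp: A0x)
    then have n: "n > 0" by (simp add: n_def)
    have denom: "n + M * \<gamma>m > 0" using n M0[OF zI] pos by (simp add: add_pos_nonneg)
    have "sigma_inf (?F' z) < \<delta>"
    proof (rule ccontr)
      assume not: "\<not> sigma_inf (?F' z) < \<delta>"
      have lower: "\<gamma>m * norm x \<le> norm (?F z x)" for x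
      proof -
        have "0 \<le> (2 * \<kappa> * onorm A1) * \<epsilon>" using \<kappa>0 a0 \<epsilon> by simp
        then have "\<gamma>m \<le> \<delta> - (1 + S) * \<epsilon>" by (simp add: \<gamma>m algebra_simps)
        then have "\<gamma>m * norm x \<le> (\<delta> - (1 + S) * \<epsilon>) * norm x" by (rule mult_right_mono) simp
        also have "\<dots> = \<delta> * norm x - (1 + S) * \<epsilon> * norm x" by (simp add: left_diff_distrib)
        also have "\<dots> \<le> norm (?F' z x) - norm (?F z x - ?F' z x)"
          using sigma_inf_lower[OF linF' not, of x] close_pencils[OF zI, of x] by linarith
        also have "\<dots> \<le> norm (?F z x)"
          using norm_triangle_ineq2[of "?F' z x" "?F' z x - ?F z x"] by (simp add: norm_minus_commute)
        finally show ?thesis .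
      qed
      note bound = exact_pencil_lower_bound[OF ctx U' V' pos lower]
      have reg: "z \<notin> nl_spectrum \<Omega> D T"
        using keldysh_inside(1)[OF adm kel zI] bound(1) by blast
      then have inv: "invertible_on D (T z)" using in_\<Omega>[OF zI] by (simp add: nl_spectrum_def)
      have "\<gamma>m / (n + M * \<gamma>m) * norm (inv_into D (T z) f) \<le> norm f" for f
      proof -
        let ?c = "matrix_inv (mat z - J) *v cadjoint W f"
        have "\<gamma>m * norm (V ?c) \<le> n * norm f"
          unfolding n_def
          by (rule bound(2)) (rule matrix_inv_apply(1)[OF keldysh_inside(2)[OF adm kel zI reg]])
        moreover have "norm (inv_into D (T z) f) \<le> norm (V ?c) + M * norm f"
          unfolding keldysh_inside(3)[OF adm kel zI reg]
          by (rule order_trans[OF norm_triangle_ineq add_left_mono[OF RM[OF zI]]])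
        then have "\<gamma>m * norm (inv_into D (T z) f) \<le> \<gamma>m * norm (V ?c) + \<gamma>m * (M * norm f)"
          using pos by (metis distrib_left mult_le_cancel_left_pos)
        ultimately have "\<gamma>m * norm (inv_into D (T z) f) \<le> (n + M * \<gamma>m) * norm f"
          by (simp add: algebra_simps)
        then show ?thesis using denom by (simp add: field_simps)
      qed
      then have "z \<notin> pseudospectrum (\<gamma>m / (n + M * \<gamma>m)) \<Omega> D T"
        using pos denom by (intro small_inverse_not_in_pseudospectrum inv) auto
      then show False using z by (simp add: n_def A0_eq)
    qed
    then show "z \<in> matrix_pseudospectrum \<delta> ?F' \<inter> ?I" using zI by (simp add: matrix_pseudospectrum_def)
  qed

  show ?upper
  proof
    fix z assume "z \<in> matrix_pseudospectrum \<delta> ?F' \<inter> ?I"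
    then have zI: "z \<in> ?I" and "sigma_inf (?F' z) < \<delta>" by (auto simp: matrix_pseudospectrum_def)
    then obtain y where y: "norm y = 1" "norm (?F' z y) < \<delta>" using sigma_inf_lessD by blast
    have S0: "S \<ge> 0" using zS[OF zI] norm_ge_zero[of z] by linarith
    define \<beta> where "\<beta> = \<delta> + (1 + S) * \<epsilon>"
    have "norm (?F z y) \<le> norm (?F' z y) + norm (?F z y - ?F' z y)"
      using norm_triangle_ineq[of "?F' z y" "?F z y - ?F' z y"] by simp
    then have Fy: "norm (?F z y) < \<beta>"
      using close_pencils[OF zI, of y] y by (simp add: \<beta>_def)
    define \<eta> where "\<eta> = \<kappa> * \<epsilon>"
    have split: "\<gamma>p = \<beta> + 2 * (\<eta> * onorm A1)" by (simp add: \<gamma>p \<beta>_def \<eta>_def algebra_simps)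
    have \<eta>0: "\<eta> \<ge> 0" using \<kappa>0 \<epsilon> by (simp add: \<eta>_def)
    have "0 \<le> S * \<epsilon>" using S0 \<epsilon> by simp
    then have "\<epsilon> \<le> \<beta>" using \<delta> by (simp add: \<beta>_def algebra_simps)
    also have "\<beta> \<le> \<gamma>p" using \<eta>0 a0 by (simp add: split)
    finally have \<epsilon>\<gamma>: "\<epsilon> \<le> \<gamma>p" .
    have \<gamma>0: "\<gamma>p > 0" using \<epsilon>\<gamma> \<epsilon> by simp
    have "\<eta> \<le> \<kappa> * \<gamma>p" unfolding \<eta>_def by (rule mult_left_mono[OF \<epsilon>\<gamma> \<kappa>0])
    then have \<eta>1: "\<eta> < 1" using small(1) by simp
    have "\<eta> * (\<eta> * \<gamma>p) \<le> \<eta> * (1 * onorm A1)"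
      using \<eta>0 \<eta>1 small(2) \<gamma>0 by (intro mult_left_mono mult_mono) auto
    moreover have "0 \<le> \<eta> * onorm A1" using \<eta>0 a0 by simp
    ultimately have \<beta>\<gamma>: "\<beta> \<le> (1 - \<eta>\<^sup>2) * \<gamma>p"
      by (simp add: split power2_eq_square algebra_simps)
    obtain x where x: "(1 - \<eta>\<^sup>2) * norm (A1 (V0 *v x) - z *\<^sub>C A0 (V0 *v x)) < \<beta> * norm x"
      using exact_pencil_small_vector[OF ctx svd svd' close(1) _ _ \<eta>1 y(1) Fy] \<epsilon>
      by (metis \<eta>_def \<kappa> less_imp_le)
    have "\<eta>\<^sup>2 < 1" using \<eta>0 \<eta>1 by (simp add: abs_square_less_1)
    have "(1 - \<eta>\<^sup>2) * norm (A1 (V0 *v x) - z *\<^sub>C A0 (V0 *v x)) < (1 - \<eta>\<^sup>2) * (\<gamma>p * norm x)"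
      using x mult_right_mono[OF \<beta>\<gamma> norm_ge_zero[of x]] by (simp only: mult.assoc)
    then have x': "norm (A1 (V0 *v x) - z *\<^sub>C A0 (V0 *v x)) < \<gamma>p * norm x"
      using \<open>\<eta>\<^sup>2 < 1\<close> by simp
    have \<delta>p: "\<gamma>p / (\<sigma> - M * \<gamma>p) > 0" using \<gamma>0 small(3) by simp
    have "z \<in> pseudospectrum (\<gamma>p / (\<sigma> - M * \<gamma>p)) \<Omega> D T"
    proof (cases "z \<in> nl_spectrum \<Omega> D T")
      case True
      then show ?thesis by (rule spectrum_subset_pseudospectrum[OF _ \<delta>p])
    next
      case reg: False
      then have inv: "invertible_on D (T z)" using in_\<Omega>[OF zI] by (simp add: nl_spectrum_def)
      let ?c = "\<lambda>f. V (matrix_inv (mat z - J) *v cadjoint W f)"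
      obtain f where f: "\<sigma> * norm f < \<gamma>p * norm (?c f)"
        using resolvent_large[OF ctx svd keldysh_inside(2)[OF adm kel zI reg] x'] unfolding \<sigma> by blast
      let ?u = "inv_into D (T z) f"
      have "norm (?c f) \<le> norm ?u + norm (R z f)"
        unfolding keldysh_inside(3)[OF adm kel zI reg] by (metis add_diff_cancel norm_triangle_ineq4)
      also have "\<dots> \<le> norm ?u + M * norm f" by (intro add_left_mono RM zI)
      finally have "\<gamma>p * norm (?c f) \<le> \<gamma>p * (norm ?u + M * norm f)"
        using \<gamma>0 by simp
      with f have "(\<sigma> - M * \<gamma>p) * norm f < \<gamma>p * norm ?u" by (simp add: algebra_simps)
      then have "norm f < \<gamma>p / (\<sigma> - M * \<gamma>p) * norm ?u"
        using small(3) by (simp add: field_simps)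
      then show ?thesis by (rule large_inverse_in_pseudospectrum[OF prob in_\<Omega>[OF zI] inv _ \<delta>p])
    qed
    then show "z \<in> pseudospectrum (\<gamma>p / (\<sigma> - M * \<gamma>p)) \<Omega> D T \<inter> ?I" using zI by blast
  qed
qed

theorem mainTheorem4:
  fixes \<Omega> :: "complex set" and D :: "'h::complex_hilbert set" and T :: "complex \<Rightarrow> 'h \<Rightarrow> 'h"
    and \<Gamma> :: "real \<Rightarrow> complex" and X :: "complex ^ 'n \<Rightarrow> 'h"
    and A0 A1 :: "complex ^ 'n \<Rightarrow> 'h"
  assumes "nonlinear_eigenproblem \<Omega> D T"
    and "admissible_contour \<Omega> D T \<Gamma>"
    and "CARD('m) \<le> CARD('n)"
    and "clinear X"
    and "A0 = contour_moment 0 D T \<Gamma> X"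
    and "A1 = contour_moment 1 D T \<Gamma> X"
    and "crank A0 = CARD('m)" and "crank A1 = CARD('m)"
  shows "\<exists>c>0. \<forall>(V :: complex ^ 'm \<Rightarrow> 'h) (W :: complex ^ 'm \<Rightarrow> 'h) (J :: complex ^ 'm ^ 'm) R
      (U0 :: complex ^ 'm \<Rightarrow> 'h) (S0 :: complex ^ 'm ^ 'm) (V0 :: complex ^ 'm ^ 'n)
      (\<epsilon> :: real) (\<delta> :: real) (A0' :: complex ^ 'n \<Rightarrow> 'h) (A1' :: complex ^ 'n \<Rightarrow> 'h)
      (U0' :: complex ^ 'm \<Rightarrow> 'h) (S0' :: complex ^ 'm ^ 'm) (V0' :: complex ^ 'm ^ 'n)
      (M :: real) (\<gamma>\<^sub>m :: real) (\<gamma>\<^sub>p :: real) (\<delta>\<^sub>m :: real) (\<delta>\<^sub>p :: real).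
      keldysh_expansion \<Omega> D T \<Gamma> V W J R \<longrightarrow>
      economized_svd A0 U0 S0 V0 \<longrightarrow>
      crank (V \<circ> cadjoint W \<circ> X \<circ> (*v) V0) = CARD('m) \<longrightarrow>
      \<epsilon> > 0 \<longrightarrow> \<delta> > 0 \<longrightarrow>
      clinear A0' \<longrightarrow> clinear A1' \<longrightarrow>
      crank A0' = CARD('m) \<longrightarrow> crank A1' = CARD('m) \<longrightarrow>
      onorm (\<lambda>x. A0 x - A0' x) \<le> \<epsilon> \<longrightarrow> onorm (\<lambda>x. A1 x - A1' x) \<le> \<epsilon> \<longrightarrow>
      economized_svd A0' U0' S0' V0' \<longrightarrow>
      M = (SUP z\<in>inside (path_image \<Gamma>). onorm (R z)) \<longrightarrow>
      \<gamma>\<^sub>m = \<delta> - (2 * onorm (pseudoinverse A0) * onorm A1 + 1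
                  + (SUP z\<in>inside (path_image \<Gamma>). cmod z)) * \<epsilon> \<longrightarrow>
      \<gamma>\<^sub>p = \<delta> + (2 * onorm (pseudoinverse A0) * onorm A1 + 1
                  + (SUP z\<in>inside (path_image \<Gamma>). cmod z)) * \<epsilon> \<longrightarrow>
      \<delta>\<^sub>m = \<gamma>\<^sub>m / (onorm (V \<circ> cadjoint W) * onorm (V \<circ> cadjoint W \<circ> X) + M * \<gamma>\<^sub>m) \<longrightarrow>
      \<delta>\<^sub>p = \<gamma>\<^sub>p / (singular_value CARD('m) (V \<circ> cadjoint W)
                  * singular_value CARD('m) (V \<circ> cadjoint W \<circ> X) - M * \<gamma>\<^sub>p) \<longrightarrow>
      \<gamma>\<^sub>m > 0 \<longrightarrow> \<gamma>\<^sub>p < c \<longrightarrow>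
      pseudospectrum \<delta>\<^sub>m \<Omega> D T \<inter> inside (path_image \<Gamma>)
        \<subseteq> matrix_pseudospectrum \<delta> (projected_pencil U0' V0' A0' A1') \<inter> inside (path_image \<Gamma>) \<and>
      matrix_pseudospectrum \<delta> (projected_pencil U0' V0' A0' A1') \<inter> inside (path_image \<Gamma>)
        \<subseteq> pseudospectrum \<delta>\<^sub>p \<Omega> D T \<inter> inside (path_image \<Gamma>)"
proof (cases "\<exists>(V :: complex ^ 'm \<Rightarrow> 'h) W J R (U0 :: complex ^ 'm \<Rightarrow> 'h) S0 (V0 :: complex ^ 'm ^ 'n).
    keldysh_expansion \<Omega> D T \<Gamma> V W J R \<and> economized_svd A0 U0 S0 V0")
  case False
  show ?thesis
    by (intro exI[of _ "1 :: real"] conjI[OF zero_less_one] allI impI) (rule notE[OF False], blast)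
next
  case True
  then obtain V W :: "complex ^ 'm \<Rightarrow> 'h" and J R and U0 :: "complex ^ 'm \<Rightarrow> 'h" and S0 and V0 :: "complex ^ 'm ^ 'n"
    where kel: "keldysh_expansion \<Omega> D T \<Gamma> V W J R" and svd: "economized_svd A0 U0 S0 V0"
    by blast
  note adm = assms(2)
  let ?I = "inside (path_image \<Gamma>)"
  define \<sigma> where "\<sigma> = singular_value CARD('m) (V \<circ> cadjoint W) * singular_value CARD('m) (V \<circ> cadjoint W \<circ> X)"
  define M where "M = (SUP z\<in>?I. onorm (R z))"
  define \<kappa> where "\<kappa> = onorm (pseudoinverse A0)"
  \<comment> \<open>The three bounds make the sine \<open>\<kappa> \<epsilon>\<close> of the angles at most one half, let the slack in \<open>\<gamma>p\<close> absorb
    the loss by these angles, and make the denominator of \<open>\<delta>p\<close> positive.\<close>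
  define c where "c = min (1 / (2 * \<kappa> + 1)) (min (onorm A1) (\<sigma> / (\<bar>M\<bar> + 1)))"
  have A0x: "A0 x = V (cadjoint W (X x))" and A1x: "A1 x = V (J *v cadjoint W (X x))" for x
    using keldysh_contour_moments[OF adm kel] assms(5,6) by simp_all
  note ctx = keldysh_linear[OF adm kel] assms(4) A0x A1x assms(7)
  have \<kappa>0: "\<kappa> \<ge> 0"
    unfolding \<kappa>_def by (rule onorm_pos_le[OF economized_svd_pseudoinverse(2)[OF svd assms(7)]])
  have \<sigma>0: "\<sigma> > 0" unfolding \<sigma>_def using singular_values_positive[OF ctx svd] by simp
  have "onorm A1 > 0"
  proof -
    have bl: "bounded_linear A1" by (intro clinear_bounded_linear moments_clinear[OF ctx])
    have "\<not> (\<forall>x. A1 x = 0)"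
    proof
      assume "\<forall>x. A1 x = 0"
      then have "range A1 = {0}" by auto
      then have "crank A1 = 0"
        unfolding crank_def using cvs.dim_le_card[of "{0}" "{}"] by (simp add: cvs.span_empty)
      then show False using assms(8) by simp
    qed
    then show ?thesis using onorm_pos_lt[OF bl] by blast
  qed
  then have c0: "c > 0" using \<kappa>0 \<sigma>0 by (simp add: c_def)
  show ?thesis
  proof (intro exI[of _ c] conjI c0 allI impI)
    fix V' W' :: "complex ^ 'm \<Rightarrow> 'h" and J' R' and U0' :: "complex ^ 'm \<Rightarrow> 'h" and S0' and V0' :: "complex ^ 'm ^ 'n"
      and \<epsilon> \<delta> :: real and B0 B1 :: "complex ^ 'n \<Rightarrow> 'h" and U1 :: "complex ^ 'm \<Rightarrow> 'h" and S1 and V1 :: "complex ^ 'm ^ 'n"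
      and M' \<gamma>m \<gamma>p \<delta>m \<delta>p :: real
    assume kel': "keldysh_expansion \<Omega> D T \<Gamma> V' W' J' R'" and svd0: "economized_svd A0 U0' S0' V0'"
      and \<epsilon>: "\<epsilon> > 0" and \<delta>: "\<delta> > 0" and lin: "clinear B0" "clinear B1"
      and close: "onorm (\<lambda>x. A0 x - B0 x) \<le> \<epsilon>" "onorm (\<lambda>x. A1 x - B1 x) \<le> \<epsilon>"
      and svd1: "economized_svd B0 U1 S1 V1"
      and M': "M' = (SUP z\<in>?I. onorm (R' z))"
      and \<gamma>m: "\<gamma>m = \<delta> - (2 * onorm (pseudoinverse A0) * onorm A1 + 1 + (SUP z\<in>?I. cmod z)) * \<epsilon>"
      and \<gamma>p: "\<gamma>p = \<delta> + (2 * onorm (pseudoinverse A0) * onorm A1 + 1 + (SUP z\<in>?I. cmod z)) * \<epsilon>"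
      and \<delta>m: "\<delta>m = \<gamma>m / (onorm (V' \<circ> cadjoint W') * onorm (V' \<circ> cadjoint W' \<circ> X) + M' * \<gamma>m)"
      and \<delta>p: "\<delta>p = \<gamma>p / (singular_value CARD('m) (V' \<circ> cadjoint W')
                  * singular_value CARD('m) (V' \<circ> cadjoint W' \<circ> X) - M' * \<gamma>p)"
      and pos: "\<gamma>m > 0" and small: "\<gamma>p < c"
    note uniq = keldysh_expansion_unique[OF adm kel' kel]
    have M_eq: "M' = M" unfolding M' M_def using uniq(2) by (intro SUP_cong) auto
    have \<sigma>': "\<sigma> = singular_value CARD('m) (V' \<circ> cadjoint W') * singular_value CARD('m) (V' \<circ> cadjoint W' \<circ> X)"
      unfolding uniq(1) \<sigma>_def ..
    have "?I \<noteq> {}"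
      using Jordan_inside_outside[of \<Gamma>] adm by (simp add: admissible_contour_def)
    then obtain z where z: "z \<in> ?I" by blast
    have "bdd_above (cmod ` ?I)"
      using bounded_interior(1)[OF adm kel] by (auto simp: bounded_iff intro: bdd_aboveI2)
    then have "cmod z \<le> (SUP z\<in>?I. cmod z)" by (rule cSUP_upper[OF z])
    then have "0 \<le> (SUP z\<in>?I. cmod z)" using norm_ge_zero[of z] by linarith
    then have "0 \<le> (2 * \<kappa> * onorm A1 + 1 + (SUP z\<in>?I. cmod z)) * \<epsilon>"
      using \<kappa>0 \<open>onorm A1 > 0\<close> \<epsilon> by (intro mult_nonneg_nonneg add_nonneg_nonneg) auto
    then have \<gamma>0: "\<gamma>p > 0" using \<delta> by (simp add: \<gamma>p \<kappa>_def)
    have "\<gamma>p < 1 / (2 * \<kappa> + 1)" using small by (simp add: c_def)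
    then have "(2 * \<kappa> + 1) * \<gamma>p < 1" using \<kappa>0 by (simp add: field_simps)
    then have s1: "2 * onorm (pseudoinverse A0) * \<gamma>p < 1"
      using \<gamma>0 by (simp add: \<kappa>_def algebra_simps)
    have s2: "\<gamma>p \<le> onorm A1" using small by (simp add: c_def)
    have "\<gamma>p < \<sigma> / (\<bar>M\<bar> + 1)" using small by (simp add: c_def)
    then have "(\<bar>M\<bar> + 1) * \<gamma>p < \<sigma>" by (simp add: field_simps)
    moreover have "M * \<gamma>p \<le> (\<bar>M\<bar> + 1) * \<gamma>p" using \<gamma>0 by (intro mult_right_mono) auto
    ultimately have s3: "M' * \<gamma>p < \<sigma>" by (simp add: M_eq)
    note incl = pseudospectra_inclusions[OF assms(1,2,4,5,6,7) kel' svd0 \<epsilon> \<delta> lin close svd1 M' refl refl \<gamma>m \<gamma>p \<sigma>' pos s1 s2 s3]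
    show "pseudospectrum \<delta>m \<Omega> D T \<inter> ?I \<subseteq> matrix_pseudospectrum \<delta> (projected_pencil U1 V1 B0 B1) \<inter> ?I"
      unfolding \<delta>m by (rule incl(1))
    show "matrix_pseudospectrum \<delta> (projected_pencil U1 V1 B0 B1) \<inter> ?I \<subseteq> pseudospectrum \<delta>p \<Omega> D T \<inter> ?I"
      unfolding \<delta>p \<sigma>'[symmetric] by (rule incl(2))
  qed
qed

end
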